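(* Let $\Omega$ be a bounded open set in $\mathbb{R}^n$ with $C^2$ regular boundary. For $m>0$ let $v_m$ be the unique minimizer of $$\min\Big\{\int_\Omega\big(|\nabla v|^2-mv\big)\,dx\ :\ v\in H^1_0(\Omega),\ |\nabla v|\le1\Big\},$$ and for $\lambda>0$ set $$E^\Omega_{m,\lambda}:=\Big\{x\in\Omega: |\nabla v_m(x)|^2\le 1-\frac{\lambda^2}{v_m^2(x)}\Big\}.$$ Then for every $\lambda>0$ and every fixed $\varepsilon>0$, $$\sup_{x\in E^\Omega_{m,\lambda}} d\big(x,\mathcal M_\lambda(\Omega)\big)\xrightarrow[m\to+\infty]{}0\qquad\text{and}\qquad \sup_{x\in\mathcal M_{\lambda+\varepsilon}(\Omega)} d\big(x,E^\Omega_{m,\lambda}\big)\xrightarrow[m\to+\infty]{}0.$$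
   Context: $d_{\partial\Omega}(x):=\min\{|x-y|:y\in\partial\Omega\}$ and $d(x,A)$ is the Euclidean distance from $x$ to a set $A$. For $x\in\Omega$, let $r(x)$ be the radius of the smallest ball containing the set $\{z\in\partial\Omega: |x-z|=d_{\partial\Omega}(x)\}$ of projections of $x$ on $\partial\Omega$. The $\lambda$-medial axis is $\mathcal M_\lambda(\Omega):=\{x\in\Omega: r(x)\ge\lambda\}$. $|\nabla v_m(x)|$ denotes the pointwise norm of the gradient of $v_m$, which is locally $C^{1,1}$ in $\Omega$. *)

theory Defs
  imports "HOL-Analysis.Analysis"
begin

(* pointwise gradient of a scalar function (meaningful where it is differentiable) *)
definition grad :: "('a::euclidean_space \<Rightarrow> real) \<Rightarrow> 'a \<Rightarrow> 'a" where
  "grad f x = (SOME g. (f has_derivative (\<lambda>h. g \<bullet> h)) (at x))"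

definition C2_on :: "'a::euclidean_space set \<Rightarrow> ('a \<Rightarrow> real) \<Rightarrow> bool" where
  "C2_on U f \<longleftrightarrow> (\<exists>Df D2f. \<forall>x\<in>U.
      (f has_derivative (\<lambda>h. Df x \<bullet> h)) (at x) \<and>
      (Df has_derivative D2f x) (at x) \<and>
      (\<forall>h. continuous_on U (\<lambda>y. D2f y h)))"

definition C2_boundary :: "'a::euclidean_space set \<Rightarrow> bool" where
  "C2_boundary \<Omega> \<longleftrightarrow> (\<forall>z\<in>frontier \<Omega>. \<exists>U \<rho>. open U \<and> z \<in> U \<and> C2_on U \<rho> \<and>
      (\<forall>x\<in>U. grad \<rho> x \<noteq> 0) \<and> \<Omega> \<inter> U = {x\<in>U. \<rho> x < 0})"

definition C1c :: "'a::euclidean_space set \<Rightarrow> ('a \<Rightarrow> real) \<Rightarrow> ('a \<Rightarrow> 'a) \<Rightarrow> bool" where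
  "C1c \<Omega> \<phi> D\<phi> \<longleftrightarrow> (\<forall>x. (\<phi> has_derivative (\<lambda>h. D\<phi> x \<bullet> h)) (at x)) \<and>
      continuous_on UNIV D\<phi> \<and> compact (closure {x. \<phi> x \<noteq> 0}) \<and>
      closure {x. \<phi> x \<noteq> 0} \<subseteq> \<Omega>"

definition L2_on :: "'a::euclidean_space set \<Rightarrow> ('a \<Rightarrow> 'b::euclidean_space) \<Rightarrow> bool" where
  "L2_on \<Omega> f \<longleftrightarrow> f \<in> borel_measurable (lebesgue_on \<Omega>) \<and>
      integrable (lebesgue_on \<Omega>) (\<lambda>x. (norm (f x))\<^sup>2)"

definition weak_grad :: "'a::euclidean_space set \<Rightarrow> ('a \<Rightarrow> real) \<Rightarrow> ('a \<Rightarrow> 'a) \<Rightarrow> bool" where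
  "weak_grad \<Omega> v g \<longleftrightarrow> L2_on \<Omega> v \<and> L2_on \<Omega> g \<and>
     (\<forall>\<phi> D\<phi>. C1c \<Omega> \<phi> D\<phi> \<longrightarrow> (\<forall>i\<in>Basis.
        integral\<^sup>L (lebesgue_on \<Omega>) (\<lambda>x. v x * (D\<phi> x \<bullet> i)) =
        - integral\<^sup>L (lebesgue_on \<Omega>) (\<lambda>x. (g x \<bullet> i) * \<phi> x)))"

definition H10 :: "'a::euclidean_space set \<Rightarrow> ('a \<Rightarrow> real) \<Rightarrow> ('a \<Rightarrow> 'a) \<Rightarrow> bool" where
  "H10 \<Omega> v g \<longleftrightarrow> weak_grad \<Omega> v g \<and>
     (\<exists>\<phi> D\<phi>. (\<forall>k::nat. C1c \<Omega> (\<phi> k) (D\<phi> k)) \<and>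
        (\<lambda>k. integral\<^sup>L (lebesgue_on \<Omega>) (\<lambda>x. (\<phi> k x - v x)\<^sup>2)) \<longlonglongrightarrow> 0 \<and>
        (\<lambda>k. integral\<^sup>L (lebesgue_on \<Omega>) (\<lambda>x. (norm (D\<phi> k x - g x))\<^sup>2)) \<longlonglongrightarrow> 0)"

definition admissible :: "'a::euclidean_space set \<Rightarrow> ('a \<Rightarrow> real) \<Rightarrow> ('a \<Rightarrow> 'a) \<Rightarrow> bool" where
  "admissible \<Omega> v g \<longleftrightarrow> H10 \<Omega> v g \<and> (AE x in lebesgue_on \<Omega>. norm (g x) \<le> 1)"

definition energy :: "'a::euclidean_space set \<Rightarrow> real \<Rightarrow> ('a \<Rightarrow> real) \<Rightarrow> ('a \<Rightarrow> 'a) \<Rightarrow> real" where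
  "energy \<Omega> m v g = integral\<^sup>L (lebesgue_on \<Omega>) (\<lambda>x. (norm (g x))\<^sup>2 - m * v x)"

definition is_minimizer :: "'a::euclidean_space set \<Rightarrow> real \<Rightarrow> ('a \<Rightarrow> real) \<Rightarrow> bool" where
  "is_minimizer \<Omega> m v \<longleftrightarrow> (\<exists>g. admissible \<Omega> v g \<and>
     (\<forall>w h. admissible \<Omega> w h \<longrightarrow> energy \<Omega> m v g \<le> energy \<Omega> m w h))"

definition proj_bd :: "'a::euclidean_space set \<Rightarrow> 'a \<Rightarrow> 'a set" where
  "proj_bd \<Omega> x = {z\<in>frontier \<Omega>. dist x z = infdist x (frontier \<Omega>)}"

definition rad :: "'a::euclidean_space set \<Rightarrow> 'a \<Rightarrow> real" where
  "rad \<Omega> x = Inf {r. \<exists>c. proj_bd \<Omega> x \<subseteq> cball c r}"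

definition medial_axis :: "'a::euclidean_space set \<Rightarrow> real \<Rightarrow> 'a set" where
  "medial_axis \<Omega> lam = {x\<in>\<Omega>. rad \<Omega> x \<ge> lam}"

definition Eset :: "'a::euclidean_space set \<Rightarrow> ('a \<Rightarrow> real) \<Rightarrow> real \<Rightarrow> 'a set" where
  "Eset \<Omega> v lam = {x\<in>\<Omega>. (norm (grad v x))\<^sup>2 \<le> 1 - lam\<^sup>2 / (v x)\<^sup>2}"

end

theory Submission
  imports Defs "HOL-Complex_Analysis.Great_Picard"
begin

text \<open>
  Let \<open>d\<close> be the distance to the complement of \<open>\<Omega>\<close>. By the Brezis--Sibony equivalence \<open>v\<^sub>m\<close> also minimizes
  the energy under the obstacle constraint \<open>v \<le> d\<close>. To avoid elliptic regularity, the obstacle problem is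
  solved at scale \<open>t\<close> with the discrete Laplacian on the whole space: its solution \<open>u\<^sub>t\<close> is the supremum of all
  subsolutions. Exhibiting subsolutions shows that \<open>u\<^sub>t\<close> is 1-Lipschitz (translates), lies above \<open>d - n/m\<close>
  (radial solutions on balls) with equality to \<open>d\<close> near the boundary (interior balls), and is semiconcave
  uniformly in \<open>m\<close> and \<open>t\<close> (averages of two translates). Semiconcavity and the lower bound on the discrete
  Laplacian make every limit \<open>u\<close> for \<open>t \<rightarrow> 0\<close> differentiable with locally Lipschitz gradient and force the
  difference quotients of \<open>u\<^sub>t\<close> to converge to \<open>\<nabla>u\<close>, so the exact discrete energy inequality passes to the
  limit and yields \<open>v\<^sub>m = u\<close>.

  Uniform convergence \<open>v\<^sub>m \<rightarrow> d\<close> and uniform semiconcavity send limits of gradients of \<open>v\<^sub>m\<close> to supergradients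
  of \<open>d\<close>, and a supergradient \<open>p\<close> of \<open>d\<close> at \<open>x\<close> satisfies \<open>|p|\<^sup>2 \<ge> 1 - r(x)\<^sup>2 / d(x)\<^sup>2\<close>; this is the first limit. For the
  second, \<open>d\<close> grows from \<open>x\<close> at rate at most \<open>sqrt (1 - r(x)\<^sup>2 / d(x)\<^sup>2)\<close>, so \<open>v\<^sub>m - s |\<cdot> - x|\<close> with a slightly larger
  slope \<open>s\<close> has a maximum close to \<open>x\<close>, where \<open>|\<nabla>v\<^sub>m| \<le> s\<close>.
\<close>

section \<open>Discrete obstacle problems\<close>

text \<open>The scale \<open>\<rho>\<close> = 2 n / m is the core radius of the radial solution: on
  a ball, - 2 \<Delta>f = m gives the parabola - r^2 / (2 \<rho>), whose slope reaches 1 at r =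
  \<rho>. Continued by a cone of slope 1, its value at the centre is \<rho> / 2 = n / m below the
  distance. The difficulty is that E is defined by pointwise gradients, while the second derivatives
  of v_m are not bounded uniformly in m. Two kinds of estimates are therefore kept apart. Upper
  bounds on second differences involve only the interior ball radius and the distance to the
  boundary, and they are the ones that survive m to infinity. Lower bounds contain 1 / \<rho>; they
  serve at fixed m, to make the limit differentiable and to identify it with v_m. Near the boundary
  an average of translates may exceed d; exact contact u = d in a collar of fixed width confines
  such modifications to the interior. In the second limit, the margin \<epsilon> pays for a gap
  between the growth rate of d at x and the slope s.\<close>

lemma norm_parallelogram:
  fixes a b :: "'a::real_inner"
  shows "(norm (a + b))\<^sup>2 + (norm (a - b))\<^sup>2 = 2 * (norm a)\<^sup>2 + 2 * (norm b)\<^sup>2"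
  by (simp add: power2_norm_eq_inner inner_simps inner_commute)

section \<open>The distance to the complement\<close>

locale bounded_domain =
  fixes \<Omega> :: "'a::euclidean_space set"
  assumes open_dom: "open \<Omega>" and bounded_dom: "bounded \<Omega>" and nonempty_dom: "\<Omega> \<noteq> {}"
begin

text \<open>Distance to the complement rather than to the frontier: on \<Omega> both agree
  (\<open>infdist_frontier_eq\<close>), and this one is a 1-Lipschitz function on the whole space
  that vanishes outside \<Omega>. Translates and averages then need no domain restrictions.\<close>

definition bdist :: "'a \<Rightarrow> real" where
  "bdist x = infdist x (- \<Omega>)"

lemma compl_closed: "closed (- \<Omega>)"
  using open_dom by auto

lemma compl_nonempty: "- \<Omega> \<noteq> {}"
  using bounded_dom not_bounded_UNIV by (metis Compl_UNIV_eq double_compl)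

lemma bdist_nonneg: "0 \<le> bdist x"
  by (simp add: bdist_def infdist_nonneg)

lemma bdist_Lipschitz: "bdist x \<le> bdist y + dist x y"
  by (simp add: bdist_def infdist_triangle)

lemma bdist_outside: "x \<notin> \<Omega> \<Longrightarrow> bdist x = 0"
  by (simp add: bdist_def)

lemma bdist_pos_iff: "0 < bdist x \<longleftrightarrow> x \<in> \<Omega>"
  using in_closed_iff_infdist_zero[OF compl_closed compl_nonempty, of x] bdist_nonneg[of x]
  by (auto simp: bdist_def)

lemma bdist_le: "z \<notin> \<Omega> \<Longrightarrow> bdist x \<le> dist x z"
  by (simp add: bdist_def infdist_le)

lemma nearest_compl_point: obtains z where "z \<notin> \<Omega>" "dist x z = bdist x"
  using infdist_attains_inf[OF compl_closed compl_nonempty, of x] unfolding bdist_def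
  by (metis ComplD)

lemma ball_bdist_subset: "ball x (bdist x) \<subseteq> \<Omega>"
  using bdist_le by (force simp: not_le[symmetric])

lemma bdist_ge_of_ball:
  assumes "ball c R \<subseteq> \<Omega>" shows "R - dist y c \<le> bdist y"
proof -
  obtain z where z: "z \<notin> \<Omega>" "dist y z = bdist y" using nearest_compl_point by blast
  then have "R \<le> dist c z" using assms by (auto simp: subset_eq not_less[symmetric])
  also have "\<dots> \<le> dist c y + dist y z" by (rule dist_triangle)
  finally show ?thesis using z by (simp add: dist_commute)
qed

text \<open>With z nearest to x, d lies below |y - z| and equals it at x. The norm lies below the
  parabola R + (|y|^2 - R^2) / (2 R), which touches it on the sphere of radius R, and the
  parallelogram law evaluates the second difference of that parabola exactly. No condition on x + h
  or x - h is involved.\<close>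

lemma bdist_second_difference:
  assumes "x \<in> \<Omega>"
  shows "bdist (x + h) + bdist (x - h) - 2 * bdist x \<le> (norm h)\<^sup>2 / bdist x"
proof -
  obtain z where z: "z \<notin> \<Omega>" "dist x z = bdist x" using nearest_compl_point by blast
  define w where "w = x - z"
  define R where "R = bdist x"
  have R: "R > 0" "norm w = R" using assms z bdist_pos_iff by (auto simp: R_def w_def dist_norm)
  have b: "norm y \<le> R + ((norm y)\<^sup>2 - R\<^sup>2) / (2*R)" for y :: 'a
  proof -
    have "0 \<le> (norm y - R)\<^sup>2" by simp
    then show ?thesis using R by (simp add: power2_eq_square field_simps)
  qed
  have "bdist (x + h) \<le> norm (w + h)" "bdist (x - h) \<le> norm (w - h)"
    using bdist_le[OF z(1), of "x+h"] bdist_le[OF z(1), of "x-h"]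
    by (simp_all add: dist_norm w_def algebra_simps)
  moreover have "((norm (w+h))\<^sup>2 - R\<^sup>2) / (2*R) + ((norm (w-h))\<^sup>2 - R\<^sup>2) / (2*R) = (norm h)\<^sup>2 / R"
  proof -
    have "(norm (w+h))\<^sup>2 - R\<^sup>2 + ((norm (w-h))\<^sup>2 - R\<^sup>2) = 2 * (norm h)\<^sup>2"
      using norm_parallelogram[of w h] R by simp
    then show ?thesis by (simp flip: add_divide_distrib)
  qed
  ultimately have "bdist (x+h) + bdist (x-h) \<le> 2*R + (norm h)\<^sup>2 / R"
    using b[of "w+h"] b[of "w-h"] by argo
  then show ?thesis by (simp add: R_def)
qed

text \<open>The discrete Laplacian is 2 n / t^2 times \<open>navg t f x - f x\<close>. It is taken
  at every point of the space instead of on a grid, so it commutes with arbitrary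
  translations.\<close>

definition navg :: "real \<Rightarrow> ('a \<Rightarrow> real) \<Rightarrow> 'a \<Rightarrow> real" where
  "navg t f x = (\<Sum>b\<in>Basis. f (x + t *\<^sub>R b) + f (x - t *\<^sub>R b)) / (2 * DIM('a))"

lemma navg_mono: "(\<And>y. f y \<le> g y) \<Longrightarrow> navg t f x \<le> navg t g x"
  unfolding navg_def by (intro divide_right_mono sum_mono add_mono) auto

lemma navg_mono_neighbours:
  assumes "\<And>b. b \<in> Basis \<Longrightarrow> f (x + t *\<^sub>R b) \<le> g (x + t *\<^sub>R b)"
    "\<And>b. b \<in> Basis \<Longrightarrow> f (x - t *\<^sub>R b) \<le> g (x - t *\<^sub>R b)"
  shows "navg t f x \<le> navg t g x"
  unfolding navg_def by (intro divide_right_mono sum_mono add_mono assms) auto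

lemma navg_nonneg: "(\<And>y. 0 \<le> f y) \<Longrightarrow> 0 \<le> navg t f x"
  unfolding navg_def by (intro divide_nonneg_nonneg sum_nonneg add_nonneg_nonneg) auto

lemma navg_add: "navg t (\<lambda>y. f y + g y) x = navg t f x + navg t g x"
  by (simp add: navg_def sum.distrib add_divide_distrib)

lemma navg_cmult: "navg t (\<lambda>y. c * f y) x = c * navg t f x"
  by (simp add: navg_def sum_distrib_left ring_distribs)

lemma navg_const: "navg t (\<lambda>y. c) x = c"
  by (simp add: navg_def)

lemma navg_shift: "navg t (\<lambda>y. f (y + h)) x = navg t f (x + h)"
  by (simp add: navg_def algebra_simps)

lemma navg_convex:
  assumes "convex_on UNIV f" shows "f x \<le> navg t f x"
proof -
  have "2 * f x \<le> f (x + t *\<^sub>R b) + f (x - t *\<^sub>R b)" for b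
  proof -
    have "f ((1 - 1/2) *\<^sub>R (x + t *\<^sub>R b) + (1/2) *\<^sub>R (x - t *\<^sub>R b))
        \<le> (1 - 1/2) * f (x + t *\<^sub>R b) + (1/2) * f (x - t *\<^sub>R b)"
      using assms by (intro convex_onD) auto
    moreover have "(1 - 1/2) *\<^sub>R (x + t *\<^sub>R b) + (1/2) *\<^sub>R (x - t *\<^sub>R b) = x"
      by (simp add: algebra_simps flip: scaleR_add_left)
    ultimately show ?thesis by simp
  qed
  then have "(\<Sum>b\<in>(Basis::'a set). 2 * f x) \<le> (\<Sum>b\<in>Basis. f (x + t *\<^sub>R b) + f (x - t *\<^sub>R b))"
    by (intro sum_mono) auto
  then show ?thesis by (simp add: navg_def field_simps)
qed

lemma navg_norm_square:
  "navg t (\<lambda>y. (norm (y - c))\<^sup>2) x = (norm (x - c))\<^sup>2 + t\<^sup>2"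
proof -
  have "(norm (x + t *\<^sub>R b - c))\<^sup>2 + (norm (x - t *\<^sub>R b - c))\<^sup>2 = 2 * (norm (x - c))\<^sup>2 + 2 * t\<^sup>2"
    if "b \<in> Basis" for b
  proof -
    have "(norm (x - c + t *\<^sub>R b))\<^sup>2 + (norm (x - c - t *\<^sub>R b))\<^sup>2
        = 2 * (norm (x - c))\<^sup>2 + 2 * (norm (t *\<^sub>R b))\<^sup>2"
      by (rule norm_parallelogram)
    then show ?thesis using that by (simp add: algebra_simps)
  qed
  then have "(\<Sum>b\<in>Basis. (norm (x + t *\<^sub>R b - c))\<^sup>2 + (norm (x - t *\<^sub>R b - c))\<^sup>2)
      = (\<Sum>b\<in>(Basis::'a set). 2 * (norm (x - c))\<^sup>2 + 2 * t\<^sup>2)" by (intro sum.cong) auto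
  then show ?thesis by (simp add: navg_def field_simps)
qed

text \<open>For \<open>\<rho> = 2 n / m\<close> the last condition is the discrete form of \<open>- 2 \<Delta>f \<le> m\<close>. It need not be restricted
  to \<open>\<Omega>\<close>, since \<open>f\<close> vanishes outside and is nonnegative.\<close>

definition dsub :: "real \<Rightarrow> real \<Rightarrow> ('a \<Rightarrow> real) set" where
  "dsub \<rho> t = {f. \<forall>x. 0 \<le> f x \<and> f x \<le> bdist x \<and> f x \<le> navg t f x + t\<^sup>2 / (2*\<rho>)}"

definition dobst :: "real \<Rightarrow> real \<Rightarrow> 'a \<Rightarrow> real" where
  "dobst \<rho> t x = (SUP f\<in>dsub \<rho> t. f x)"

section \<open>The largest discrete subsolution and its estimates\<close>

context
  fixes \<rho> t :: real
  assumes \<rho>: "\<rho> > 0"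
begin

lemma dsub_zero: "(\<lambda>x. 0) \<in> dsub \<rho> t"
  using \<rho> by (auto simp: dsub_def bdist_nonneg navg_const)

lemma dobst_upper: "f \<in> dsub \<rho> t \<Longrightarrow> f x \<le> dobst \<rho> t x"
  unfolding dobst_def by (rule cSUP_upper) (auto simp: dsub_def intro: bdd_aboveI2[where M="bdist x"])

lemma dobst_least: "(\<And>f. f \<in> dsub \<rho> t \<Longrightarrow> f x \<le> c) \<Longrightarrow> dobst \<rho> t x \<le> c"
  unfolding dobst_def using dsub_zero by (intro cSUP_least) auto

lemma dobst_le_bdist: "dobst \<rho> t x \<le> bdist x"
  by (rule dobst_least) (auto simp: dsub_def)

lemma dobst_nonneg: "0 \<le> dobst \<rho> t x"
  using dobst_upper[OF dsub_zero] .

lemma dobst_le_navg: "dobst \<rho> t x \<le> navg t (dobst \<rho> t) x + t\<^sup>2 / (2*\<rho>)"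
proof (rule dobst_least)
  fix f assume f: "f \<in> dsub \<rho> t"
  then have "f x \<le> navg t f x + t\<^sup>2 / (2*\<rho>)" by (auto simp: dsub_def)
  also have "navg t f x \<le> navg t (dobst \<rho> t) x" by (intro navg_mono dobst_upper f)
  finally show "f x \<le> navg t (dobst \<rho> t) x + t\<^sup>2 / (2*\<rho>)" by simp
qed

text \<open>Perron's argument: replacing the supremum by the smaller of the obstacle and the
  averaged value gives a subsolution that is at least as large, hence equal to it. Off the contact
  set the averaged value is the smaller one.\<close>

lemma dobst_eq_navg:
  assumes "dobst \<rho> t x < bdist x"
  shows "dobst \<rho> t x = navg t (dobst \<rho> t) x + t\<^sup>2 / (2*\<rho>)"
proof -
  define F where "F y = min (bdist y) (navg t (dobst \<rho> t) y + t\<^sup>2 / (2*\<rho>))" for y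
  have ge: "dobst \<rho> t y \<le> F y" for y
    using dobst_le_bdist dobst_le_navg by (auto simp: F_def)
  have "F \<in> dsub \<rho> t"
    unfolding dsub_def
  proof safe
    fix y
    show "0 \<le> F y" using ge[of y] dobst_nonneg[of y] by linarith
    show "F y \<le> bdist y" by (simp add: F_def)
    show "F y \<le> navg t F y + t\<^sup>2 / (2*\<rho>)"
      using navg_mono[of "dobst \<rho> t" F, OF ge, of t y] by (auto simp: F_def)
  qed
  then have "F x \<le> dobst \<rho> t x" by (rule dobst_upper)
  then show ?thesis using assms dobst_le_navg[of x] by (auto simp: F_def)
qed

text \<open>A translate by h, lowered by |h|, still lies below d because d is 1-Lipschitz. The
  maximum with the solution itself restores nonnegativity and remains a subsolution.\<close>

lemma dobst_Lipschitz: "dobst \<rho> t x \<le> dobst \<rho> t y + dist x y"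
proof -
  define h where "h = x - y"
  define F where "F z = max (dobst \<rho> t z) (dobst \<rho> t (z + h) - norm h)" for z
  have "F \<in> dsub \<rho> t"
    unfolding dsub_def
  proof safe
    fix z
    show "0 \<le> F z" using dobst_nonneg by (simp add: F_def le_max_iff_disj)
    show "F z \<le> bdist z"
      using dobst_le_bdist[of z] dobst_le_bdist[of "z+h"] bdist_Lipschitz[of "z+h" z]
      by (auto simp: F_def dist_norm)
    have "navg t (dobst \<rho> t) z \<le> navg t F z" by (intro navg_mono) (auto simp: F_def)
    moreover have "navg t (\<lambda>z. dobst \<rho> t (z + h) + (- norm h)) z \<le> navg t F z"
      by (intro navg_mono) (auto simp: F_def)
    then have "navg t (dobst \<rho> t) (z + h) - norm h \<le> navg t F z"
      by (simp only: navg_add navg_shift navg_const)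
    ultimately show "F z \<le> navg t F z + t\<^sup>2 / (2*\<rho>)"
      using dobst_le_navg[of z] dobst_le_navg[of "z+h"] by (auto simp: F_def)
  qed
  then have "F y \<le> dobst \<rho> t y" by (rule dobst_upper)
  then show ?thesis by (auto simp: F_def h_def dist_norm)
qed

text \<open>The left side is the radial solution on the ball: a parabola up to radius \<rho> and the
  cone R - r beyond. Averaging lowers the parabola by exactly t^2 / (2 \<rho>), and the remaining
  summand is convex, so this is a subsolution at every scale t, not only in the limit.\<close>

lemma dobst_ge_ball:
  assumes "ball c R \<subseteq> \<Omega>"
  shows "R - \<rho>/2 - (norm (y - c))\<^sup>2 / (2*\<rho>) + (max 0 (norm (y - c) - \<rho>))\<^sup>2 / (2*\<rho>) \<le> dobst \<rho> t y"
proof -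
  define G where "G y = (max 0 (norm (y - c) - \<rho>))\<^sup>2" for y
  define q where "q y = (R - \<rho>/2) + ((-1/(2*\<rho>)) * (norm (y - c))\<^sup>2 + (1/(2*\<rho>)) * G y)" for y
  have qle: "q y \<le> R - norm (y - c)" for y
  proof -
    have "G y \<le> (norm (y - c) - \<rho>)\<^sup>2"
      unfolding G_def by (auto simp: max_def)
    then show ?thesis using \<rho> by (simp add: q_def field_simps power2_eq_square)
  qed
  have cvx: "convex_on UNIV G"
  proof -
    have 1: "convex_on UNIV (\<lambda>y. max 0 (norm (y - c) - \<rho>))"
    proof (rule convex_onI)
      fix s :: real and x y :: 'a assume s: "0 < s" "s < 1"
      have "(1 - s) *\<^sub>R x + s *\<^sub>R y - c = (1 - s) *\<^sub>R (x - c) + s *\<^sub>R (y - c)"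
        by (simp add: algebra_simps)
      then have "norm ((1 - s) *\<^sub>R x + s *\<^sub>R y - c) \<le> (1 - s) * norm (x - c) + s * norm (y - c)"
        using s by (metis abs_of_nonneg diff_ge_0_iff_ge less_imp_le norm_scaleR norm_triangle_ineq)
      then have "norm ((1 - s) *\<^sub>R x + s *\<^sub>R y - c) - \<rho> 
          \<le> (1 - s) * (norm (x - c) - \<rho>) + s * (norm (y - c) - \<rho>)" by (simp add: algebra_simps)
      also have "\<dots> \<le> (1 - s) * max 0 (norm (x - c) - \<rho>) + s * max 0 (norm (y - c) - \<rho>)"
        using s by (intro add_mono mult_left_mono) auto
      finally show "max 0 (norm ((1 - s) *\<^sub>R x + s *\<^sub>R y - c) - \<rho>) 
          \<le> (1 - s) * max 0 (norm (x - c) - \<rho>) + s * max 0 (norm (y - c) - \<rho>)"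
        using s by (auto intro!: add_nonneg_nonneg)
    qed auto
    show ?thesis
    proof (rule convex_onI)
      fix s :: real and x y :: 'a assume s: "0 < s" "s < 1"
      let ?m = "\<lambda>y. max 0 (norm (y - c) - \<rho>)"
      have "(?m ((1 - s) *\<^sub>R x + s *\<^sub>R y))\<^sup>2 \<le> ((1 - s) * ?m x + s * ?m y)\<^sup>2"
        using convex_onD[OF 1, of s x y] s by (intro power_mono) auto
      also have "\<dots> \<le> (1 - s) * (?m x)\<^sup>2 + s * (?m y)\<^sup>2"
        using convex_onD[OF convex_power2, of s "?m x" "?m y"] s by simp
      finally show "G ((1 - s) *\<^sub>R x + s *\<^sub>R y) \<le> (1 - s) * G x + s * G y" by (simp add: G_def)
    qed auto
  qed
  have qsub: "q y \<le> navg t q y + t\<^sup>2 / (2*\<rho>)" for y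
  proof -
    have "navg t q y = (R - \<rho>/2) + ((-1/(2*\<rho>)) * ((norm (y - c))\<^sup>2 + t\<^sup>2) + (1/(2*\<rho>)) * navg t G y)"
      unfolding q_def by (simp only: navg_add navg_cmult navg_const navg_norm_square)
    moreover have "(1/(2*\<rho>)) * G y \<le> (1/(2*\<rho>)) * navg t G y"
      using \<rho> navg_convex[OF cvx] by (intro mult_left_mono) auto
    moreover have "(-1/(2*\<rho>)) * ((norm (y - c))\<^sup>2 + t\<^sup>2) = (-1/(2*\<rho>)) * (norm (y - c))\<^sup>2 - t\<^sup>2 / (2*\<rho>)"
      by (simp add: ring_distribs)
    ultimately show ?thesis unfolding q_def by linarith
  qed
  have "(\<lambda>y. max 0 (q y)) \<in> dsub \<rho> t"
    unfolding dsub_def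
  proof safe
    fix y
    show "0 \<le> max 0 (q y)" by simp
    show "max 0 (q y) \<le> bdist y"
      using qle[of y] bdist_ge_of_ball[OF assms, of y] bdist_nonneg[of y] by (auto simp: dist_norm)
    have "navg t q y \<le> navg t (\<lambda>y. max 0 (q y)) y" by (intro navg_mono) auto
    moreover have "0 \<le> navg t (\<lambda>y. max 0 (q y)) y" by (intro navg_nonneg) auto
    ultimately show "max 0 (q y) \<le> navg t (\<lambda>y. max 0 (q y)) y + t\<^sup>2 / (2*\<rho>)"
      using qsub[of y] \<rho> by auto
  qed
  from dobst_upper[OF this, of y] show ?thesis by (simp add: q_def G_def)
qed

lemma dobst_ge: "bdist x - \<rho>/2 \<le> dobst \<rho> t x"
  using dobst_ge_ball[OF ball_bdist_subset, of x x] \<rho> by simp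

text \<open>The average of the translates by h and -h, lowered by |h|^2 / \<sigma>, is a
  subsolution, and where d is at least \<sigma> / 2 it lies below d by semiconcavity of d. It is
  inserted only there. By contact it can exceed the solution only where d > \<sigma>, and the bound
  on t keeps all neighbours of such a point in the region of insertion. Hence the constant involves
  neither \<rho> nor t.\<close>

lemma dobst_second_difference:
  assumes contact: "\<And>x. bdist x \<le> \<sigma> \<Longrightarrow> dobst \<rho> t x = bdist x"
    and \<sigma>: "\<sigma> > 0" "\<bar>t\<bar> \<le> \<sigma>/2" and x: "x \<in> \<Omega>"
  shows "dobst \<rho> t (x + h) + dobst \<rho> t (x - h) - 2 * dobst \<rho> t x
      \<le> max (2/\<sigma>) (1 / bdist x) * (norm h)\<^sup>2"
proof -
  let ?u = "dobst \<rho> t"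
  have dd: "?u (y + h) + ?u (y - h) \<le> 2 * bdist y + (norm h)\<^sup>2 / bdist y" if "y \<in> \<Omega>" for y
    using bdist_second_difference[OF that, of h] dobst_le_bdist[of "y+h"] dobst_le_bdist[of "y-h"]
    by linarith
  show ?thesis
  proof (cases "bdist x \<ge> \<sigma>/2")
    case False
    then have "?u x = bdist x" using \<sigma> by (intro contact) auto
    then have "?u (x + h) + ?u (x - h) - 2 * ?u x \<le> (1 / bdist x) * (norm h)\<^sup>2"
      using dd[OF x] by simp
    also have "\<dots> \<le> max (2/\<sigma>) (1 / bdist x) * (norm h)\<^sup>2" by (intro mult_right_mono) auto
    finally show ?thesis .
  next
    case True
    define g where "g y = (1/2) * ?u (y + h) + ((1/2) * ?u (y + (-h)) + (- (norm h)\<^sup>2 / \<sigma>))" for y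
    define F where "F y = (if bdist y \<ge> \<sigma>/2 then max (?u y) (g y) else ?u y)" for y
    have gd: "g y \<le> bdist y" if "bdist y \<ge> \<sigma>/2" for y
    proof -
      have y: "y \<in> \<Omega>" using that \<sigma> bdist_pos_iff[of y] by linarith
      have "(norm h)\<^sup>2 / bdist y \<le> (norm h)\<^sup>2 / (\<sigma>/2)"
        using that \<sigma> by (intro divide_left_mono) auto
      then have "(norm h)\<^sup>2 / bdist y \<le> 2 * ((norm h)\<^sup>2 / \<sigma>)" by (simp add: mult.commute)
      then show ?thesis using dd[OF y] by (simp add: g_def)
    qed
    have uF: "?u y \<le> F y" for y by (simp add: F_def)
    have gsub: "g y \<le> navg t g y + t\<^sup>2 / (2*\<rho>)" for y
    proof -
      have "navg t g y = (1/2) * navg t ?u (y + h) + ((1/2) * navg t ?u (y + (-h)) + (- (norm h)\<^sup>2 / \<sigma>))"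
        unfolding g_def navg_add navg_cmult navg_const
        using navg_shift[of t ?u h y] navg_shift[of t ?u "-h" y] by simp
      then show ?thesis
        using dobst_le_navg[of "y+h"] dobst_le_navg[of "y+(-h)"] unfolding g_def by linarith
    qed
    have "F \<in> dsub \<rho> t"
      unfolding dsub_def
    proof safe
      fix y
      show "0 \<le> F y" using uF[of y] dobst_nonneg[of y] by linarith
      show "F y \<le> bdist y" using gd[of y] dobst_le_bdist[of y] by (auto simp: F_def)
      show "F y \<le> navg t F y + t\<^sup>2 / (2*\<rho>)"
      proof (cases "F y = ?u y")
        case True
        then show ?thesis using dobst_le_navg[of y] navg_mono[of ?u F t y, OF uF] by linarith
      next
        case False
        then have y: "bdist y \<ge> \<sigma>/2" "g y > ?u y" "F y = g y" by (auto simp: F_def split: if_splits)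
        then have "?u y \<noteq> bdist y" using gd[of y] by auto
        then have "bdist y > \<sigma>" using contact[of y] by force
        then have "bdist (y + s *\<^sub>R b) \<ge> \<sigma>/2" if "b \<in> Basis" "\<bar>s\<bar> = \<bar>t\<bar>" for b s
          using bdist_Lipschitz[of y "y + s *\<^sub>R b"] \<sigma> that by (simp add: dist_norm)
        then have "g (y + s *\<^sub>R b) \<le> F (y + s *\<^sub>R b)" if "b \<in> Basis" "\<bar>s\<bar> = \<bar>t\<bar>" for b s
          using that by (simp add: F_def)
        from this[of _ t] this[of _ "-t"] have "navg t g y \<le> navg t F y"
          by (intro navg_mono_neighbours) auto
        then show ?thesis using gsub[of y] y by linarith
      qed
    qed
    then have "F x \<le> ?u x" by (rule dobst_upper)
    then have "g x \<le> ?u x" using True by (auto simp: F_def)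
    then have "?u (x + h) + ?u (x - h) - 2 * ?u x \<le> (2/\<sigma>) * (norm h)\<^sup>2"
      unfolding g_def by simp
    also have "\<dots> \<le> max (2/\<sigma>) (1 / bdist x) * (norm h)\<^sup>2" by (intro mult_right_mono) auto
    finally show ?thesis .
  qed
qed

end

end

section \<open>Semiconcave functions\<close>

text \<open>On a segment the excess of F over its chord attains a maximum. A positive maximum is
  interior, and the strict midpoint inequality for one symmetric step inside the segment contradicts
  maximality.\<close>

lemma strict_midpoint_convex:
  fixes F :: "'a::real_normed_vector \<Rightarrow> real"
  assumes "convex S" and cont: "continuous_on S F"
    and mid: "\<And>x h. x + h \<in> S \<Longrightarrow> x - h \<in> S \<Longrightarrow> h \<noteq> 0 \<Longrightarrow> 2 * F x < F (x + h) + F (x - h)"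
  shows "convex_on S F"
proof (rule convex_onI[OF _ \<open>convex S\<close>])
  fix t :: real and x y assume t: "0 < t" "t < 1" and xy: "x \<in> S" "y \<in> S"
  show "F ((1 - t) *\<^sub>R x + t *\<^sub>R y) \<le> (1 - t) * F x + t * F y"
  proof (cases "x = y")
    case True
    then show ?thesis by (simp add: algebra_simps flip: scaleR_add_left)
  next
    case False
    define p where "p s = (1 - s) *\<^sub>R x + s *\<^sub>R y" for s
    define g where "g s = F (p s) - ((1 - s) * F x + s * F y)" for s
    have pS: "p s \<in> S" if "s \<in> {0..1}" for s
      using that xy \<open>convex S\<close> by (auto simp: p_def convex_alt)
    have "continuous_on {0..1} p" unfolding p_def by (intro continuous_intros)
    then have "continuous_on {0..1} (\<lambda>s. F (p s))"
      using continuous_on_compose2[OF cont] pS by blast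
    then have "continuous_on {0..1} g" unfolding g_def by (intro continuous_intros)
    then obtain s where s: "s \<in> {0..1}" and max: "\<And>r. r \<in> {0..1} \<Longrightarrow> g r \<le> g s"
      using continuous_attains_sup[of "{0..1::real}" g] by auto
    have "g s \<le> 0"
    proof (rule ccontr)
      assume pos: "\<not> g s \<le> 0"
      then have "s \<noteq> 0" "s \<noteq> 1" by (auto simp: g_def p_def)
      define r where "r = min s (1 - s)"
      have r: "r > 0" "s + r \<in> {0..1}" "s - r \<in> {0..1}"
        using \<open>s \<noteq> 0\<close> \<open>s \<noteq> 1\<close> s by (auto simp: r_def)
      have e: "p (s + r) = p s + r *\<^sub>R (y - x)" "p (s - r) = p s - r *\<^sub>R (y - x)"
        by (auto simp: p_def algebra_simps)
      have "2 * F (p s) < F (p (s + r)) + F (p (s - r))"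
        unfolding e
        using r pS[of "s+r"] pS[of "s-r"] False by (intro mid) (auto simp: e)
      then have "2 * g s < g (s + r) + g (s - r)"
        by (simp add: g_def algebra_simps)
      then show False using max[of "s+r"] max[of "s-r"] r by auto
    qed
    then have "g t \<le> 0" using max[of t] t by auto
    then show ?thesis by (simp add: g_def p_def)
  qed
qed

text \<open>The room between K and L makes the midpoint inequality strict, as
  \<open>strict_midpoint_convex\<close> requires.\<close>

lemma semiconcave_convex_on:
  fixes u :: "'a::euclidean_space \<Rightarrow> real"
  assumes cont: "continuous_on (ball x0 r) u"
    and up: "\<And>x h. x \<in> ball x0 r \<Longrightarrow> u (x + h) + u (x - h) - 2 * u x \<le> K * (norm h)\<^sup>2"
    and "K < L"
  shows "convex_on (ball x0 r) (\<lambda>y. L / 2 * (norm (y - x0))\<^sup>2 - u y)"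
proof (rule strict_midpoint_convex)
  show "continuous_on (ball x0 r) (\<lambda>y. L / 2 * (norm (y - x0))\<^sup>2 - u y)"
    by (intro continuous_intros cont)
  fix x h :: 'a
  assume xh: "x + h \<in> ball x0 r" "x - h \<in> ball x0 r" and "h \<noteq> 0"
  have "(1 - 1/2) *\<^sub>R (x + h) + (1/2) *\<^sub>R (x - h) \<in> ball x0 r"
    using xh convex_ball[of x0 r] by (intro convexD_alt) auto
  moreover have "(1 - 1/2) *\<^sub>R (x + h) + (1/2) *\<^sub>R (x - h) = x"
    by (simp add: algebra_simps flip: scaleR_add_left)
  ultimately have "u (x + h) + u (x - h) - 2 * u x \<le> K * (norm h)\<^sup>2" by (metis up)
  also have "K * (norm h)\<^sup>2 < L * (norm h)\<^sup>2" using \<open>h \<noteq> 0\<close> \<open>K < L\<close> by simp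
  finally have 1: "u (x + h) + u (x - h) - 2 * u x < L * (norm h)\<^sup>2" .
  have "(norm (x - x0 + h))\<^sup>2 + (norm (x - x0 - h))\<^sup>2 = 2 * (norm (x - x0))\<^sup>2 + 2 * (norm h)\<^sup>2"
    by (rule norm_parallelogram)
  then have "L / 2 * ((norm (x + h - x0))\<^sup>2 + (norm (x - h - x0))\<^sup>2)
      = L / 2 * (2 * (norm (x - x0))\<^sup>2 + 2 * (norm h)\<^sup>2)" by (simp add: algebra_simps)
  then have "L / 2 * (norm (x + h - x0))\<^sup>2 + L / 2 * (norm (x - h - x0))\<^sup>2
      = L * (norm (x - x0))\<^sup>2 + L * (norm h)\<^sup>2" by (simp add: distrib_left)
  then show "2 * (L / 2 * (norm (x - x0))\<^sup>2 - u x)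
      < L / 2 * (norm (x + h - x0))\<^sup>2 - u (x + h) + (L / 2 * (norm (x - h - x0))\<^sup>2 - u (x - h))"
    using 1 by simp
qed auto

text \<open>Up to an error of order L |h|, slopes of u along h decrease. So the increment over a
  fraction t of h is controlled from below by the forward increment over h, and in
  \<open>semiconcave_backward\<close> from above by the backward one. In
  \<open>w_difference_quotient\<close> this controls a vanishing step by a fixed one.\<close>

lemma semiconcave_forward:
  fixes u :: "'a::euclidean_space \<Rightarrow> real"
  assumes cvx: "convex_on (ball x0 r) (\<lambda>y. L / 2 * (norm (y - x0))\<^sup>2 - u y)"
    and "0 \<le> t" "t \<le> 1" "norm h < r" "0 \<le> L"
  shows "t * (u (x0 + h) - u x0) - t * L / 2 * (norm h)\<^sup>2 \<le> u (x0 + t *\<^sub>R h) - u x0"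
proof -
  have x: "x0 \<in> ball x0 r" "x0 + h \<in> ball x0 r"
    using assms le_less_trans[OF norm_ge_zero] by (auto simp: dist_norm)
  have e: "(1 - t) *\<^sub>R x0 + t *\<^sub>R (x0 + h) = x0 + t *\<^sub>R h" by (simp add: algebra_simps)
  have "L / 2 * (norm (t *\<^sub>R h))\<^sup>2 - u (x0 + t *\<^sub>R h) \<le> (1 - t) * (- u x0) + t * (L / 2 * (norm h)\<^sup>2 - u (x0 + h))"
    using convex_onD[OF cvx \<open>0 \<le> t\<close> \<open>t \<le> 1\<close> x] unfolding e by simp
  moreover have "L / 2 * (norm (t *\<^sub>R h))\<^sup>2 \<ge> 0" using \<open>0 \<le> L\<close> by simp
  ultimately show ?thesis by (simp add: algebra_simps)
qed

lemma semiconcave_backward: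
  fixes u :: "'a::euclidean_space \<Rightarrow> real"
  assumes cvx: "convex_on (ball x0 r) (\<lambda>y. L / 2 * (norm (y - x0))\<^sup>2 - u y)"
    and "0 \<le> t" "t \<le> 1" "norm h < r" "0 \<le> L"
  shows "u (x0 + t *\<^sub>R h) - u x0 \<le> t * (u x0 - u (x0 - h)) + t * L * (norm h)\<^sup>2"
proof -
  have "norm (t *\<^sub>R h) \<le> norm h" using assms by (simp add: mult_left_le_one_le)
  then have x: "x0 + t *\<^sub>R h \<in> ball x0 r" "x0 - h \<in> ball x0 r"
    using assms by (auto simp: dist_norm)
  \<comment> \<open>The weight for which x0 is the barycentre of x0 + t h and x0 - h.\<close>
  define l where "l = t / (1 + t)"
  have l: "0 \<le> l" "l \<le> 1" "l * (1 + t) = t" "(1 - l) * (1 + t) = 1"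
    using assms by (auto simp: l_def field_simps)
  have e: "(1 - l) *\<^sub>R (x0 + t *\<^sub>R h) + l *\<^sub>R (x0 - h) = x0"
  proof -
    have "(1 - l) *\<^sub>R (x0 + t *\<^sub>R h) + l *\<^sub>R (x0 - h) = x0 + ((1 - l) * t - l) *\<^sub>R h"
      by (simp add: algebra_simps)
    moreover have "(1 - l) * t - l = 0" using l(3) by (simp add: algebra_simps)
    ultimately show ?thesis by simp
  qed
  let ?A = "L / 2 * (t\<^sup>2 * (norm h)\<^sup>2) - u (x0 + t *\<^sub>R h)"
  let ?B = "L / 2 * (norm h)\<^sup>2 - u (x0 - h)"
  from convex_onD[OF cvx l(1,2) x] have "- u x0 \<le> (1 - l) * ?A + l * ?B"
    unfolding e by (simp add: power_mult_distrib)
  then have "(1 + t) * (- u x0) \<le> (1 + t) * ((1 - l) * ?A + l * ?B)"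
    using assms by (intro mult_left_mono) auto
  also have "\<dots> = ((1 - l) * (1 + t)) * ?A + (l * (1 + t)) * ?B" by (simp add: algebra_simps)
  also have "\<dots> = ?A + t * ?B" by (simp only: l mult_1)
  finally have "u (x0 + t *\<^sub>R h) - u x0 \<le> t * (u x0 - u (x0 - h)) + L / 2 * (norm h)\<^sup>2 * (t\<^sup>2 + t)"
    by (simp add: algebra_simps add_divide_distrib)
  also have "L / 2 * (norm h)\<^sup>2 * (t\<^sup>2 + t) \<le> L / 2 * (norm h)\<^sup>2 * (t + t)"
    using assms by (intro mult_left_mono add_right_mono) (auto simp: power2_eq_square mult_left_le)
  finally show ?thesis by (simp add: algebra_simps)
qed

text \<open>One-sided control in every direction and two-sided control along the coordinate axes is
  enough: the axes give the partial derivatives, and writing \<open>x0 + h\<close> as the barycentre of the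
  points \<open>x0 + DIM * (h \<bullet> b) b\<close> transfers the lower bound to all directions.\<close>

lemma semiconcave_quadratic_bound:
  fixes u :: "'a::euclidean_space \<Rightarrow> real" and K K' :: real
  assumes cont: "continuous_on (ball x0 r) u" and "r > 0" "K \<ge> 0" "K' \<ge> 0"
    and up: "\<And>x h. x \<in> ball x0 r \<Longrightarrow> u (x + h) + u (x - h) - 2 * u x \<le> K * (norm h)\<^sup>2"
    and low: "\<And>b s. b \<in> Basis \<Longrightarrow> \<bar>s\<bar> < r \<Longrightarrow> u (x0 + s *\<^sub>R b) + u (x0 - s *\<^sub>R b) - 2 * u x0 \<ge> - K' * s\<^sup>2"
  shows "\<exists>p. \<forall>h. DIM('a) * norm h < r \<longrightarrow>
    \<bar>u (x0 + h) - u x0 - p \<bullet> h\<bar> \<le> (DIM('a) * (K' + K + 1) + K) * (norm h)\<^sup>2"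
proof -
  define L where "L = K + 1"
  define F where "F y = L / 2 * (norm (y - x0))\<^sup>2 - u y" for y
  let ?n = "real DIM('a)"
  have n: "?n \<ge> 1" by (simp add: Suc_leI)
  have cvx: "convex_on (ball x0 r) F"
    unfolding F_def using semiconcave_convex_on[OF cont up, of L] by (simp add: L_def)
  have "\<exists>q. \<forall>s. \<bar>s\<bar> < r \<longrightarrow> F (x0 + s *\<^sub>R b) \<ge> F x0 + q * s" if b: "b \<in> Basis" for b
  proof -
    have c1: "convex_on {-r<..<r} (\<lambda>s. F (x0 + s *\<^sub>R b))"
    proof (rule convex_onI)
      fix t x y :: real assume t: "0 < t" "t < 1" and xy: "x \<in> {-r<..<r}" "y \<in> {-r<..<r}"
      have e: "x0 + ((1 - t) * x + t * y) *\<^sub>R b = (1 - t) *\<^sub>R (x0 + x *\<^sub>R b) + t *\<^sub>R (x0 + y *\<^sub>R b)"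
        by (simp add: algebra_simps)
      show "F (x0 + ((1 - t) *\<^sub>R x + t *\<^sub>R y) *\<^sub>R b) \<le> (1 - t) * F (x0 + x *\<^sub>R b) + t * F (x0 + y *\<^sub>R b)"
        unfolding real_scaleR_def e using t xy b
        by (intro convex_onD[OF cvx]) (auto simp: dist_norm)
    qed auto
    \<comment> \<open>The infimum of the right difference quotients at 0 is a subgradient of the
      convex restriction of F to the axis.\<close>
    define q where "q = Inf ((\<lambda>t. (F (x0 + 0 *\<^sub>R b) - F (x0 + t *\<^sub>R b)) / (0 - t)) ` ({0<..} \<inter> {-r<..<r}))"
    have "F (x0 + s *\<^sub>R b) \<ge> F (x0 + 0 *\<^sub>R b) + q * (s - 0)" if "\<bar>s\<bar> < r" for s
      unfolding q_def using that \<open>r > 0\<close>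
      by (intro convex_le_Inf_differential[OF c1]) (auto simp: interior_open abs_less_iff)
    then have "\<forall>s. \<bar>s\<bar> < r \<longrightarrow> F (x0 + s *\<^sub>R b) \<ge> F x0 + q * s" by simp
    then show ?thesis by blast
  qed
  then obtain q where q: "\<And>b s. b \<in> Basis \<Longrightarrow> \<bar>s\<bar> < r \<Longrightarrow> F (x0 + s *\<^sub>R b) \<ge> F x0 + q b * s"
    by metis
  define p where "p = (\<Sum>b\<in>Basis. (- q b) *\<^sub>R b)"
  have pb: "p \<bullet> b = - q b" if "b \<in> Basis" for b
    using that by (simp add: p_def inner_sum_left inner_Basis if_distrib cong: if_cong)
  \<comment> \<open>The subgradient inequality at -s bounds u from above at x0 - s b, and
    \<open>low\<close> turns this into a lower bound at x0 + s b.\<close>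
  have lo1: "u (x0 + s *\<^sub>R b) \<ge> u x0 + p \<bullet> b * s - (K' + L/2) * s\<^sup>2" if "b \<in> Basis" "\<bar>s\<bar> < r" for b s
  proof -
    have "u (x0 + (- s) *\<^sub>R b) \<le> u x0 - p \<bullet> b * s + L/2 * s\<^sup>2"
      using q[of b "-s"] that by (simp add: F_def pb)
    then show ?thesis using low[of b s] that by (simp add: algebra_simps)
  qed
  have lo: "u (x0 + h) \<ge> u x0 + p \<bullet> h - ?n * (K' + L) * (norm h)\<^sup>2" if h: "?n * norm h < r" for h
  proof -
    have hb: "\<bar>?n * (h \<bullet> b)\<bar> < r" if "b \<in> Basis" for b
    proof -
      have "?n * \<bar>h \<bullet> b\<bar> \<le> ?n * norm h" using that by (intro mult_left_mono Basis_le_norm) auto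
      then have "?n * \<bar>h \<bullet> b\<bar> < r" using h by linarith
      then show ?thesis by (simp add: abs_mult)
    qed
    have "F (\<Sum>b\<in>Basis. (1/?n) *\<^sub>R (x0 + (?n * (h \<bullet> b)) *\<^sub>R b)) \<le> (\<Sum>b\<in>Basis. (1/?n) * F (x0 + (?n * (h \<bullet> b)) *\<^sub>R b))"
      using hb by (intro convex_on_sum[OF _ _ cvx]) (auto simp: dist_norm)
    moreover have "(\<Sum>b\<in>Basis. (1/?n) *\<^sub>R (x0 + (?n * (h \<bullet> b)) *\<^sub>R b)) = x0 + h"
      by (simp add: scaleR_add_right sum.distrib euclidean_representation sum_constant_scaleR)
    moreover have "F (x0 + h) = L/2 * (norm h)\<^sup>2 - u (x0 + h)" by (simp add: F_def)
    moreover have "(\<Sum>b\<in>Basis. (1/?n) * F (x0 + (?n * (h \<bullet> b)) *\<^sub>R b))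
       \<le> (\<Sum>b\<in>Basis. ?n * (K' + L) * (h \<bullet> b)\<^sup>2 - p \<bullet> b * (h \<bullet> b) - (1/?n) * u x0)"
    proof (rule sum_mono)
      fix b :: 'a assume b: "b \<in> Basis"
      have "F (x0 + (?n * (h \<bullet> b)) *\<^sub>R b) \<le> (K' + L) * (?n * (h \<bullet> b))\<^sup>2 - p \<bullet> b * (?n * (h \<bullet> b)) - u x0"
        using lo1[OF b hb[OF b]] b by (simp add: F_def algebra_simps)
      then have "(1/?n) * F (x0 + (?n * (h \<bullet> b)) *\<^sub>R b) \<le> (1/?n) * ((K' + L) * (?n * (h \<bullet> b))\<^sup>2 - p \<bullet> b * (?n * (h \<bullet> b)) - u x0)"
        by (intro mult_left_mono) auto
      also have "\<dots> = ?n * (K' + L) * (h \<bullet> b)\<^sup>2 - p \<bullet> b * (h \<bullet> b) - (1/?n) * u x0"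
        by (simp add: power2_eq_square field_simps)
      finally show "(1/?n) * F (x0 + (?n * (h \<bullet> b)) *\<^sub>R b) \<le> ?n * (K' + L) * (h \<bullet> b)\<^sup>2 - p \<bullet> b * (h \<bullet> b) - (1/?n) * u x0" .
    qed
    moreover have "(\<Sum>b\<in>Basis. ?n * (K' + L) * (h \<bullet> b)\<^sup>2 - p \<bullet> b * (h \<bullet> b) - (1/?n) * u x0)
       = ?n * (K' + L) * (norm h)\<^sup>2 - p \<bullet> h - u x0"
    proof -
      have "(\<Sum>b\<in>Basis. (h \<bullet> b)\<^sup>2) = (norm h)\<^sup>2"
        unfolding power2_norm_eq_inner[of h] by (simp add: power2_eq_square euclidean_inner[of h h])
      moreover have "(\<Sum>b\<in>Basis. p \<bullet> b * (h \<bullet> b)) = p \<bullet> h" by (rule euclidean_inner[symmetric])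
      ultimately show ?thesis by (simp add: sum_subtractf flip: sum_distrib_left)
    qed
    moreover have "L/2 * (norm h)\<^sup>2 \<ge> 0" using \<open>K \<ge> 0\<close> by (simp add: L_def)
    ultimately show ?thesis by simp
  qed
  have "\<bar>u (x0 + h) - u x0 - p \<bullet> h\<bar> \<le> (?n * (K' + K + 1) + K) * (norm h)\<^sup>2" if h: "?n * norm h < r" for h
  proof -
    \<comment> \<open>The upper bound at h follows from the lower bound at -h and the bound on the
      second difference.\<close>
    have "u (x0 + h) + u (x0 - h) - 2 * u x0 \<le> K * (norm h)\<^sup>2" using \<open>r > 0\<close> by (intro up) auto
    moreover have "u (x0 + (-h)) \<ge> u x0 + p \<bullet> (-h) - ?n * (K' + L) * (norm (-h))\<^sup>2"
      using h by (intro lo) auto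
    moreover have "0 \<le> K * (norm h)\<^sup>2" using \<open>K \<ge> 0\<close> by simp
    ultimately show ?thesis using lo[OF h] by (simp add: L_def algebra_simps)
  qed
  then show ?thesis by blast
qed

lemma quadratic_bound_has_derivative:
  fixes u :: "'a::euclidean_space \<Rightarrow> real"
  assumes "r > 0" and b: "\<And>h. norm h < r \<Longrightarrow> \<bar>u (x + h) - u x - p \<bullet> h\<bar> \<le> Q * (norm h)\<^sup>2"
  shows "(u has_derivative (\<lambda>h. p \<bullet> h)) (at x)"
proof (rule has_derivativeI_sandwich[OF \<open>r > 0\<close>, where H = "\<lambda>y. Q * norm (y - x)"])
  show "bounded_linear ((\<bullet>) p)" by (rule bounded_linear_inner_right)
  fix y assume "y \<noteq> x" "dist y x < r"
  then have "\<bar>u y - u x - p \<bullet> (y - x)\<bar> \<le> Q * (norm (y - x))\<^sup>2"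
    using b[of "y - x"] by (simp add: dist_norm)
  then show "norm (u y - u x - p \<bullet> (y - x)) / norm (y - x) \<le> Q * norm (y - x)"
    using \<open>y \<noteq> x\<close> by (simp add: field_simps power2_eq_square)
next
  show "((\<lambda>y. Q * norm (y - x)) \<longlongrightarrow> 0) (at x)"
    by (auto intro!: tendsto_eq_intros)
qed

text \<open>Expand u at y + w from y and from x0, with w of length |y - x0| in the direction of the
  gradient difference. The three expansions used have errors Q s^2, Q s^2 and Q (2 s)^2, which add
  up to the factor 6.\<close>

lemma quadratic_bound_gradient_Lipschitz:
  fixes u :: "'a::euclidean_space \<Rightarrow> real"
  assumes b: "\<And>y h. y \<in> ball x0 r \<Longrightarrow> norm h < r \<Longrightarrow> \<bar>u (y + h) - u y - p y \<bullet> h\<bar> \<le> Q * (norm h)\<^sup>2"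
    and y: "2 * norm (y - x0) < r" and "Q \<ge> 0"
  shows "norm (p y - p x0) \<le> 6 * Q * norm (y - x0)"
proof (cases "p y = p x0 \<or> y = x0")
  case True
  then show ?thesis using \<open>Q \<ge> 0\<close> by auto
next
  case False
  define s where "s = norm (y - x0)"
  define w where "w = (s / norm (p y - p x0)) *\<^sub>R (p y - p x0)"
  have s: "s > 0" "2 * s < r" using False y by (auto simp: s_def)
  have w: "norm w = s" using False s by (simp add: w_def)
  have ws: "norm (y - x0 + w) \<le> 2 * s" using norm_triangle_ineq[of "y - x0" w] w by (simp add: s_def)
  have 1: "\<bar>u (y + w) - u y - p y \<bullet> w\<bar> \<le> Q * s\<^sup>2"
    using b[of y w] s w unfolding s_def by (simp add: dist_norm norm_minus_commute[of x0 y])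
  have 2: "\<bar>u y - u x0 - p x0 \<bullet> (y - x0)\<bar> \<le> Q * s\<^sup>2"
  proof -
    have "norm (y - x0) < r" using s unfolding s_def by linarith
    then show ?thesis using b[of x0 "y - x0"] by (simp add: s_def le_less_trans[OF norm_ge_zero])
  qed
  have "\<bar>u (y + w) - u x0 - p x0 \<bullet> (y - x0 + w)\<bar> \<le> Q * (norm (y - x0 + w))\<^sup>2"
    using b[of x0 "y - x0 + w"] s ws by simp
  also have "\<dots> \<le> Q * (2 * s)\<^sup>2" using ws \<open>Q \<ge> 0\<close> by (intro mult_left_mono power_mono) auto
  finally have 3: "\<bar>u (y + w) - u x0 - p x0 \<bullet> (y - x0) - p x0 \<bullet> w\<bar> \<le> 4 * (Q * s\<^sup>2)"
    by (simp add: inner_add_right power_mult_distrib algebra_simps)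
  have "(p y - p x0) \<bullet> w = s * norm (p y - p x0)"
    using False by (simp add: w_def power2_eq_square flip: power2_norm_eq_inner)
  then have "s * norm (p y - p x0) \<le> 6 * (Q * s\<^sup>2)"
    using 1 2 3 unfolding inner_diff_left by linarith
  also have "\<dots> = s * (6 * Q * s)" by (simp add: power2_eq_square)
  finally have "s * norm (p y - p x0) \<le> s * (6 * Q * s)" .
  then show ?thesis using s by (simp add: s_def)
qed

section \<open>Domains with twice differentiable boundary\<close>

lemma grad_eqI:
  assumes "(f has_derivative (\<lambda>h. g \<bullet> h)) (at x)"
  shows "grad f x = g"
proof -
  have "(f has_derivative (\<lambda>h. grad f x \<bullet> h)) (at x)"
    unfolding grad_def using assms by (rule someI)
  then have "(\<lambda>h. grad f x \<bullet> h) = (\<lambda>h. g \<bullet> h)" using assms by (rule has_derivative_unique)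
  then have "(grad f x - g) \<bullet> h = 0" for h by (simp add: inner_diff_left fun_eq_iff)
  then show ?thesis by (metis inner_eq_zero_iff right_minus_eq)
qed

lemma norm_diff_scaleR_square:
  fixes a w :: "'a::real_inner"
  shows "(norm (a - t *\<^sub>R w))\<^sup>2 = (norm a)\<^sup>2 - 2 * t * (w \<bullet> a) + t\<^sup>2 * (norm w)\<^sup>2"
  unfolding power2_norm_eq_inner
  by (simp add: inner_diff_left inner_diff_right inner_commute power2_eq_square algebra_simps)

text \<open>Continuity is given for each direction of the second derivative separately, so its
  operator norm is bounded by the sum of the bounds over the basis. The mean value inequality is
  used twice: for the gradient, and for f minus its linear part along the segment.\<close>

lemma C2_on_Taylor:
  fixes f :: "'a::euclidean_space \<Rightarrow> real"
  assumes "open U" "C2_on U f" "z0 \<in> U"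
  obtains r M where "r > 0" "M \<ge> 0" "ball z0 r \<subseteq> U"
    "\<And>z w. z \<in> ball z0 r \<Longrightarrow> z + w \<in> ball z0 r \<Longrightarrow> \<bar>f (z + w) - f z - grad f z \<bullet> w\<bar> \<le> M * (norm w)\<^sup>2"
    "continuous_on (ball z0 r) (grad f)" "continuous_on (ball z0 r) f"
proof -
  obtain Df D2f where D0: "\<forall>x\<in>U. (f has_derivative (\<lambda>h. Df x \<bullet> h)) (at x) \<and>
      (Df has_derivative D2f x) (at x) \<and> (\<forall>h. continuous_on U (\<lambda>y. D2f y h))"
    using \<open>C2_on U f\<close> unfolding C2_on_def by blast
  have D: "\<And>x. x \<in> U \<Longrightarrow> (f has_derivative (\<lambda>h. Df x \<bullet> h)) (at x)"
      "\<And>x. x \<in> U \<Longrightarrow> (Df has_derivative D2f x) (at x)"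
      "\<And>h. continuous_on U (\<lambda>y. D2f y h)"
    using D0 \<open>z0 \<in> U\<close> by auto
  obtain r where r: "r > 0" "cball z0 r \<subseteq> U" using assms open_contains_cball by blast
  have "\<exists>B. \<forall>y\<in>cball z0 r. norm (D2f y b) \<le> B" for b
  proof -
    have "bounded ((\<lambda>y. D2f y b) ` cball z0 r)"
      using continuous_on_subset[OF D(3) r(2)] by (intro compact_imp_bounded compact_continuous_image) auto
    then show ?thesis by (auto simp: bounded_iff)
  qed
  then obtain B where B: "\<And>b y. y \<in> cball z0 r \<Longrightarrow> norm (D2f y b) \<le> B b" by metis
  have B0: "B b \<ge> 0" for b using B[of z0 b] r norm_ge_zero[of "D2f z0 b"] by (simp del: norm_ge_zero)
  define M where "M = (\<Sum>b\<in>Basis. B b)"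
  have M: "M \<ge> 0" unfolding M_def by (intro sum_nonneg B0)
  have on: "onorm (D2f y) \<le> M" if y: "y \<in> cball z0 r" for y
  proof (rule onorm_le)
    fix h :: 'a
    have lin: "linear (D2f y)" using D(2) y r has_derivative_linear by blast
    have "D2f y h = (\<Sum>b\<in>Basis. (h \<bullet> b) *\<^sub>R D2f y b)"
      by (subst (1) euclidean_representation[of h, symmetric]) (simp add: linear_sum[OF lin] linear_cmul[OF lin])
    also have "norm \<dots> \<le> (\<Sum>b\<in>Basis. B b * norm h)"
    proof (rule sum_norm_le)
      fix b :: 'a assume "b \<in> Basis"
      then have "\<bar>h \<bullet> b\<bar> * norm (D2f y b) \<le> norm h * B b"
        using B[OF y] by (intro mult_mono Basis_le_norm) auto
      then show "norm ((h \<bullet> b) *\<^sub>R D2f y b) \<le> B b * norm h" by (simp add: mult.commute)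
    qed
    finally show "norm (D2f y h) \<le> M * norm h" by (simp add: M_def sum_distrib_right)
  qed
  have g: "grad f y = Df y" if "y \<in> U" for y using D(1)[OF that] by (rule grad_eqI)
  have sub: "ball z0 r \<subseteq> cball z0 r" "ball z0 r \<subseteq> U" using r by auto
  show ?thesis
  proof (rule that[OF \<open>r > 0\<close> M sub(2)])
    have "continuous_on (ball z0 r) Df"
      using D(2) sub by (meson continuous_at_imp_continuous_on has_derivative_continuous subset_eq)
    then show "continuous_on (ball z0 r) (grad f)"
      using g sub by (subst continuous_on_cong[OF refl, of _ _ Df]) auto
    show "continuous_on (ball z0 r) f"
      using D(1) sub by (meson continuous_at_imp_continuous_on has_derivative_continuous subset_eq)
    fix z w assume z: "z \<in> ball z0 r" "z + w \<in> ball z0 r"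
    let ?S = "closed_segment z (z + w)"
    have S: "?S \<subseteq> cball z0 r" using z by (intro closed_segment_subset) auto
    have lip: "norm (Df y - Df z) \<le> M * norm w" if "y \<in> ?S" for y
    proof -
      have "norm (Df y - Df z) \<le> M * norm (y - z)"
        using S that z r(2)
        by (intro differentiable_bound[OF convex_cball[of z0 r], where f' = D2f] on
            has_derivative_at_withinI[OF D(2)]) auto
      also have "\<dots> \<le> M * norm w"
        using segment_bound1[OF that] M by (intro mult_left_mono) auto
      finally show ?thesis .
    qed
    have "norm ((f (z + w) - Df z \<bullet> (z + w)) - (f z - Df z \<bullet> z)) \<le> (M * norm w) * norm (z + w - z)"
    proof (rule differentiable_bound[OF convex_closed_segment[of z "z+w"]])
      fix y assume y: "y \<in> ?S"
      then have "(f has_derivative (\<lambda>h. Df y \<bullet> h)) (at y within ?S)"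
        using S r by (intro has_derivative_at_withinI[OF D(1)]) auto
      then show "((\<lambda>y. f y - Df z \<bullet> y) has_derivative (\<lambda>h. (Df y - Df z) \<bullet> h)) (at y within ?S)"
        by (auto intro!: derivative_eq_intros simp: inner_diff_left)
      show "onorm (\<lambda>h. (Df y - Df z) \<bullet> h) \<le> M * norm w"
      proof (rule onorm_le)
        fix h
        have "norm ((Df y - Df z) \<bullet> h) \<le> norm (Df y - Df z) * norm h"
          by (simp add: Cauchy_Schwarz_ineq2)
        also have "\<dots> \<le> M * norm w * norm h" using lip[OF y] by (intro mult_right_mono) auto
        finally show "norm ((Df y - Df z) \<bullet> h) \<le> M * norm w * norm h" .
      qed
    qed auto
    then show "\<bar>f (z + w) - f z - grad f z \<bullet> w\<bar> \<le> M * (norm w)\<^sup>2"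
      using g[of z] z sub by (auto simp: inner_add_right power2_eq_square algebra_simps)
  qed
qed

section \<open>Exterior points and interior tangent balls\<close>

context bounded_domain
begin

lemma nearest_in_frontier:
  assumes "x \<in> \<Omega>" "z \<notin> \<Omega>" "dist x z = bdist x"
  shows "z \<in> frontier \<Omega>"
proof -
  have "bdist x > 0" using assms bdist_pos_iff by auto
  then have "cball x (bdist x) \<subseteq> closure \<Omega>"
    using closure_mono[OF ball_bdist_subset[of x]] by simp
  then show ?thesis using assms open_dom by (auto simp: frontier_def interior_open)
qed

lemma frontier_not_in: "z \<in> frontier \<Omega> \<Longrightarrow> z \<notin> \<Omega>"
  using open_dom by (auto simp: frontier_def interior_open)

lemma infdist_frontier_eq:
  assumes "x \<in> \<Omega>" shows "infdist x (frontier \<Omega>) = bdist x"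
proof (rule antisym)
  obtain z where z: "z \<notin> \<Omega>" "dist x z = bdist x" using nearest_compl_point by blast
  then show "infdist x (frontier \<Omega>) \<le> bdist x"
    using nearest_in_frontier[OF assms z] by (metis infdist_le)
  have "frontier \<Omega> \<noteq> {}" using nearest_in_frontier[OF assms z] by auto
  then obtain y where "y \<in> frontier \<Omega>" "infdist x (frontier \<Omega>) = dist x y"
    using infdist_attains_inf[OF frontier_closed] by metis
  then show "bdist x \<le> infdist x (frontier \<Omega>)" using bdist_le frontier_not_in by auto
qed

lemma proj_bd_eq:
  assumes "x \<in> \<Omega>" shows "proj_bd \<Omega> x = {z. z \<notin> \<Omega> \<and> dist x z = bdist x}"
  using nearest_in_frontier[OF assms] frontier_not_in infdist_frontier_eq[OF assms]
  by (auto simp: proj_bd_def)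

lemma frontier_defining_zero:
  assumes "open U" "z \<in> U" "z \<in> frontier \<Omega>" "\<Omega> \<inter> U = {x\<in>U. f x < (0::real)}" "continuous_on U f"
  shows "f z = 0"
proof -
  have "\<not> f z < 0" using assms frontier_not_in by blast
  moreover have "\<not> f z > 0"
  proof
    assume "f z > 0"
    have "open (U \<inter> f -` {0<..})"
      using assms by (intro continuous_open_preimage) auto
    moreover have "U \<inter> f -` {0<..} = {x\<in>U. f x > 0}" by auto
    ultimately have "open {x\<in>U. f x > 0}" by simp
    moreover have "z \<in> {x\<in>U. f x > 0}" using \<open>f z > 0\<close> assms by auto
    moreover have "{x\<in>U. f x > 0} \<inter> \<Omega> = {}" using assms(4) by force
    ultimately have "z \<notin> closure \<Omega>"
      using open_Int_closure_eq_empty[of "{x\<in>U. f x > 0}" \<Omega>] by auto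
    then show False using assms(3) by (simp add: frontier_def)
  qed
  ultimately show ?thesis by linarith
qed

text \<open>A small step along the gradient of the defining function makes it positive. That the
  exterior reaches every boundary point is what lets \<open>admissible_le_bdist\<close> extract
  boundary values from statements that hold almost everywhere.\<close>

lemma exterior_near_frontier:
  assumes "C2_boundary \<Omega>" "z \<in> frontier \<Omega>" "e > 0"
  obtains y where "dist z y < e" "y \<notin> closure \<Omega>"
proof -
  obtain U f where U: "open U" "z \<in> U" "C2_on U f" "\<And>x. x \<in> U \<Longrightarrow> grad f x \<noteq> 0" "\<Omega> \<inter> U = {x\<in>U. f x < 0}"
    using assms(1,2) unfolding C2_boundary_def by metis
  obtain r M where T: "r > 0" "M \<ge> 0" "ball z r \<subseteq> U"
    "\<And>y w. y \<in> ball z r \<Longrightarrow> y + w \<in> ball z r \<Longrightarrow> \<bar>f (y + w) - f y - grad f y \<bullet> w\<bar> \<le> M * (norm w)\<^sup>2"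
    "continuous_on (ball z r) f"
    using C2_on_Taylor[OF U(1,3,2)] by metis
  have V: "\<Omega> \<inter> ball z r = {x\<in>ball z r. f x < 0}" using U(5) T(3) by blast
  have z0: "f z = 0"
    using T(1) by (intro frontier_defining_zero[OF open_ball _ assms(2) V T(5)]) simp
  define g where "g = grad f z"
  have g: "g \<noteq> 0" using U by (simp add: g_def)
  \<comment> \<open>The first bound keeps the displacement s |g| within e / 2 and r / 2; the second
    makes the Taylor error M s^2 |g|^2 smaller than the linear gain s |g|^2.\<close>
  define s where "s = min (min (e/2) (r/2) / norm g) (1 / (2 * (M + 1)))"
  have s: "s > 0" using g T assms by (simp add: s_def)
  have "s * norm g \<le> (min (e/2) (r/2) / norm g) * norm g" unfolding s_def by (intro mult_right_mono) auto
  then have sg: "s * norm g \<le> min (e/2) (r/2)" using g by simp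
  have sM: "s * M < 1"
  proof -
    have "s * M \<le> 1 / (2 * (M + 1)) * M" unfolding s_def using T by (intro mult_right_mono) auto
    also have "\<dots> < 1" using T by (simp add: field_simps)
    finally show ?thesis .
  qed
  define y where "y = z + s *\<^sub>R g"
  have d: "dist z y < e" "y \<in> ball z r" using sg s T assms by (auto simp: y_def dist_norm)
  have "\<bar>f y - 0 - s * (norm g)\<^sup>2\<bar> \<le> M * (s * norm g)\<^sup>2"
    using T(4)[of z "s *\<^sub>R g"] d T s z0 by (simp add: y_def g_def power2_norm_eq_inner)
  moreover have "M * (s * norm g)\<^sup>2 = (s * M) * (s * (norm g)\<^sup>2)" by (simp add: power2_eq_square)
  moreover have "(s * M) * (s * (norm g)\<^sup>2) < 1 * (s * (norm g)\<^sup>2)"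
    using sM s g by (intro mult_strict_right_mono) auto
  ultimately have fy: "f y > 0" by linarith
  have "y \<notin> frontier \<Omega>"
    using frontier_defining_zero[OF open_ball d(2) _ V T(5)] fy by auto
  moreover have "y \<notin> \<Omega>"
  proof
    assume "y \<in> \<Omega>"
    then have "y \<in> {x\<in>ball z r. f x < 0}" using V d(2) by blast
    then show False using fy by simp
  qed
  ultimately have "y \<notin> closure \<Omega>" using open_dom by (auto simp: frontier_def interior_open)
  then show ?thesis using d that by blast
qed

text \<open>The ball around x that touches the boundary at z lies in \<Omega>, which forces the
  gradient g of the defining function at z to be - |g| n, where n is the unit vector from z to x.
  Points z + w of the ball of radius s tangent at z satisfy |w|^2 < 2 s (w . n), so for small s the
  linear term dominates the Taylor error and the function stays negative.\<close>

lemma interior_ball_local: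
  assumes "C2_boundary \<Omega>" "z0 \<in> frontier \<Omega>"
  shows "\<exists>e>0. \<exists>s>0. \<forall>z\<in>frontier \<Omega> \<inter> ball z0 e. \<forall>x\<in>\<Omega>. dist x z = bdist x
     \<longrightarrow> ball (z + (s / dist x z) *\<^sub>R (x - z)) s \<subseteq> \<Omega>"
proof -
  obtain U f where U: "open U" "z0 \<in> U" "C2_on U f" "\<And>x. x \<in> U \<Longrightarrow> grad f x \<noteq> 0" "\<Omega> \<inter> U = {x\<in>U. f x < 0}"
    using assms(1,2) unfolding C2_boundary_def by metis
  obtain r M where T: "r > 0" "M \<ge> 0" "ball z0 r \<subseteq> U"
    "\<And>y w. y \<in> ball z0 r \<Longrightarrow> y + w \<in> ball z0 r \<Longrightarrow> \<bar>f (y + w) - f y - grad f y \<bullet> w\<bar> \<le> M * (norm w)\<^sup>2"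
    "continuous_on (ball z0 r) (grad f)" "continuous_on (ball z0 r) f"
    using C2_on_Taylor[OF U(1,3,2)] by metis
  have V: "\<Omega> \<inter> ball z0 r = {x\<in>ball z0 r. f x < 0}" using U(5) T(3) by blast
  define c where "c = norm (grad f z0) / 2"
  have c: "c > 0" using U by (simp add: c_def)
  have "isCont (grad f) z0" using T(5) T(1) by (simp add: continuous_on_eq_continuous_at)
  then obtain r1 where r1: "r1 > 0" "\<And>z. dist z z0 < r1 \<Longrightarrow> dist (grad f z) (grad f z0) < c"
    using c unfolding continuous_at_eps_delta by metis
  have gl: "norm (grad f z) \<ge> c" if "dist z z0 < r1" for z
    using r1(2)[OF that] norm_triangle_ineq2[of "grad f z0" "grad f z"]
    by (simp add: dist_norm c_def norm_minus_commute)
  define e where "e = min r1 (r / 2)"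
  \<comment> \<open>The bound r / 8 keeps the tangent ball inside the ball of the Taylor estimate;
    the other bound makes 2 s M < c, where c bounds the gradient norm from below near z0.\<close>
  define s where "s = min (r / 8) (c / (2 * (M + 1)))"
  have es: "e > 0" "s > 0" using r1 T c by (auto simp: e_def s_def)
  have "ball (z + (s / dist x z) *\<^sub>R (x - z)) s \<subseteq> \<Omega>"
    if z: "z \<in> frontier \<Omega>" "z \<in> ball z0 e" and x: "x \<in> \<Omega>" and d: "dist x z = bdist x" for x z
  proof
    have zr: "z \<in> ball z0 r" "dist z0 z < r / 2" and zr1: "dist z z0 < r1"
      using z T by (auto simp: e_def dist_commute)
    have fz: "f z = 0"
      by (rule frontier_defining_zero[OF open_ball zr(1) z(1) V T(6)])
    define R where "R = dist x z"
    have R: "R > 0" using d x bdist_pos_iff by (simp add: R_def)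
    define n where "n = (1/R) *\<^sub>R (x - z)"
    have n: "norm n = 1" using R by (simp add: n_def R_def dist_norm)
    have nn: "n \<bullet> n = 1" using n by (simp add: norm_eq_1)
    define g where "g = grad f z"
    \<comment> \<open>A direction w with w . n > 0 enters the ball around x for small t, so f(z + t
      w) < 0 = f(z). Divide the Taylor estimate by t and let t tend to 0.\<close>
    have gw: "g \<bullet> w \<le> 0" if w: "w \<bullet> n > 0" for w
    proof -
      have w0: "w \<noteq> 0" using w by auto
      have "g \<bullet> w \<le> 0 + M * (norm w)\<^sup>2 * t"
        if t: "0 < t" "t < min (r / 2 / norm w) (2 * R * (w \<bullet> n) / (norm w)\<^sup>2)" for t
      proof -
        have "t * norm w < r / 2" using t w0 by (simp add: pos_less_divide_eq)
        then have b: "z + t *\<^sub>R w \<in> ball z0 r"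
          using zr t dist_triangle[of z0 "z + t *\<^sub>R w" z] by (simp add: dist_norm)
        have "t * (norm w)\<^sup>2 < 2 * R * (w \<bullet> n)" using t w0 by (simp add: pos_less_divide_eq)
        then have "t * (t * (norm w)\<^sup>2) < t * (2 * R * (w \<bullet> n))" using t by simp
        moreover have "(norm (x - z - t *\<^sub>R w))\<^sup>2 = R\<^sup>2 - t * (2 * R * (w \<bullet> n)) + t * (t * (norm w)\<^sup>2)"
        proof -
          have "(norm (x - z - t *\<^sub>R w))\<^sup>2 = (norm (x - z))\<^sup>2 - 2 * t * (w \<bullet> (x - z)) + t\<^sup>2 * (norm w)\<^sup>2"
            by (rule norm_diff_scaleR_square)
          moreover have "w \<bullet> (x - z) = R * (w \<bullet> n)" using R by (simp add: n_def)
          ultimately show ?thesis by (simp add: R_def dist_norm power2_eq_square algebra_simps)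
        qed
        ultimately have "(norm (x - z - t *\<^sub>R w))\<^sup>2 < R\<^sup>2" by linarith
        then have "norm (x - z - t *\<^sub>R w) < R" using R by (simp add: power2_less_imp_less)
        then have "z + t *\<^sub>R w \<in> ball x (bdist x)" using d by (simp add: R_def dist_norm algebra_simps)
        then have "z + t *\<^sub>R w \<in> \<Omega>" using ball_bdist_subset by blast
        then have "f (z + t *\<^sub>R w) < 0" using V b by blast
        moreover have "\<bar>f (z + t *\<^sub>R w) - 0 - t * (g \<bullet> w)\<bar> \<le> M * (t\<^sup>2 * (norm w)\<^sup>2)"
          using T(4)[OF zr(1) b] fz t by (simp add: g_def power_mult_distrib)
        ultimately have "t * (g \<bullet> w) \<le> M * (t\<^sup>2 * (norm w)\<^sup>2)" by linarith
        also have "\<dots> = t * (M * (norm w)\<^sup>2 * t)" by (simp add: power2_eq_square)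
        finally show ?thesis using t by simp
      qed
      then have "eventually (\<lambda>t. g \<bullet> w \<le> 0 + M * (norm w)\<^sup>2 * t) (at_right 0)"
        using R w w0 T by (intro eventually_at_rightI[of 0 "min (r / 2 / norm w) (2 * R * (w \<bullet> n) / (norm w)\<^sup>2)"]) auto
      moreover have "((\<lambda>t. 0 + M * (norm w)\<^sup>2 * t) \<longlongrightarrow> 0 + M * (norm w)\<^sup>2 * 0) (at_right 0)"
        by (intro tendsto_intros)
      ultimately have "g \<bullet> w \<le> 0 + M * (norm w)\<^sup>2 * 0"
        by (intro tendsto_lowerbound) auto
      then show ?thesis by simp
    qed
    have gn: "g \<bullet> n = - norm g"
    proof -
      define b where "b = g \<bullet> n"
      have b0: "b \<le> 0" using gw[of n] nn by (simp add: b_def)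
      have "(norm g)\<^sup>2 - b\<^sup>2 \<le> 0 + t * (- b)" if "t > 0" for t
      proof -
        \<comment> \<open>The tested direction is the part of g orthogonal to n, tilted by t n to
          have positive product with n. As t tends to 0 the orthogonal part must vanish.\<close>
        have "g \<bullet> (g - b *\<^sub>R n + t *\<^sub>R n) \<le> 0"
          using that nn by (intro gw) (simp add: inner_simps b_def)
        moreover have "g \<bullet> (g - b *\<^sub>R n + t *\<^sub>R n) = (norm g)\<^sup>2 - b\<^sup>2 + t * b"
          by (simp add: inner_simps b_def dot_square_norm power2_eq_square)
        ultimately show ?thesis by simp
      qed
      then have "eventually (\<lambda>t. (norm g)\<^sup>2 - b\<^sup>2 \<le> 0 + t * (- b)) (at_right 0)"
        by (intro eventually_at_rightI[of 0 1]) auto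
      moreover have "((\<lambda>t. 0 + t * (-b)) \<longlongrightarrow> 0 + 0 * (-b)) (at_right 0)"
        by (intro tendsto_intros)
      ultimately have "(norm g)\<^sup>2 - b\<^sup>2 \<le> 0 + 0 * (-b)" by (intro tendsto_lowerbound) auto
      then have "norm g \<le> \<bar>b\<bar>" using abs_le_square_iff[of "norm g" b] by simp
      moreover have "\<bar>b\<bar> \<le> norm g" using Cauchy_Schwarz_ineq2[of g n] n by (simp add: b_def)
      ultimately show ?thesis using b0 by (simp add: b_def)
    qed
    have "\<forall>w. w \<bullet> n > 0 \<longrightarrow> g \<bullet> w \<le> - norm g * (w \<bullet> n)"
    proof safe
      fix w
      have "(norm (g - (- norm g) *\<^sub>R n))\<^sup>2 = 0"
        using norm_diff_scaleR_square[of g "- norm g" n] gn n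
        by (simp add: inner_commute[of n g] power2_eq_square)
      then have "g + norm g *\<^sub>R n = 0" by simp
      then have "g = - (norm g *\<^sub>R n)" by (simp add: eq_neg_iff_add_eq_0)
      then have "g \<bullet> w = - (norm g *\<^sub>R n) \<bullet> w" by simp
      then show "g \<bullet> w \<le> - norm g * (w \<bullet> n)" by (simp add: inner_commute)
    qed
    then have gw2: "\<And>w. w \<bullet> n > 0 \<Longrightarrow> g \<bullet> w \<le> - norm g * (w \<bullet> n)" by blast
    fix y assume "y \<in> ball (z + (s / dist x z) *\<^sub>R (x - z)) s"
    then have y: "norm (y - z - s *\<^sub>R n) < s"
      by (simp add: n_def R_def dist_norm norm_minus_commute algebra_simps)
    define w where "w = y - z"
    have "(norm (w - s *\<^sub>R n))\<^sup>2 < s\<^sup>2" using y es by (simp add: w_def power_strict_mono)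
    moreover have "(norm (w - s *\<^sub>R n))\<^sup>2 = (norm w)\<^sup>2 - 2 * s * (w \<bullet> n) + s\<^sup>2"
      using norm_diff_scaleR_square[of w s n] n by (simp add: inner_commute)
    ultimately have ws: "(norm w)\<^sup>2 < 2 * s * (w \<bullet> n)" by linarith
    then have "2 * s * (w \<bullet> n) > 0" by (meson le_less_trans zero_le_power2)
    then have wn: "w \<bullet> n > 0" using es by (simp add: zero_less_mult_iff)
    have "norm w < 2 * s"
      using norm_triangle_ineq[of "w - s *\<^sub>R n" "s *\<^sub>R n"] y n es by (simp add: w_def)
    also have "2 * s \<le> r / 4" by (auto simp: s_def)
    finally have yb: "z + w \<in> ball z0 r"
      using zr T dist_triangle[of z0 "z + w" z] by (simp add: dist_norm)
    have "f (z + w) \<le> g \<bullet> w + M * (norm w)\<^sup>2" using T(4)[OF zr(1) yb] fz by (simp add: g_def)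
    also have "g \<bullet> w \<le> - norm g * (w \<bullet> n)" by (rule gw2[OF wn])
    also have "- norm g * (w \<bullet> n) \<le> - c * (w \<bullet> n)" using gl[OF zr1] wn by (simp add: g_def)
    also have "M * (norm w)\<^sup>2 \<le> M * (2 * s * (w \<bullet> n))" using ws T by (intro mult_left_mono) auto
    also have "M * (2 * s * (w \<bullet> n)) \<le> M * (2 * (c / (2 * (M + 1))) * (w \<bullet> n))"
      using wn T by (intro mult_left_mono mult_right_mono) (auto simp: s_def)
    also have "\<dots> = c * (w \<bullet> n) * (M / (M + 1))" using T by (simp add: field_simps)
    also have "\<dots> < c * (w \<bullet> n) * 1"
      using c wn T by (intro mult_strict_left_mono) (auto simp: field_simps)
    finally have "f (z + w) < 0" by simp
    then have "z + w \<in> \<Omega>" using V yb by blast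
    then show "y \<in> \<Omega>" by (simp add: w_def)
  qed
  then show ?thesis using es by blast
qed

end

section \<open>Distance function and circumradius of the projections\<close>

context bounded_domain
begin

text \<open>Compactness of the frontier makes the radius uniform: a smaller ball with the same
  tangency point and direction lies inside the larger one.\<close>

lemma interior_ball:
  assumes "C2_boundary \<Omega>"
  obtains R where "R > 0"
    "\<And>x z. x \<in> \<Omega> \<Longrightarrow> z \<notin> \<Omega> \<Longrightarrow> dist x z = bdist x \<Longrightarrow> ball (z + (R / dist x z) *\<^sub>R (x - z)) R \<subseteq> \<Omega>"
proof -
  have "\<forall>z0\<in>frontier \<Omega>. \<exists>e>0. \<exists>s>0. \<forall>z\<in>frontier \<Omega> \<inter> ball z0 e. \<forall>x\<in>\<Omega>. dist x z = bdist x
     \<longrightarrow> ball (z + (s / dist x z) *\<^sub>R (x - z)) s \<subseteq> \<Omega>"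
    using interior_ball_local[OF assms] by blast
  then obtain e s where es: "\<And>z0. z0 \<in> frontier \<Omega> \<Longrightarrow> e z0 > 0" "\<And>z0. z0 \<in> frontier \<Omega> \<Longrightarrow> s z0 > 0"
    "\<And>z0 z x. z0 \<in> frontier \<Omega> \<Longrightarrow> z \<in> frontier \<Omega> \<Longrightarrow> z \<in> ball z0 (e z0) \<Longrightarrow> x \<in> \<Omega> \<Longrightarrow> dist x z = bdist x
     \<Longrightarrow> ball (z + (s z0 / dist x z) *\<^sub>R (x - z)) (s z0) \<subseteq> \<Omega>"
    unfolding Ball_def Bex_def bchoice_iff by (metis IntI)
  have "compact (frontier \<Omega>)" using bounded_dom by (rule compact_frontier_bounded)
  moreover have "frontier \<Omega> \<subseteq> (\<Union>z0\<in>frontier \<Omega>. ball z0 (e z0))" using es(1) by force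
  ultimately obtain D where D: "D \<subseteq> frontier \<Omega>" "finite D" "frontier \<Omega> \<subseteq> (\<Union>z0\<in>D. ball z0 (e z0))"
    by (metis (no_types, lifting) compactE_image open_ball)
  obtain x0 where "x0 \<in> \<Omega>" using nonempty_dom by blast
  then have "frontier \<Omega> \<noteq> {}" using nearest_compl_point nearest_in_frontier by (metis empty_iff)
  then have "D \<noteq> {}" using D by auto
  define R where "R = Min (s ` D)"
  have R: "R > 0" using D \<open>D \<noteq> {}\<close> es(2) by (auto simp: R_def)
  have "ball (z + (R / dist x z) *\<^sub>R (x - z)) R \<subseteq> \<Omega>"
    if x: "x \<in> \<Omega>" "z \<notin> \<Omega>" "dist x z = bdist x" for x z
  proof -
    have zf: "z \<in> frontier \<Omega>" using nearest_in_frontier x by blast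
    then obtain z0 where z0: "z0 \<in> D" "z \<in> ball z0 (e z0)" using D by blast
    have "R \<le> s z0" using z0 D by (auto simp: R_def)
    have d: "dist x z > 0" using x bdist_pos_iff by simp
    have "ball (z + (R / dist x z) *\<^sub>R (x - z)) R \<subseteq> ball (z + (s z0 / dist x z) *\<^sub>R (x - z)) (s z0)"
    proof -
      have "(z + (R / dist x z) *\<^sub>R (x - z)) - (z + (s z0 / dist x z) *\<^sub>R (x - z)) = ((R - s z0) / dist x z) *\<^sub>R (x - z)"
        by (simp add: diff_divide_distrib algebra_simps)
      then have "dist (z + (R / dist x z) *\<^sub>R (x - z)) (z + (s z0 / dist x z) *\<^sub>R (x - z)) = s z0 - R"
        using d \<open>R \<le> s z0\<close> by (simp add: dist_norm)
      then show ?thesis by (simp add: ball_subset_ball_iff)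
    qed
    also have "\<dots> \<subseteq> \<Omega>" using es(3) D z0 zf x by blast
    finally show ?thesis .
  qed
  then show ?thesis using R that by blast
qed

text \<open>The point x lies on a radius of the interior ball touching at z, at distance R - d(x)
  from its centre. This distance is at least R / 2 and hence at least \<rho>, so x is in the conical
  part of the profile of \<open>dobst_ge_ball\<close>, where the profile equals d(x).\<close>

lemma dobst_contact:
  assumes "\<rho> > 0" "\<rho> \<le> R/2"
    and ib: "\<And>x z. x \<in> \<Omega> \<Longrightarrow> z \<notin> \<Omega> \<Longrightarrow> dist x z = bdist x \<Longrightarrow> ball (z + (R / dist x z) *\<^sub>R (x - z)) R \<subseteq> \<Omega>"
    and "bdist x \<le> R/2"
  shows "dobst \<rho> t x = bdist x"
proof (cases "x \<in> \<Omega>")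
  case False
  then show ?thesis
    using dobst_le_bdist[OF \<open>\<rho> > 0\<close>, of t x] dobst_nonneg[OF \<open>\<rho> > 0\<close>, of t x] bdist_outside by auto
next
  case True
  obtain z where z: "z \<notin> \<Omega>" "dist x z = bdist x" using nearest_compl_point by blast
  have d: "bdist x > 0" using True bdist_pos_iff by blast
  let ?c = "z + (R / dist x z) *\<^sub>R (x - z)"
  have "x - ?c = (1 - R / bdist x) *\<^sub>R (x - z)" using z by (simp add: algebra_simps)
  then have "norm (x - ?c) = \<bar>1 - R / bdist x\<bar> * bdist x" using z by (simp add: dist_norm)
  also have "\<dots> = R - bdist x" using d assms by (simp add: abs_if field_simps)
  finally have n: "norm (x - ?c) = R - bdist x" .
  have "R - \<rho>/2 - (norm (x - ?c))\<^sup>2 / (2*\<rho>) + (max 0 (norm (x - ?c) - \<rho>))\<^sup>2 / (2*\<rho>) = bdist x"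
    using assms unfolding n by (simp add: field_simps power2_eq_square max_def)
  then have "bdist x \<le> dobst \<rho> t x"
    using dobst_ge_ball[OF \<open>\<rho> > 0\<close> ib[OF True z], of x t] by simp
  then show ?thesis using dobst_le_bdist[OF \<open>\<rho> > 0\<close>, of t x] by simp
qed

section \<open>The circumradius of the projections\<close>

lemma proj_bd_nonempty:
  assumes "x \<in> \<Omega>" shows "proj_bd \<Omega> x \<noteq> {}"
  using nearest_compl_point[of x] proj_bd_eq[OF assms] by blast

lemma rad_le:
  assumes "x \<in> \<Omega>" "proj_bd \<Omega> x \<subseteq> cball c r" shows "rad \<Omega> x \<le> r"
  unfolding rad_def
proof (rule cInf_lower)
  show "r \<in> {r. \<exists>c. proj_bd \<Omega> x \<subseteq> cball c r}" using assms by blast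
  show "bdd_below {r. \<exists>c. proj_bd \<Omega> x \<subseteq> cball c r}"
  proof (rule bdd_belowI)
    fix r assume "r \<in> {r. \<exists>c. proj_bd \<Omega> x \<subseteq> cball c r}"
    then show "0 \<le> r" using proj_bd_nonempty[OF assms(1)]
      by (auto simp: subset_eq) (meson order_trans zero_le_dist)
  qed
qed

lemma rad_ge:
  assumes "x \<in> \<Omega>" "\<And>c r. 0 \<le> r \<Longrightarrow> proj_bd \<Omega> x \<subseteq> cball c r \<Longrightarrow> l \<le> r" shows "l \<le> rad \<Omega> x"
  unfolding rad_def
proof (rule cInf_greatest)
  have "proj_bd \<Omega> x \<subseteq> cball x (bdist x)" using proj_bd_eq[OF assms(1)] by auto
  then show "{r. \<exists>c. proj_bd \<Omega> x \<subseteq> cball c r} \<noteq> {}" by blast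
  fix r assume "r \<in> {r. \<exists>c. proj_bd \<Omega> x \<subseteq> cball c r}"
  then obtain c where c: "proj_bd \<Omega> x \<subseteq> cball c r" by blast
  moreover have "0 \<le> r" using proj_bd_nonempty[OF assms(1)] c
    by (auto simp: subset_eq) (meson order_trans zero_le_dist)
  ultimately show "l \<le> r" using assms(2) by blast
qed

text \<open>The centre \<open>c\<close> is the point of the convex hull of the projections closest to \<open>x\<close>.\<close>

lemma rad_center:
  assumes x: "x \<in> \<Omega>"
  obtains c where "(norm (x - c))\<^sup>2 + (max 0 (rad \<Omega> x))\<^sup>2 \<le> (bdist x)\<^sup>2"
    "\<And>h. (bdist (x + h))\<^sup>2 \<le> (bdist x)\<^sup>2 + 2 * (h \<bullet> (x - c)) + (norm h)\<^sup>2"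
proof -
  let ?P = "proj_bd \<Omega> x" and ?H = "convex hull (proj_bd \<Omega> x)"
  have "?P = - \<Omega> \<inter> sphere x (bdist x)" unfolding proj_bd_eq[OF x] by auto
  then have "compact ?P" using compl_closed by (auto intro: closed_Int_compact)
  then have H: "closed ?H" "convex ?H" "?H \<noteq> {}"
    using proj_bd_nonempty[OF x] by (auto intro: compact_imp_closed compact_convex_hull)
  obtain c where c: "c \<in> ?H" "\<forall>y\<in>?H. dist x c \<le> dist x y" 
    using distance_attains_inf[OF H(1,3), of x] by metis
  have np: "norm (x - z) = bdist x" "z \<notin> \<Omega>" if "z \<in> ?P" for z
    using that unfolding proj_bd_eq[OF x] by (auto simp: dist_norm)
  have ob: "(x - c) \<bullet> (z - c) \<le> 0" if "z \<in> ?P" for z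
    using any_closest_point_dot[OF H(2,1) c(1) hull_inc[OF that] c(2)] .
  have sq: "(norm (z - c))\<^sup>2 \<le> (bdist x)\<^sup>2 - (norm (x - c))\<^sup>2" if z: "z \<in> ?P" for z
  proof -
    have "(norm (x - z))\<^sup>2 = (norm (x - c))\<^sup>2 - 2 * ((x - c) \<bullet> (z - c)) + (norm (z - c))\<^sup>2"
      using norm_diff_scaleR_square[of "x - c" 1 "z - c"] by (simp add: inner_commute)
    then show ?thesis using ob[OF z] np[OF z] by simp
  qed
  show ?thesis
  proof
    obtain z where z: "z \<in> ?P" using proj_bd_nonempty[OF x] by blast
    \<comment> \<open>The angle at c between x and any projection is at least a right angle, so the
      ball around c of this Pythagorean radius contains all projections.\<close>
    define r where "r = sqrt ((bdist x)\<^sup>2 - (norm (x - c))\<^sup>2)"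
    have nn: "(bdist x)\<^sup>2 - (norm (x - c))\<^sup>2 \<ge> 0" using sq[OF z] by (meson order_trans zero_le_power2)
    then have r2: "r\<^sup>2 = (bdist x)\<^sup>2 - (norm (x - c))\<^sup>2" "r \<ge> 0" by (auto simp: r_def)
    have "?P \<subseteq> cball c r"
    proof
      fix z assume "z \<in> ?P"
      then have "(norm (z - c))\<^sup>2 \<le> r\<^sup>2" using sq r2 by simp
      then have "norm (z - c) \<le> r" using r2(2) by (rule power2_le_imp_le)
      then show "z \<in> cball c r" by (simp add: dist_norm norm_minus_commute)
    qed
    then have "rad \<Omega> x \<le> r" by (rule rad_le[OF x])
    then have "(max 0 (rad \<Omega> x))\<^sup>2 \<le> r\<^sup>2" using r2 by (intro power_mono) auto
    then show "(norm (x - c))\<^sup>2 + (max 0 (rad \<Omega> x))\<^sup>2 \<le> (bdist x)\<^sup>2" using r2 by simp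
    fix h
    \<comment> \<open>For a projection z, squaring d(x + h) \<le> |x + h - z| gives a condition that
      is affine in z. It therefore passes to the convex hull, and so to c.\<close>
    have "?H \<subseteq> {z. h \<bullet> z \<le> ((bdist x)\<^sup>2 + (norm h)\<^sup>2 - (bdist (x + h))\<^sup>2) / 2 + h \<bullet> x}"
    proof (rule hull_minimal)
      show "?P \<subseteq> {z. h \<bullet> z \<le> ((bdist x)\<^sup>2 + (norm h)\<^sup>2 - (bdist (x + h))\<^sup>2) / 2 + h \<bullet> x}"
      proof safe
        fix z assume z: "z \<in> ?P"
        have "bdist (x + h) \<le> norm (x - z + h)" using bdist_le[OF np(2)[OF z], of "x + h"]
          by (simp add: dist_norm algebra_simps)
        then have "(bdist (x + h))\<^sup>2 \<le> (norm (x - z + h))\<^sup>2" using bdist_nonneg by (intro power_mono) auto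
        also have "\<dots> = (bdist x)\<^sup>2 + 2 * (h \<bullet> (x - z)) + (norm h)\<^sup>2"
          using norm_diff_scaleR_square[of "x - z" "-1" h] np(1)[OF z] by simp
        finally show "h \<bullet> z \<le> ((bdist x)\<^sup>2 + (norm h)\<^sup>2 - (bdist (x + h))\<^sup>2) / 2 + h \<bullet> x"
          by (simp add: inner_diff_right field_simps)
      qed
    qed (rule convex_halfspace_le)
    then have "h \<bullet> c \<le> ((bdist x)\<^sup>2 + (norm h)\<^sup>2 - (bdist (x + h))\<^sup>2) / 2 + h \<bullet> x" using c(1) by blast
    then show "(bdist (x + h))\<^sup>2 \<le> (bdist x)\<^sup>2 + 2 * (h \<bullet> (x - c)) + (norm h)\<^sup>2"
      by (simp add: inner_diff_right field_simps)
  qed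
qed

text \<open>Let a ball around c of radius r contain the projections, and put w = x - c. Nearest
  points of x + t w converge, along a subsequence, to a projection z0 with w . (x - z0) \<le> d (p .
  w). Since |w - (x - z0)| \<le> r, this gives |w|^2 - 2 d (p . w) + d^2 \<le> r^2, and completing
  the square yields d^2 (1 - |p|^2) \<le> r^2.\<close>

lemma rad_ge_of_supergradient:
  assumes x: "x \<in> \<Omega>" and "e > 0" "K \<ge> 0"
    and up: "\<And>h. norm h < e \<Longrightarrow> bdist (x + h) \<le> bdist x + p \<bullet> h + K * (norm h)\<^sup>2"
    and p: "(norm p)\<^sup>2 \<le> 1 - lam\<^sup>2 / (bdist x)\<^sup>2" and "lam \<ge> 0"
  shows "lam \<le> rad \<Omega> x"
proof (rule rad_ge[OF x])
  fix c r assume "0 \<le> r" and c: "proj_bd \<Omega> x \<subseteq> cball c r"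
  define d where "d = bdist x"
  define w where "w = x - c"
  have d: "d > 0" using x bdist_pos_iff by (simp add: d_def)
  \<comment> \<open>The added 1 covers w = 0; the choice keeps |t w| < e for all t up to e'.\<close>
  define e' where "e' = e / 2 / (norm w + 1)"
  have w1: "norm w + 1 > 0" by (simp add: add_nonneg_pos)
  have e': "e' > 0" using \<open>e > 0\<close> w1 by (simp add: e'_def)
  have e'w: "e' * norm w < e"
  proof -
    have "e' * norm w \<le> e' * (norm w + 1)" using e' by (intro mult_left_mono) auto
    also have "\<dots> = e / 2" using w1 e'_def by (metis less_irrefl nonzero_eq_divide_eq)
    finally show ?thesis using \<open>e > 0\<close> by simp
  qed
  define t where "t k = e' / real (Suc k)" for k
  have t: "t k > 0" "t k \<le> e'" for k using e' by (auto simp: t_def field_simps)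
  have tw: "norm (t k *\<^sub>R w) < e" for k
  proof -
    have "norm (t k *\<^sub>R w) \<le> e' * norm w" using t[of k] by (auto intro: mult_right_mono)
    then show ?thesis using e'w by simp
  qed
  have t0: "t \<longlonglongrightarrow> 0" unfolding t_def by (rule LIMSEQ_Suc[OF lim_const_over_n])
  have "\<forall>k. \<exists>z. z \<notin> \<Omega> \<and> dist (x + t k *\<^sub>R w) z = bdist (x + t k *\<^sub>R w)" using nearest_compl_point by metis
  then obtain z where z: "\<And>k. z k \<notin> \<Omega>" "\<And>k. dist (x + t k *\<^sub>R w) (z k) = bdist (x + t k *\<^sub>R w)" by metis
  have zd: "d \<le> norm (x - z k)" for k using bdist_le[OF z(1), of x] by (simp add: d_def dist_norm)
  \<comment> \<open>Cauchy-Schwarz for the vectors from z k to x + t w and to x, with the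
    supergradient bound for the length of the first. By \<open>zd\<close> the value d(x) in that
    bound may be replaced by |x - z k|; then t cancels.\<close>
  have key: "w \<bullet> (x - z k) \<le> norm (x - z k) * (p \<bullet> w + K * t k * (norm w)\<^sup>2)" for k
  proof -
    let ?n = "norm (x - z k)"
    have n0: "?n > 0" using zd[of k] d by linarith
    have "(x + t k *\<^sub>R w - z k) \<bullet> (x - z k) \<le> norm (x + t k *\<^sub>R w - z k) * ?n" by (rule norm_cauchy_schwarz)
    moreover have "(x + t k *\<^sub>R w - z k) \<bullet> (x - z k) = ?n\<^sup>2 + t k * (w \<bullet> (x - z k))"
    proof -
      have "x + t k *\<^sub>R w - z k = (x - z k) + t k *\<^sub>R w" by simp
      then show ?thesis by (simp only: inner_add_left inner_scaleR_left power2_norm_eq_inner)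
    qed
    moreover have "norm (x + t k *\<^sub>R w - z k) = bdist (x + t k *\<^sub>R w)" using z(2)[of k] by (simp add: dist_norm)
    moreover have "bdist (x + t k *\<^sub>R w) \<le> ?n + p \<bullet> (t k *\<^sub>R w) + K * (norm (t k *\<^sub>R w))\<^sup>2"
      using up[OF tw[of k]] zd[of k] by (simp add: d_def)
    ultimately have "?n\<^sup>2 + t k * (w \<bullet> (x - z k)) \<le> (?n + p \<bullet> (t k *\<^sub>R w) + K * (norm (t k *\<^sub>R w))\<^sup>2) * ?n"
      using n0 by (smt (verit) mult_right_mono)
    then have "t k * (w \<bullet> (x - z k)) \<le> t k * (?n * (p \<bullet> w + K * t k * (norm w)\<^sup>2))"
      by (simp add: power2_eq_square algebra_simps)
    then show ?thesis using t[of k] by simp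
  qed
  have "bounded (range z)"
  proof -
    have "dist x (z k) \<le> bdist x + 2 * e" for k
      using dist_triangle[of x "z k" "x + t k *\<^sub>R w"] z(2)[of k] bdist_Lipschitz[of "x + t k *\<^sub>R w" x] tw[of k]
      by (simp add: dist_norm)
    then show ?thesis unfolding bounded_def by blast
  qed
  then obtain z0 \<phi> where \<phi>: "strict_mono \<phi>" "(z \<circ> \<phi>) \<longlonglongrightarrow> z0"
    using bounded_imp_convergent_subsequence by metis
  have tphi: "(\<lambda>k. t (\<phi> k)) \<longlonglongrightarrow> 0" using LIMSEQ_subseq_LIMSEQ[OF t0 \<phi>(1)] by (simp add: o_def)
  have zphi: "(\<lambda>k. z (\<phi> k)) \<longlonglongrightarrow> z0" using \<phi>(2) by (simp add: o_def)
  have z0: "z0 \<notin> \<Omega>"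
    using closed_sequentially[OF compl_closed, of "z \<circ> \<phi>" z0] \<phi>(2) z(1) by auto
  have cont: "isCont bdist y" for y unfolding bdist_def by (intro continuous_infdist continuous_ident)
  have l1: "(\<lambda>k. bdist (x + t (\<phi> k) *\<^sub>R w)) \<longlonglongrightarrow> bdist (x + 0 *\<^sub>R w)"
    by (intro isCont_tendsto_compose[OF cont] tendsto_intros tphi)
  have l2: "(\<lambda>k. dist (x + t (\<phi> k) *\<^sub>R w) (z (\<phi> k))) \<longlonglongrightarrow> dist (x + 0 *\<^sub>R w) z0"
    by (intro tendsto_intros tphi zphi)
  have "dist x z0 = bdist x" using LIMSEQ_unique[OF l1 l2[unfolded z(2)]] by simp
  then have zP: "z0 \<in> proj_bd \<Omega> x" and nz: "norm (x - z0) = d"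
    using z0 proj_bd_eq[OF x] by (auto simp: d_def dist_norm)
  have "w \<bullet> (x - z0) \<le> norm (x - z0) * (p \<bullet> w + K * 0 * (norm w)\<^sup>2)"
  proof (rule LIMSEQ_le)
    show "(\<lambda>k. w \<bullet> (x - z (\<phi> k))) \<longlonglongrightarrow> w \<bullet> (x - z0)" by (intro tendsto_intros zphi)
    show "(\<lambda>k. norm (x - z (\<phi> k)) * (p \<bullet> w + K * t (\<phi> k) * (norm w)\<^sup>2)) \<longlonglongrightarrow> norm (x - z0) * (p \<bullet> w + K * 0 * (norm w)\<^sup>2)"
      by (intro tendsto_intros zphi tphi)
    show "\<exists>N. \<forall>n\<ge>N. w \<bullet> (x - z (\<phi> n)) \<le> norm (x - z (\<phi> n)) * (p \<bullet> w + K * t (\<phi> n) * (norm w)\<^sup>2)"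
      using key by blast
  qed
  then have 1: "w \<bullet> (x - z0) \<le> d * (p \<bullet> w)" by (simp add: nz)
  have "dist c z0 \<le> r" using zP c by auto
  then have "(norm (w - (x - z0)))\<^sup>2 \<le> r\<^sup>2"
    by (intro power_mono) (auto simp: w_def dist_norm norm_minus_commute algebra_simps)
  moreover have "(norm (w - (x - z0)))\<^sup>2 = (norm w)\<^sup>2 - 2 * (w \<bullet> (x - z0)) + d\<^sup>2"
    using norm_diff_scaleR_square[of w 1 "x - z0"] nz by (simp add: inner_commute)
  ultimately have 2: "(norm w)\<^sup>2 - 2 * (d * (p \<bullet> w)) + d\<^sup>2 \<le> r\<^sup>2" using 1 by linarith
  have "(norm (w - d *\<^sub>R p))\<^sup>2 = (norm w)\<^sup>2 - 2 * (d * (p \<bullet> w)) + d\<^sup>2 * (norm p)\<^sup>2"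
    using norm_diff_scaleR_square[of w d p] by simp
  then have 3: "2 * (d * (p \<bullet> w)) - (norm w)\<^sup>2 \<le> d\<^sup>2 * (norm p)\<^sup>2" by (smt (verit) zero_le_power2)
  have "d\<^sup>2 * (norm p)\<^sup>2 \<le> d\<^sup>2 * (1 - lam\<^sup>2 / d\<^sup>2)" using p by (intro mult_left_mono) (auto simp: d_def)
  also have "\<dots> = d\<^sup>2 - lam\<^sup>2" using d by (simp add: field_simps)
  finally have "lam\<^sup>2 \<le> r\<^sup>2" using 2 3 by linarith
  then show "lam \<le> r" using \<open>0 \<le> r\<close> by (rule power2_le_imp_le)
qed

end

section \<open>Limit of the discrete obstacle problems\<close>

context bounded_domain
begin

lemma continuous_bdist: "continuous_on S bdist"
  unfolding bdist_def by (intro continuous_on_infdist continuous_on_id)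

lemma bdist_bounded: obtains D where "D > 0" "\<And>x. bdist x \<le> D"
proof -
  obtain z where z: "z \<notin> \<Omega>" using compl_nonempty by blast
  obtain D where D: "\<And>x. x \<in> \<Omega> \<Longrightarrow> dist z x \<le> D" using bounded_any_center[of \<Omega> z] bounded_dom by blast
  have "bdist x \<le> max 1 D" for x
    using bdist_le[OF z, of x] D[of x] bdist_outside[of x] by (cases "x \<in> \<Omega>") (auto simp: dist_commute)
  then show ?thesis using that[of "max 1 D"] by simp
qed

end

text \<open>Here \<rho>, and with it m, is fixed and only the discretisation scale tends to 0. The
  collar width \<sigma> will come from the interior balls alone. The bound on
  \<open>\<tau> k\<close> is the one required by \<open>dobst_second_difference\<close>.\<close>

locale obst_limit = bounded_domain \<Omega> for \<Omega> :: "'a::euclidean_space set" +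
  fixes \<rho> \<sigma> :: real and \<tau> :: "nat \<Rightarrow> real" and u :: "'a \<Rightarrow> real"
  assumes \<rho>_pos: "\<rho> > 0" and \<sigma>_pos: "\<sigma> > 0"
    and contact: "\<And>t x. bdist x \<le> \<sigma> \<Longrightarrow> dobst \<rho> t x = bdist x"
    and \<tau>_pos: "\<And>k. \<tau> k > 0" and \<tau>_le: "\<And>k. \<tau> k \<le> \<sigma>/2" and \<tau>_lim: "\<tau> \<longlonglongrightarrow> 0"
    and u_lim: "\<And>x. (\<lambda>k. dobst \<rho> (\<tau> k) x) \<longlonglongrightarrow> u x"

lemma (in bounded_domain) obst_limit_exists:
  assumes \<rho>: "\<rho> > 0" and \<sigma>: "\<sigma> > 0"
    and contact: "\<And>t x. bdist x \<le> \<sigma> \<Longrightarrow> dobst \<rho> t x = bdist x"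
  obtains \<tau> u where "obst_limit \<Omega> \<rho> \<sigma> \<tau> u"
proof -
  define F where "F n = dobst \<rho> (\<sigma> / 2 / real (Suc n))" for n
  obtain D where D: "\<And>x. bdist x \<le> D" using bdist_bounded by blast
  have "\<exists>g k. continuous_on (closure \<Omega>) g \<and> strict_mono (k :: nat \<Rightarrow> nat) \<and>
      (\<forall>e>0. \<exists>N. \<forall>n x. n \<ge> N \<and> x \<in> closure \<Omega> \<longrightarrow> norm (F (k n) x - g x) < e)"
  proof (rule Arzela_Ascoli[of "closure \<Omega>" F D])
    show "compact (closure \<Omega>)" using bounded_dom by simp
    show "norm (F n x) \<le> D" for n x
      using dobst_nonneg[OF \<rho>] dobst_le_bdist[OF \<rho>] D by (simp add: F_def) (meson order_trans)
    show "\<exists>d. 0 < d \<and> (\<forall>n y. y \<in> closure \<Omega> \<and> norm (x - y) < d \<longrightarrow> norm (F n x - F n y) < e)"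
      if "0 < e" for x e
    proof (intro exI[of _ e] conjI allI impI that)
      fix n y assume "y \<in> closure \<Omega> \<and> norm (x - y) < e"
      then show "norm (F n x - F n y) < e"
        using dobst_Lipschitz[OF \<rho>, of _ x y] dobst_Lipschitz[OF \<rho>, of _ y x]
        unfolding F_def by (simp add: dist_norm norm_minus_commute abs_less_iff) (smt (verit))
    qed
  qed blast
  then obtain g k where k: "strict_mono (k :: nat \<Rightarrow> nat)"
    and g: "\<And>e. e > 0 \<Longrightarrow> \<exists>N. \<forall>n x. n \<ge> N \<and> x \<in> closure \<Omega> \<longrightarrow> norm (F (k n) x - g x) < e" by metis
  define \<tau> where "\<tau> n = \<sigma> / 2 / real (Suc (k n))" for n
  have F\<tau>: "F (k n) = dobst \<rho> (\<tau> n)" for n by (simp add: F_def \<tau>_def)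
  have "obst_limit \<Omega> \<rho> \<sigma> \<tau> (\<lambda>x. if x \<in> closure \<Omega> then g x else 0)"
  proof
    show "\<rho> > 0" "\<sigma> > 0" by fact+
    show "\<And>t x. bdist x \<le> \<sigma> \<Longrightarrow> dobst \<rho> t x = bdist x" by (rule contact)
    show "\<tau> n > 0" "\<tau> n \<le> \<sigma>/2" for n using \<sigma> by (auto simp: \<tau>_def field_simps)
    have "(\<lambda>n. \<sigma> / 2 / real (Suc n)) \<longlonglongrightarrow> 0" by (rule LIMSEQ_Suc[OF lim_const_over_n])
    from LIMSEQ_subseq_LIMSEQ[OF this k] show "\<tau> \<longlonglongrightarrow> 0" unfolding \<tau>_def[abs_def] o_def .
    fix x
    show "(\<lambda>n. dobst \<rho> (\<tau> n) x) \<longlonglongrightarrow> (if x \<in> closure \<Omega> then g x else 0)"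
    proof (cases "x \<in> closure \<Omega>")
      case True
      then show ?thesis using g unfolding LIMSEQ_iff F\<tau> by simp metis
    next
      case False
      then have "bdist x = 0" using bdist_outside closure_subset by blast
      then have "dobst \<rho> t x = 0" for t using contact[of x t] \<sigma> by simp
      then show ?thesis using False by simp
    qed
  qed
  then show ?thesis by (rule that)
qed

text \<open>Increments start at no less than -c and drop by at most 2 c per step, so the j-th is at
  least -c (2 j + 1); odd numbers sum to N^2.\<close>

lemma second_difference_iterate:
  fixes a :: "nat \<Rightarrow> real"
  assumes "a 1 - a 0 \<ge> - c" "\<And>j. 0 < j \<Longrightarrow> j < N \<Longrightarrow> a (Suc j) + a (j - 1) - 2 * a j \<ge> - 2 * c" "c \<ge> 0"
  shows "a N - a 0 \<ge> - c * (real N)\<^sup>2"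
proof -
  have step: "a (Suc j) - a j \<ge> - c * (2 * real j + 1)" if "j < N" for j
    using that
  proof (induction j)
    case 0
    then show ?case using assms(1) by simp
  next
    case (Suc j)
    then have "a (Suc j) - a j \<ge> - c * (2 * real j + 1)" by simp
    moreover have "a (Suc (Suc j)) + a j - 2 * a (Suc j) \<ge> - 2 * c" using assms(2)[of "Suc j"] Suc by simp
    ultimately show ?case by (simp add: algebra_simps)
  qed
  have "a n - a 0 \<ge> - c * (real n)\<^sup>2" if "n \<le> N" for n
    using that
  proof (induction n)
    case 0
    then show ?case by simp
  next
    case (Suc n)
    then have "a n - a 0 \<ge> - c * (real n)\<^sup>2" "a (Suc n) - a n \<ge> - c * (2 * real n + 1)"
      using step[of n] by auto
    then show ?case by (simp add: algebra_simps power2_eq_square)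
  qed
  then show ?thesis by simp
qed

section \<open>Bounds inherited by the limit\<close>

context obst_limit
begin

abbreviation "w k \<equiv> dobst \<rho> (\<tau> k)"

lemma u_nonneg: "0 \<le> u x"
  by (rule LIMSEQ_le_const[OF u_lim]) (use dobst_nonneg[OF \<rho>_pos] in blast)

lemma u_le_bdist: "u x \<le> bdist x"
  by (rule LIMSEQ_le_const2[OF u_lim]) (use dobst_le_bdist[OF \<rho>_pos] in blast)

lemma u_ge: "bdist x - \<rho>/2 \<le> u x"
  by (rule LIMSEQ_le_const[OF u_lim]) (use dobst_ge[OF \<rho>_pos] in blast)

lemma u_contact: "bdist x \<le> \<sigma> \<Longrightarrow> u x = bdist x"
  using LIMSEQ_unique[OF u_lim[of x]] contact[of x] by simp

lemma u_outside: "x \<notin> \<Omega> \<Longrightarrow> u x = 0"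
  using u_nonneg[of x] u_le_bdist[of x] bdist_outside[of x] by simp

lemma u_pos:
  assumes "\<rho> \<le> \<sigma>" "x \<in> \<Omega>" shows "0 < u x"
proof (cases "bdist x \<le> \<sigma>")
  case True
  then show ?thesis using u_contact assms bdist_pos_iff by simp
next
  case False
  then show ?thesis using u_ge[of x] assms \<rho>_pos by linarith
qed

lemma u_Lipschitz: "u x \<le> u y + dist x y"
  by (rule LIMSEQ_le[OF u_lim tendsto_add[OF u_lim tendsto_const]])
    (use dobst_Lipschitz[OF \<rho>_pos] in blast)

lemma u_Lipschitz_abs: "\<bar>u x - u y\<bar> \<le> dist x y"
  using u_Lipschitz[of x y] u_Lipschitz[of y x] by (simp add: dist_commute)

lemma w_Lipschitz_abs: "\<bar>w k x - w k y\<bar> \<le> dist x y"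
  using dobst_Lipschitz[OF \<rho>_pos, of "\<tau> k" x y] dobst_Lipschitz[OF \<rho>_pos, of "\<tau> k" y x]
  by (simp add: dist_commute)

lemma continuous_w: "continuous_on S (w k)"
  unfolding continuous_on_iff dist_real_def using w_Lipschitz_abs by (metis le_less_trans dist_commute)

lemma continuous_u: "continuous_on S u"
  unfolding continuous_on_iff dist_real_def using u_Lipschitz_abs by (metis le_less_trans dist_commute)

text \<open>The semiconcavity constant at points of distance at least \<beta> from the complement.
  It depends on neither \<rho> nor k, hence is uniform in m.\<close>

definition semi where "semi \<beta> = max (2/\<sigma>) (1/\<beta>)"

lemma semi_pos: "semi \<beta> > 0"
  using \<sigma>_pos by (simp add: semi_def less_max_iff_disj)

lemma w_second_difference:
  assumes "\<beta> > 0" "bdist x \<ge> \<beta>"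
  shows "w k (x + h) + w k (x - h) - 2 * w k x \<le> semi \<beta> * (norm h)\<^sup>2"
proof -
  have "w k (x + h) + w k (x - h) - 2 * w k x \<le> max (2/\<sigma>) (1 / bdist x) * (norm h)\<^sup>2"
    using contact \<sigma>_pos \<tau>_pos[of k] \<tau>_le[of k] assms bdist_pos_iff[of x]
    by (intro dobst_second_difference[OF \<rho>_pos]) auto
  also have "\<dots> \<le> semi \<beta> * (norm h)\<^sup>2"
  proof -
    have "1 / bdist x \<le> 1 / \<beta>" using assms by (simp add: frac_le)
    then show ?thesis unfolding semi_def by (intro mult_right_mono max.mono) auto
  qed
  finally show ?thesis .
qed

lemma u_second_difference:
  assumes "\<beta> > 0" "bdist x \<ge> \<beta>"
  shows "u (x + h) + u (x - h) - 2 * u x \<le> semi \<beta> * (norm h)\<^sup>2"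
  by (rule LIMSEQ_le_const2[where X = "\<lambda>k. w k (x + h) + w k (x - h) - 2 * w k x"])
    (use w_second_difference[OF assms] in \<open>auto intro!: tendsto_intros u_lim\<close>)

text \<open>The second differences of a subsolution over all axes add up to at least - n \<tau>^2 /
  \<rho>, and each of the other axes contributes at most \<open>semi \<beta>\<close> times \<tau>^2.
  This bounds a single axis from below. The constant blows up as \<rho> tends to 0 and is used only
  at fixed m.\<close>

definition axlow where "axlow \<beta> = DIM('a) / \<rho> + DIM('a) * semi \<beta>"

lemma axlow_nonneg: "axlow \<beta> \<ge> 0"
  using \<rho>_pos semi_pos[of \<beta>] by (simp add: axlow_def)

lemma w_axis_step:
  assumes "\<beta> > 0" "bdist x \<ge> \<beta>" "b \<in> Basis"
  shows "w k (x + \<tau> k *\<^sub>R b) + w k (x - \<tau> k *\<^sub>R b) - 2 * w k x \<ge> - axlow \<beta> * (\<tau> k)\<^sup>2"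
proof -
  let ?d = "\<lambda>b. w k (x + \<tau> k *\<^sub>R b) + w k (x - \<tau> k *\<^sub>R b) - 2 * w k x"
  let ?n = "real DIM('a)"
  have n: "?n > 0" by simp
  have "w k x \<le> navg (\<tau> k) (w k) x + (\<tau> k)\<^sup>2 / (2*\<rho>)" by (rule dobst_le_navg[OF \<rho>_pos])
  then have "2 * ?n * w k x \<le> 2 * ?n * (navg (\<tau> k) (w k) x + (\<tau> k)\<^sup>2 / (2*\<rho>))"
    using n by (intro mult_left_mono) auto
  also have "\<dots> = (\<Sum>b\<in>Basis. w k (x + \<tau> k *\<^sub>R b) + w k (x - \<tau> k *\<^sub>R b)) + ?n / \<rho> * (\<tau> k)\<^sup>2"
    by (simp add: navg_def distrib_left)
  finally have "(\<Sum>b\<in>Basis. ?d b) \<ge> - ?n / \<rho> * (\<tau> k)\<^sup>2"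
    by (simp add: sum_subtractf)
  moreover have "(\<Sum>b\<in>Basis. ?d b) = ?d b + (\<Sum>b\<in>Basis - {b}. ?d b)"
    using assms(3) by (intro sum.remove) auto
  moreover have "(\<Sum>b\<in>Basis - {b}. ?d b) \<le> (\<Sum>b\<in>Basis - {b}. semi \<beta> * (\<tau> k)\<^sup>2)"
  proof (rule sum_mono)
    fix b' :: 'a assume "b' \<in> Basis - {b}"
    then show "?d b' \<le> semi \<beta> * (\<tau> k)\<^sup>2"
      using w_second_difference[OF assms(1,2), of k "\<tau> k *\<^sub>R b'"] by simp
  qed
  moreover have "(\<Sum>b\<in>Basis - {b}. semi \<beta> * (\<tau> k)\<^sup>2) \<le> (\<Sum>b\<in>(Basis::'a set). semi \<beta> * (\<tau> k)\<^sup>2)"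
    using semi_pos[of \<beta>] by (intro sum_mono2) auto
  ultimately show ?thesis by (simp add: axlow_def algebra_simps)
qed

text \<open>Carries the bound for one step to a macroscopic one. For the symmetric sum of w at
  distance j \<tau> on both sides of x, the first increment is one second difference of w and each
  later second difference is a sum of two, matching c and 2 c in
  \<open>second_difference_iterate\<close>.\<close>

lemma w_axis_multistep:
  assumes "\<beta> > 0" and x: "\<And>s. \<bar>s\<bar> \<le> real N * \<tau> k \<Longrightarrow> bdist (x + s *\<^sub>R b) \<ge> \<beta>" and b: "b \<in> Basis"
  shows "w k (x + (real N * \<tau> k) *\<^sub>R b) + w k (x - (real N * \<tau> k) *\<^sub>R b) - 2 * w k x
    \<ge> - axlow \<beta> * (real N * \<tau> k)\<^sup>2"
proof -
  define a where "a j = w k (x + (real j * \<tau> k) *\<^sub>R b) + w k (x - (real j * \<tau> k) *\<^sub>R b)" for j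
  have st: "w k (x + (s + \<tau> k) *\<^sub>R b) + w k (x + (s - \<tau> k) *\<^sub>R b) - 2 * w k (x + s *\<^sub>R b) \<ge> - (axlow \<beta> * (\<tau> k)\<^sup>2)"
    if "\<bar>s\<bar> \<le> real N * \<tau> k" for s
    using w_axis_step[OF \<open>\<beta> > 0\<close> x[OF that] b, of k] by (simp add: algebra_simps)
  have "a N - a 0 \<ge> - (axlow \<beta> * (\<tau> k)\<^sup>2) * (real N)\<^sup>2"
  proof (cases "N = 0")
    case False
    show ?thesis
    proof (rule second_difference_iterate)
      show "a 1 - a 0 \<ge> - (axlow \<beta> * (\<tau> k)\<^sup>2)"
        using st[of 0] \<tau>_pos[of k] by (simp add: a_def)
      show "axlow \<beta> * (\<tau> k)\<^sup>2 \<ge> 0" using axlow_nonneg by simp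
      fix j assume j: "0 < j" "j < N"
      have l: "real j * \<tau> k \<le> real N * \<tau> k" using j \<tau>_pos[of k] by simp
      have e: "real (Suc j) * \<tau> k = real j * \<tau> k + \<tau> k" "real (j - 1) * \<tau> k = real j * \<tau> k - \<tau> k"
        using j by (auto simp: algebra_simps of_nat_diff)
      have "a (Suc j) = w k (x + (real j * \<tau> k + \<tau> k) *\<^sub>R b) + w k (x + (- (real j * \<tau> k) - \<tau> k) *\<^sub>R b)"
        "a (j - 1) = w k (x + (real j * \<tau> k - \<tau> k) *\<^sub>R b) + w k (x + (- (real j * \<tau> k) + \<tau> k) *\<^sub>R b)"
        "a j = w k (x + (real j * \<tau> k) *\<^sub>R b) + w k (x + (- (real j * \<tau> k)) *\<^sub>R b)"
        unfolding a_def e by (auto simp: algebra_simps)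
      then show "a (Suc j) + a (j - 1) - 2 * a j \<ge> - 2 * (axlow \<beta> * (\<tau> k)\<^sup>2)"
        using st[of "real j * \<tau> k"] st[of "- (real j * \<tau> k)"] l j \<tau>_pos[of k] by simp
    qed
  qed simp
  then show ?thesis by (simp add: a_def power_mult_distrib algebra_simps)
qed

lemma u_axis_second_difference:
  assumes "\<beta> > 0" and x: "bdist x \<ge> 2 * \<beta>" and b: "b \<in> Basis" and s: "\<bar>s\<bar> < \<beta>"
  shows "u (x + s *\<^sub>R b) + u (x - s *\<^sub>R b) - 2 * u x \<ge> - axlow \<beta> * s\<^sup>2"
proof -
  have main: "u (x + s *\<^sub>R b) + u (x - s *\<^sub>R b) - 2 * u x \<ge> - axlow \<beta> * s\<^sup>2" if s: "0 \<le> s" "s < \<beta>" for s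
  proof -
    \<comment> \<open>The step s is rounded down to a multiple of the scale; the common Lipschitz
      constant of the discrete solutions makes the rounding error vanish.\<close>
    define N where "N k = nat \<lfloor>s / \<tau> k\<rfloor>" for k
    define r where "r k = real (N k) * \<tau> k" for k
    have r: "r k \<le> s" "s - \<tau> k \<le> r k" "0 \<le> r k" for k
    proof -
      have "real (N k) = of_int \<lfloor>s / \<tau> k\<rfloor>" using s \<tau>_pos[of k] by (simp add: N_def)
      then have "real (N k) \<le> s / \<tau> k" "s / \<tau> k < real (N k) + 1" by linarith+
      then show "r k \<le> s" "s - \<tau> k \<le> r k" "0 \<le> r k"
        using \<tau>_pos[of k] by (auto simp: r_def field_simps)
    qed
    have rl: "r \<longlonglongrightarrow> s"
    proof (rule tendsto_sandwich[of "\<lambda>k. s - \<tau> k" _ _ "\<lambda>k. s"])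
      show "(\<lambda>k. s - \<tau> k) \<longlonglongrightarrow> s" using tendsto_diff[OF tendsto_const \<tau>_lim, of s] by simp
    qed (use r in auto)
    have wl: "(\<lambda>k. w k (x + (c * r k) *\<^sub>R b)) \<longlonglongrightarrow> u (x + (c * s) *\<^sub>R b)" for c
    proof -
      have "(\<lambda>k. w k (x + (c * r k) *\<^sub>R b) - w k (x + (c * s) *\<^sub>R b)) \<longlonglongrightarrow> 0"
      proof (rule Lim_null_comparison[OF always_eventually])
        show "\<forall>k. norm (w k (x + (c * r k) *\<^sub>R b) - w k (x + (c * s) *\<^sub>R b)) \<le> \<bar>c\<bar> * \<bar>r k - s\<bar>"
          using w_Lipschitz_abs[of _ "x + (c * r _) *\<^sub>R b" "x + (c * s) *\<^sub>R b"] b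
          by (simp add: dist_norm abs_mult flip: scaleR_diff_left right_diff_distrib)
        have "(\<lambda>k. \<bar>c\<bar> * \<bar>r k - s\<bar>) \<longlonglongrightarrow> \<bar>c\<bar> * \<bar>s - s\<bar>" by (intro tendsto_intros rl)
        then show "(\<lambda>k. \<bar>c\<bar> * \<bar>r k - s\<bar>) \<longlonglongrightarrow> 0" by simp
      qed
      from tendsto_add[OF this u_lim[of "x + (c * s) *\<^sub>R b"]] show ?thesis by simp
    qed
    have l1: "(\<lambda>k. w k (x + r k *\<^sub>R b) + w k (x - r k *\<^sub>R b) - 2 * w k x)
        \<longlonglongrightarrow> u (x + s *\<^sub>R b) + u (x - s *\<^sub>R b) - 2 * u x"
      using wl[of 1] wl[of "-1"] by (intro tendsto_intros u_lim) auto
    have l2: "(\<lambda>k. - axlow \<beta> * (r k)\<^sup>2) \<longlonglongrightarrow> - axlow \<beta> * s\<^sup>2" by (intro tendsto_intros rl)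
    have "- axlow \<beta> * (r k)\<^sup>2 \<le> w k (x + r k *\<^sub>R b) + w k (x - r k *\<^sub>R b) - 2 * w k x" for k
      unfolding r_def
    proof (rule w_axis_multistep[OF \<open>\<beta> > 0\<close> _ b])
      fix q assume "\<bar>q\<bar> \<le> real (N k) * \<tau> k"
      then have "\<bar>q\<bar> \<le> \<beta>" using r(1)[of k] s by (simp add: r_def)
      then show "bdist (x + q *\<^sub>R b) \<ge> \<beta>"
        using bdist_Lipschitz[of x "x + q *\<^sub>R b"] x b by (simp add: dist_norm)
    qed
    then show ?thesis by (intro LIMSEQ_le[OF l2 l1]) auto
  qed
  from main[of "\<bar>s\<bar>"] s show ?thesis by (auto simp: abs_if split: if_splits)
qed

definition quad where "quad \<beta> = DIM('a) * (axlow \<beta> + semi \<beta> + 1) + semi \<beta>"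

lemma quad_nonneg: "quad \<beta> \<ge> 0"
  using axlow_nonneg[of \<beta>] semi_pos[of \<beta>] by (simp add: quad_def)

lemma bdist_ge_ball: "bdist x \<ge> 2 * \<beta> \<Longrightarrow> y \<in> ball x \<beta> \<Longrightarrow> bdist y \<ge> \<beta>"
  using bdist_Lipschitz[of x y] by simp

section \<open>Differentiability and supergradients of the limit\<close>

lemma u_quadratic_bound:
  assumes "\<beta> > 0" and x: "bdist x \<ge> 2 * \<beta>" and h: "DIM('a) * norm h < \<beta>"
  shows "\<bar>u (x + h) - u x - grad u x \<bullet> h\<bar> \<le> quad \<beta> * (norm h)\<^sup>2"
proof -
  have "\<exists>p. \<forall>h. DIM('a) * norm h < \<beta> \<longrightarrow> \<bar>u (x + h) - u x - p \<bullet> h\<bar> \<le> (DIM('a) * (axlow \<beta> + semi \<beta> + 1) + semi \<beta>) * (norm h)\<^sup>2"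
  proof (rule semiconcave_quadratic_bound)
    show "continuous_on (ball x \<beta>) u" by (rule continuous_u)
    show "\<beta> > 0" "semi \<beta> \<ge> 0" "axlow \<beta> \<ge> 0"
      using assms semi_pos[of \<beta>] axlow_nonneg by auto
    show "\<And>y h. y \<in> ball x \<beta> \<Longrightarrow> u (y + h) + u (y - h) - 2 * u y \<le> semi \<beta> * (norm h)\<^sup>2"
      using u_second_difference[OF \<open>\<beta> > 0\<close>] bdist_ge_ball[OF x] by blast
    show "\<And>b s. b \<in> Basis \<Longrightarrow> \<bar>s\<bar> < \<beta> \<Longrightarrow> u (x + s *\<^sub>R b) + u (x - s *\<^sub>R b) - 2 * u x \<ge> - axlow \<beta> * s\<^sup>2"
      using u_axis_second_difference[OF assms(1,2)] by blast
  qed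
  then obtain p where p: "\<And>h. DIM('a) * norm h < \<beta> \<Longrightarrow> \<bar>u (x + h) - u x - p \<bullet> h\<bar> \<le> quad \<beta> * (norm h)\<^sup>2"
    unfolding quad_def by blast
  have "(u has_derivative (\<lambda>h. p \<bullet> h)) (at x)"
    by (rule quadratic_bound_has_derivative[of "\<beta> / DIM('a)", OF _ p])
      (use assms(1) in \<open>auto simp: field_simps\<close>)
  then have "grad u x = p" by (rule grad_eqI)
  then show ?thesis using p[OF h] by simp
qed

lemma u_has_derivative:
  assumes "x \<in> \<Omega>" shows "(u has_derivative (\<lambda>h. grad u x \<bullet> h)) (at x)"
proof (rule quadratic_bound_has_derivative)
  have b: "bdist x > 0" using assms bdist_pos_iff by blast
  show "bdist x / 2 / DIM('a) > 0" using b by simp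
  fix h :: 'a assume "norm h < bdist x / 2 / DIM('a)"
  then have "DIM('a) * norm h < bdist x / 2" by (simp add: field_simps)
  then show "\<bar>u (x + h) - u x - grad u x \<bullet> h\<bar> \<le> quad (bdist x / 2) * (norm h)\<^sup>2"
    using b by (intro u_quadratic_bound) auto
qed

lemma continuous_grad_u: "continuous_on \<Omega> (grad u)"
proof (rule continuous_at_imp_continuous_on, rule ballI)
  fix x assume "x \<in> \<Omega>"
  \<comment> \<open>A quarter of the distance, so that every point within \<beta> of x still has
    distance at least 2 \<beta>, as \<open>u_quadratic_bound\<close> requires.\<close>
  define \<beta> where "\<beta> = bdist x / 4"
  have \<beta>: "\<beta> > 0" using \<open>x \<in> \<Omega>\<close> bdist_pos_iff by (simp add: \<beta>_def)
  define r where "r = \<beta> / DIM('a)"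
  have r: "r > 0" "r \<le> \<beta>" using \<beta> DIM_positive[where 'a='a] by (auto simp: r_def field_simps Suc_leI)
  have "norm (grad u y - grad u x) \<le> 6 * quad \<beta> * norm (y - x)" if "2 * norm (y - x) < r" for y
  proof (rule quadratic_bound_gradient_Lipschitz[OF _ that quad_nonneg])
    fix y h :: 'a assume "y \<in> ball x r" "norm h < r"
    then have "dist x y < \<beta>" "norm h < r" using r by auto
    moreover from this have "DIM('a) * norm h < \<beta>" by (simp add: r_def field_simps)
    ultimately have "dist x y < \<beta>" "DIM('a) * norm h < \<beta>" by auto
    then show "\<bar>u (y + h) - u y - grad u y \<bullet> h\<bar> \<le> quad \<beta> * (norm h)\<^sup>2"
      using \<beta> bdist_Lipschitz[of x y] by (intro u_quadratic_bound) (auto simp: \<beta>_def)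
  qed
  then have ev: "eventually (\<lambda>y. norm (grad u y - grad u x) \<le> 6 * quad \<beta> * norm (y - x)) (at x)"
    unfolding eventually_at using r by (intro exI[of _ "r/2"]) (auto simp: dist_norm)
  have "((\<lambda>y. 6 * quad \<beta> * norm (y - x)) \<longlongrightarrow> 6 * quad \<beta> * norm (x - x)) (at x)" by (intro tendsto_intros)
  then have "((\<lambda>y. grad u y - grad u x) \<longlongrightarrow> 0) (at x)"
    by (intro Lim_null_comparison[OF ev]) simp
  then show "isCont (grad u) x" by (simp add: isCont_def LIM_zero_iff)
qed

lemma norm_grad_u_le:
  assumes "x \<in> \<Omega>" shows "norm (grad u x) \<le> 1"
proof -
  define \<beta> where "\<beta> = bdist x / 2"
  have \<beta>: "\<beta> > 0" using assms bdist_pos_iff by (simp add: \<beta>_def)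
  define g where "g = grad u x"
  have "norm g * norm g \<le> norm g + s * (quad \<beta> * (norm g)\<^sup>2)" if s: "0 < s" "s * (DIM('a) * norm g) < \<beta>" for s
  proof -
    have "\<bar>u (x + s *\<^sub>R g) - u x - g \<bullet> (s *\<^sub>R g)\<bar> \<le> quad \<beta> * (norm (s *\<^sub>R g))\<^sup>2"
      unfolding g_def using s \<beta> by (intro u_quadratic_bound) (auto simp: \<beta>_def g_def algebra_simps)
    moreover have "u (x + s *\<^sub>R g) - u x \<le> s * norm g" using u_Lipschitz[of "x + s *\<^sub>R g" x] s by (simp add: dist_norm)
    moreover have "g \<bullet> (s *\<^sub>R g) = s * (norm g * norm g)" by (simp add: dot_square_norm power2_eq_square)
    ultimately have "s * (norm g * norm g) \<le> s * norm g + quad \<beta> * (norm (s *\<^sub>R g))\<^sup>2" by linarith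
    also have "\<dots> = s * (norm g + s * (quad \<beta> * (norm g)\<^sup>2))"
      by (simp add: power_mult_distrib power2_eq_square algebra_simps)
    finally show ?thesis using s by simp
  qed
  moreover have "eventually (\<lambda>s. s * (DIM('a) * norm g) < \<beta>) (at_right 0)"
    by (rule order_tendstoD(2)[where y = 0]) (auto intro!: tendsto_eq_intros \<beta>)
  ultimately have "eventually (\<lambda>s. norm g * norm g \<le> norm g + s * (quad \<beta> * (norm g)\<^sup>2)) (at_right 0)"
    using eventually_at_right_less[of 0] by (auto elim: eventually_elim2)
  moreover have "((\<lambda>s. norm g + s * (quad \<beta> * (norm g)\<^sup>2)) \<longlongrightarrow> norm g + 0 * (quad \<beta> * (norm g)\<^sup>2)) (at_right 0)"
    by (intro tendsto_intros)
  ultimately have "norm g * norm g \<le> norm g + 0 * (quad \<beta> * (norm g)\<^sup>2)" by (intro tendsto_lowerbound) auto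
  then have "norm g * norm g \<le> norm g * 1" by simp
  then show ?thesis unfolding g_def[symmetric] by (cases "norm g = 0") (auto simp: mult_le_cancel_left)
qed

lemma w_convex_on:
  assumes "\<beta> > 0" "bdist x \<ge> 2 * \<beta>"
  shows "convex_on (ball x \<beta>) (\<lambda>y. (semi \<beta> + 1) / 2 * (norm (y - x))\<^sup>2 - w k y)"
  using w_second_difference[OF \<open>\<beta> > 0\<close>] bdist_ge_ball[OF assms(2)] continuous_w
  by (intro semiconcave_convex_on[where K = "semi \<beta>"]) auto

text \<open>Compared with \<open>u_quadratic_bound\<close>, the constant is free of \<rho>: the
  error \<open>quad \<beta>\<close> enters only through the differentiation at t h and disappears as
  t tends to 0. This is the estimate that passes to the limit in m.\<close>

lemma u_supergradient:
  assumes "\<beta> > 0" and x: "bdist x \<ge> 2 * \<beta>" and h: "norm h < \<beta>"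
  shows "u (x + h) \<le> u x + grad u x \<bullet> h + (semi \<beta> + 1) / 2 * (norm h)\<^sup>2"
proof -
  let ?L = "semi \<beta> + 1"
  have cvx: "convex_on (ball x \<beta>) (\<lambda>y. ?L / 2 * (norm (y - x))\<^sup>2 - u y)"
    using u_second_difference[OF \<open>\<beta> > 0\<close>] bdist_ge_ball[OF x] continuous_u
    by (intro semiconcave_convex_on[where K = "semi \<beta>"]) auto
  have "u (x + h) - u x - ?L / 2 * (norm h)\<^sup>2 \<le> grad u x \<bullet> h + t * (quad \<beta> * (norm h)\<^sup>2)"
    if t: "0 < t" "t < 1" "t * (DIM('a) * norm h) < \<beta>" for t
  proof -
    have "t * (u (x + h) - u x) - t * ?L / 2 * (norm h)\<^sup>2 \<le> u (x + t *\<^sub>R h) - u x"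
      using t h semi_pos[of \<beta>] by (intro semiconcave_forward[OF cvx]) auto
    moreover have "\<bar>u (x + t *\<^sub>R h) - u x - grad u x \<bullet> (t *\<^sub>R h)\<bar> \<le> quad \<beta> * (norm (t *\<^sub>R h))\<^sup>2"
      using t by (intro u_quadratic_bound assms(1,2)) (auto simp: algebra_simps)
    ultimately have "t * (u (x + h) - u x) - t * ?L / 2 * (norm h)\<^sup>2 \<le> grad u x \<bullet> (t *\<^sub>R h) + quad \<beta> * (norm (t *\<^sub>R h))\<^sup>2"
      by linarith
    then have "t * (u (x + h) - u x - ?L / 2 * (norm h)\<^sup>2) \<le> t * (grad u x \<bullet> h + t * (quad \<beta> * (norm h)\<^sup>2))"
      by (simp add: power_mult_distrib power2_eq_square algebra_simps)
    then show ?thesis using t by simp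
  qed
  moreover have "eventually (\<lambda>t. t * (DIM('a) * norm h) < \<beta>) (at_right 0)"
    by (rule order_tendstoD(2)[where y = 0]) (auto intro!: tendsto_eq_intros assms(1))
  moreover have "eventually (\<lambda>t::real. 0 < t \<and> t < 1) (at_right 0)"
    by (intro eventually_at_rightI[of 0 1]) auto
  ultimately have "eventually (\<lambda>t. u (x + h) - u x - ?L / 2 * (norm h)\<^sup>2 \<le> grad u x \<bullet> h + t * (quad \<beta> * (norm h)\<^sup>2)) (at_right 0)"
    by (auto elim: eventually_elim2)
  moreover have "((\<lambda>t. grad u x \<bullet> h + t * (quad \<beta> * (norm h)\<^sup>2)) \<longlongrightarrow> grad u x \<bullet> h + 0 * (quad \<beta> * (norm h)\<^sup>2)) (at_right 0)"
    by (intro tendsto_intros)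
  ultimately have "u (x + h) - u x - ?L / 2 * (norm h)\<^sup>2 \<le> grad u x \<bullet> h + 0 * (quad \<beta> * (norm h)\<^sup>2)"
    by (intro tendsto_lowerbound) auto
  then show ?thesis by simp
qed

text \<open>Pointwise convergence of functions does not control quotients over the vanishing step
  \<open>\<tau> k\<close>. Semiconcavity does: these lie, up to L s, between the forward and
  backward quotients over a fixed step s, which converge to those of u and so are close to the
  derivative.\<close>

lemma w_difference_quotient:
  assumes "x \<in> \<Omega>" and b: "b \<in> Basis"
  shows "(\<lambda>k. (w k (x + \<tau> k *\<^sub>R b) - w k x) / \<tau> k) \<longlonglongrightarrow> grad u x \<bullet> b"
proof (rule LIMSEQ_I)
  fix e :: real assume "e > 0"
  define \<beta> where "\<beta> = bdist x / 2"
  have \<beta>: "\<beta> > 0" "bdist x \<ge> 2 * \<beta>" using assms bdist_pos_iff by (auto simp: \<beta>_def)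
  define L where "L = semi \<beta> + 1"
  have L: "L > 0" using semi_pos[of \<beta>] by (simp add: L_def)
  \<comment> \<open>Collects the Taylor error of u, the semiconcavity error of w and the slack s^2
    allowed for convergence at the fixed step.\<close>
  define C where "C = quad \<beta> + L + 1"
  have C: "C > 0" using L quad_nonneg[of \<beta>] by (simp add: C_def)
  define s where "s = min (\<beta> / DIM('a) / 2) (e / C / 2)"
  have s: "s > 0" "DIM('a) * s < \<beta>" "C * s < e"
  proof -
    show "s > 0" using \<beta> C \<open>e > 0\<close> by (simp add: s_def)
    have "DIM('a) * s \<le> DIM('a) * (\<beta> / DIM('a) / 2)" by (intro mult_left_mono) (auto simp: s_def)
    also have "\<dots> = \<beta> / 2" by simp
    finally show "DIM('a) * s < \<beta>" using \<beta> by linarith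
    have "C * s \<le> C * (e / C / 2)" using C by (intro mult_left_mono) (auto simp: s_def)
    also have "\<dots> = e / 2" using C by simp
    finally show "C * s < e" using \<open>e > 0\<close> by linarith
  qed
  have sb: "s < \<beta>"
  proof -
    have "1 * s \<le> DIM('a) * s" using s DIM_positive[where 'a='a] by (intro mult_right_mono) (auto simp: Suc_leI)
    then show ?thesis using s by linarith
  qed
  define g where "g = grad u x \<bullet> b"
  have q1: "\<bar>u (x + s *\<^sub>R b) - u x - s * g\<bar> \<le> quad \<beta> * s\<^sup>2"
    using u_quadratic_bound[OF \<beta>, of "s *\<^sub>R b"] s b by (simp add: g_def)
  have q2: "\<bar>u (x - s *\<^sub>R b) - u x + s * g\<bar> \<le> quad \<beta> * s\<^sup>2"
    using u_quadratic_bound[OF \<beta>, of "- (s *\<^sub>R b)"] s b by (simp add: g_def)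
  have "(\<lambda>k. w k (x + s *\<^sub>R b) - w k x) \<longlonglongrightarrow> u (x + s *\<^sub>R b) - u x"
    "(\<lambda>k. w k x - w k (x - s *\<^sub>R b)) \<longlonglongrightarrow> u x - u (x - s *\<^sub>R b)"
    by (intro tendsto_intros u_lim)+
  then have "eventually (\<lambda>k. w k (x + s *\<^sub>R b) - w k x > u (x + s *\<^sub>R b) - u x - s\<^sup>2) sequentially"
    "eventually (\<lambda>k. w k x - w k (x - s *\<^sub>R b) < u x - u (x - s *\<^sub>R b) + s\<^sup>2) sequentially"
    using s by (auto intro: order_tendstoD)
  moreover have "eventually (\<lambda>k. \<tau> k < s) sequentially" using order_tendstoD(2)[OF \<tau>_lim s(1)] .
  ultimately have "eventually (\<lambda>k. \<bar>(w k (x + \<tau> k *\<^sub>R b) - w k x) / \<tau> k - g\<bar> < e) sequentially"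
  proof eventually_elim
    case (elim k)
    have t: "0 \<le> \<tau> k / s" "\<tau> k / s \<le> 1" "(\<tau> k / s) *\<^sub>R (s *\<^sub>R b) = \<tau> k *\<^sub>R b" "norm (s *\<^sub>R b) < \<beta>" "norm (s *\<^sub>R b) = s"
      using elim s \<tau>_pos[of k] b sb by auto
    let ?A = "w k (x + \<tau> k *\<^sub>R b) - w k x"
    have tp: "\<tau> k > 0" by (rule \<tau>_pos)
    have fw: "\<tau> k / s * (w k (x + s *\<^sub>R b) - w k x) - \<tau> k / s * L / 2 * s\<^sup>2 \<le> ?A"
      using semiconcave_forward[OF w_convex_on[OF \<beta>] t(1,2,4)] L unfolding t(3,5) L_def by simp
    have bw: "?A \<le> \<tau> k / s * (w k x - w k (x - s *\<^sub>R b)) + \<tau> k / s * L * s\<^sup>2"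
      using semiconcave_backward[OF w_convex_on[OF \<beta>] t(1,2,4)] L unfolding t(3,5) L_def by simp
    have "\<tau> k / s * (w k (x + s *\<^sub>R b) - w k x) \<ge> \<tau> k / s * (s * g - quad \<beta> * s\<^sup>2 - s\<^sup>2)"
      using elim q1 t(1) by (intro mult_left_mono) linarith+
    moreover have "\<tau> k / s * L / 2 * s\<^sup>2 \<le> \<tau> k / s * L * s\<^sup>2" 
    proof -
      have "0 \<le> \<tau> k / s * L * s\<^sup>2" using t(1) L by (intro mult_nonneg_nonneg) auto
      moreover have "\<tau> k / s * L / 2 * s\<^sup>2 = (\<tau> k / s * L * s\<^sup>2) / 2" by simp
      ultimately show ?thesis by argo
    qed
    ultimately have "\<tau> k / s * (s * g - quad \<beta> * s\<^sup>2 - s\<^sup>2 - L * s\<^sup>2) \<le> ?A"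
      using fw by (simp add: algebra_simps)
    moreover have "\<tau> k / s * (s * g - quad \<beta> * s\<^sup>2 - s\<^sup>2 - L * s\<^sup>2) = \<tau> k * (g - C * s)"
      using s(1) by (simp add: C_def power2_eq_square field_simps)
    ultimately have lo: "\<tau> k * (g - C * s) \<le> ?A" by simp
    have "\<tau> k / s * (w k x - w k (x - s *\<^sub>R b)) \<le> \<tau> k / s * (s * g + quad \<beta> * s\<^sup>2 + s\<^sup>2)"
      using elim q2 t(1) by (intro mult_left_mono) linarith+
    then have "?A \<le> \<tau> k / s * (s * g + quad \<beta> * s\<^sup>2 + s\<^sup>2 + L * s\<^sup>2)"
      using bw by (simp add: algebra_simps)
    moreover have "\<tau> k / s * (s * g + quad \<beta> * s\<^sup>2 + s\<^sup>2 + L * s\<^sup>2) = \<tau> k * (g + C * s)"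
      using s(1) by (simp add: C_def power2_eq_square field_simps)
    ultimately have up: "?A \<le> \<tau> k * (g + C * s)" by simp
    have "g - C * s \<le> ?A / \<tau> k" "?A / \<tau> k \<le> g + C * s"
      using lo up tp by (auto simp: field_simps)
    then show ?case using s(3) by linarith
  qed
  then show "\<exists>no. \<forall>k\<ge>no. norm ((w k (x + \<tau> k *\<^sub>R b) - w k x) / \<tau> k - grad u x \<bullet> b) < e"
    by (simp add: eventually_sequentially g_def)
qed

end

section \<open>Integrals of difference quotients\<close>

lemma integral_lborel_shift:
  fixes f :: "'a::euclidean_space \<Rightarrow> real"
  assumes [measurable]: "f \<in> borel_measurable borel"
  shows "(LBINT x. f (x + a)) = integral\<^sup>L lborel f"
proof -
  have "integral\<^sup>L lborel f = integral\<^sup>L (distr lborel borel ((+) a)) f"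
    by (simp add: lborel_distr_plus)
  also have "\<dots> = (LBINT x. f (a + x))" by (rule integral_distr) auto
  finally show ?thesis by (simp add: add.commute)
qed

lemma integrable_lborel_shift:
  fixes f :: "'a::euclidean_space \<Rightarrow> real"
  assumes "integrable lborel f"
  shows "integrable lborel (\<lambda>x. f (x + a))"
proof -
  have [measurable]: "f \<in> borel_measurable borel" using assms by (simp add: integrable_iff_bounded)
  have "integrable (distr lborel borel ((+) a)) f" using assms by (simp add: lborel_distr_plus)
  then have "integrable lborel (\<lambda>x. f (a + x))" by (subst (asm) integrable_distr_eq) auto
  then show ?thesis by (simp add: add.commute)
qed

text \<open>A class of integrable functions closed under translation and under continuous operations
  that map 0 to 0, so that integrability of every expression below is a matter of closure
  rules.\<close>

definition bsupp :: "('a::euclidean_space \<Rightarrow> real) \<Rightarrow> bool" where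
  "bsupp f \<longleftrightarrow> f \<in> borel_measurable borel \<and> (\<exists>B. \<forall>x. \<bar>f x\<bar> \<le> B) \<and> (\<exists>R. \<forall>x. norm x > R \<longrightarrow> f x = 0)"

lemma bsuppI:
  assumes "f \<in> borel_measurable borel" "\<And>x. \<bar>f x\<bar> \<le> B" "\<And>x. norm x > R \<Longrightarrow> f x = 0"
  shows "bsupp f"
  using assms by (auto simp: bsupp_def)

lemma bsupp_measurable: "bsupp f \<Longrightarrow> f \<in> borel_measurable borel"
  by (simp add: bsupp_def)

lemma bsupp_integrable:
  assumes "bsupp f" shows "integrable lborel f"
proof -
  obtain B R where "\<And>x. \<bar>f x\<bar> \<le> B" "\<And>x. norm x > R \<Longrightarrow> f x = 0"
    using assms by (auto simp: bsupp_def)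
  moreover have "f \<in> borel_measurable lborel" using assms by (simp add: bsupp_def)
  ultimately show ?thesis
    by (intro integrableI_bounded_set[where A = "cball 0 R" and B = B])
      (auto simp: emeasure_lborel_cball_finite[simplified])
qed

lemma bsupp_lift2:
  assumes "bsupp f" "bsupp g" and c: "continuous_on UNIV (\<lambda>p. \<theta> (fst p) (snd p))" and "\<theta> 0 0 = (0::real)"
  shows "bsupp (\<lambda>x. \<theta> (f x) (g x))"
proof -
  obtain B1 R1 where 1: "\<And>x. \<bar>f x\<bar> \<le> B1" "\<And>x. norm x > R1 \<Longrightarrow> f x = 0"
    using assms(1) by (auto simp: bsupp_def)
  obtain B2 R2 where 2: "\<And>x. \<bar>g x\<bar> \<le> B2" "\<And>x. norm x > R2 \<Longrightarrow> g x = 0"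
    using assms(2) by (auto simp: bsupp_def)
  have "bounded ((\<lambda>p. \<theta> (fst p) (snd p)) ` ({-B1..B1} \<times> {-B2..B2}))"
    by (intro compact_imp_bounded compact_continuous_image compact_Times continuous_on_subset[OF c]) auto
  then obtain B where "\<forall>y\<in>(\<lambda>p. \<theta> (fst p) (snd p)) ` ({-B1..B1} \<times> {-B2..B2}). norm y \<le> B"
    unfolding bounded_iff by metis
  then have B: "\<And>p. p \<in> {-B1..B1} \<times> {-B2..B2} \<Longrightarrow> \<bar>\<theta> (fst p) (snd p)\<bar> \<le> B" by force
  show ?thesis
  proof (rule bsuppI[where B = B and R = "max R1 R2"])
    have [measurable]: "f \<in> borel_measurable borel" "g \<in> borel_measurable borel"
      using assms by (auto simp: bsupp_def)
    have [measurable]: "(\<lambda>p. \<theta> (fst p) (snd p)) \<in> borel_measurable borel"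
      using c by (rule borel_measurable_continuous_onI)
    have "(\<lambda>x. (\<lambda>p. \<theta> (fst p) (snd p)) (f x, g x)) \<in> borel_measurable borel" by measurable
    then show "(\<lambda>x. \<theta> (f x) (g x)) \<in> borel_measurable borel" by simp
    show "\<bar>\<theta> (f x) (g x)\<bar> \<le> B" for x
      using B[of "(f x, g x)"] 1(1)[of x] 2(1)[of x] by (auto simp: abs_le_iff)
    show "norm x > max R1 R2 \<Longrightarrow> \<theta> (f x) (g x) = 0" for x using 1(2) 2(2) assms(4) by simp
  qed
qed

lemma bsupp_compose:
  assumes "bsupp f" "continuous_on UNIV \<theta>" "\<theta> 0 = (0::real)"
  shows "bsupp (\<lambda>x. \<theta> (f x))"
  using assms by (intro bsupp_lift2[where \<theta> = "\<lambda>a b. \<theta> a"]) (auto intro!: continuous_on_compose2[OF assms(2)] continuous_intros)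

lemma bsupp_add: "bsupp f \<Longrightarrow> bsupp g \<Longrightarrow> bsupp (\<lambda>x. f x + g x)"
  by (rule bsupp_lift2) (auto intro!: continuous_intros)

lemma bsupp_diff: "bsupp f \<Longrightarrow> bsupp g \<Longrightarrow> bsupp (\<lambda>x. f x - g x)"
  by (rule bsupp_lift2) (auto intro!: continuous_intros)

lemma bsupp_mult: "bsupp f \<Longrightarrow> bsupp g \<Longrightarrow> bsupp (\<lambda>x. f x * g x)"
  by (rule bsupp_lift2) (auto intro!: continuous_intros)

lemma bsupp_cmult: "bsupp f \<Longrightarrow> bsupp (\<lambda>x. c * f x)"
  by (rule bsupp_compose) (auto intro!: continuous_intros)

lemma bsupp_power2: "bsupp f \<Longrightarrow> bsupp (\<lambda>x. (f x)\<^sup>2)"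
  by (rule bsupp_compose) (auto intro!: continuous_intros)

lemma bsupp_divide: "bsupp f \<Longrightarrow> bsupp (\<lambda>x. f x / c)"
  using bsupp_cmult[of f "1/c"] by simp

lemma bsupp_shift:
  assumes "bsupp f" shows "bsupp (\<lambda>x. f (x + a))"
proof -
  obtain B R where 1: "\<And>x. \<bar>f x\<bar> \<le> B" "\<And>x. norm x > R \<Longrightarrow> f x = 0"
    using assms by (auto simp: bsupp_def)
  show ?thesis
  proof (rule bsuppI[where B = B and R = "R + norm a"])
    show "(\<lambda>x. f (x + a)) \<in> borel_measurable borel"
      using measurable_compose[OF _ bsupp_measurable[OF assms], of "\<lambda>x. x + a"] by auto
    show "norm x > R + norm a \<Longrightarrow> f (x + a) = 0" for x
      using 1(2)[of "x + a"] norm_triangle_ineq2[of x "- a"] by simp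
  qed (use 1 in auto)
qed

lemma bsupp_sum: "finite A \<Longrightarrow> (\<And>i. i \<in> A \<Longrightarrow> bsupp (f i)) \<Longrightarrow> bsupp (\<lambda>x. \<Sum>i\<in>A. f i x)"
proof (induction A rule: finite_induct)
  case empty
  then show ?case by (auto intro: bsuppI[of _ 0])
next
  case (insert i A)
  then show ?case by (auto intro: bsupp_add)
qed

lemmas bsupp_intros = bsupp_cmult bsupp_divide bsupp_power2 bsupp_add bsupp_diff bsupp_mult

text \<open>Translation invariance of Lebesgue measure replaces integration by parts: after
  expanding the product, shifts move every increment of p onto f.\<close>

lemma discrete_Green:
  assumes f: "bsupp f" and p: "bsupp p"
  shows "(LBINT x. (f (x + h) - f x) * (p (x + h) - p x))
    = - (LBINT x. (f (x + h) + f (x - h) - 2 * f x) * p x)"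
proof -
  note I = bsupp_integrable bsupp_intros f p bsupp_shift[OF f] bsupp_shift[OF p]
  have s1: "(LBINT x. f (x + h) * p (x + h)) = (LBINT x. f x * p x)"
    by (rule integral_lborel_shift[where f = "\<lambda>x. f x * p x"]) (intro bsupp_measurable I)
  have "(LBINT x. f (x + (- h)) * p ((x + (- h)) + h)) = (LBINT x. f x * p (x + h))"
    by (rule integral_lborel_shift[where f = "\<lambda>x. f x * p (x + h)"]) (intro bsupp_measurable I)
  then have s2: "(LBINT x. f x * p (x + h)) = (LBINT x. f (x - h) * p x)" by simp
  have i: "integrable lborel (\<lambda>x. f (x + h) * p (x + h))" "integrable lborel (\<lambda>x. f x * p x)"
    "integrable lborel (\<lambda>x. f x * p (x + h))" "integrable lborel (\<lambda>x. f (x + h) * p x)"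
    by (intro I)+
  have i2: "integrable lborel (\<lambda>x. f (x - h) * p x)"
    using bsupp_integrable[OF bsupp_mult[OF bsupp_shift[OF f, of "- h"] p]] by simp
  have "(LBINT x. (f (x + h) - f x) * (p (x + h) - p x))
     = (LBINT x. f (x + h) * p (x + h) - f (x + h) * p x - f x * p (x + h) + f x * p x)"
    by (simp add: algebra_simps)
  also have "\<dots> = 2 * (LBINT x. f x * p x) - (LBINT x. f (x + h) * p x)
      - (LBINT x. f (x - h) * p x)"
    using i by (simp add: s1 s2)
  also have "\<dots> = - (LBINT x. f (x + h) * p x + f (x - h) * p x - 2 * (f x * p x))"
    using i i2 by simp
  also have "\<dots> = - (LBINT x. (f (x + h) + f (x - h) - 2 * f x) * p x)"
    by (simp add: algebra_simps)
  finally show ?thesis .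
qed

text \<open>The increment over N h is the mean of N times the increments over h along the way.
  Jensen's inequality applies pointwise, and translation makes the N resulting integrals
  equal.\<close>

lemma integral_convex_difference_steps:
  fixes f :: "'a::euclidean_space \<Rightarrow> real"
  assumes f: "bsupp f" and "convex_on UNIV \<theta>" and c: "continuous_on UNIV \<theta>" and "\<theta> 0 = (0::real)" and "N > 0"
  shows "(LBINT x. \<theta> (f (x + real N *\<^sub>R h) - f x))
    \<le> (LBINT x. \<theta> (real N * (f (x + h) - f x)))"
proof -
  define a where "a j x = real N * (f (x + real j *\<^sub>R h + h) - f (x + real j *\<^sub>R h))" for j x
  have bs0: "bsupp (\<lambda>x. \<theta> (real N * (f (x + h) - f x)))"
    by (intro bsupp_compose[OF _ c assms(4)] bsupp_intros f bsupp_shift[OF f])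
  have bsa: "bsupp (\<lambda>x. \<theta> (a j x))" for j
    using bsupp_shift[OF bs0, of "real j *\<^sub>R h"] by (simp add: a_def)
  have inta: "(LBINT x. \<theta> (a j x)) = (LBINT x. \<theta> (real N * (f (x + h) - f x)))" for j
    using integral_lborel_shift[OF bsupp_measurable[OF bs0], of "real j *\<^sub>R h"] by (simp add: a_def)
  have pw: "\<theta> (f (x + real N *\<^sub>R h) - f x) \<le> (\<Sum>j<N. (1 / real N) * \<theta> (a j x))" for x
  proof -
    have "f (x + real N *\<^sub>R h) - f x = (\<Sum>j<N. f (x + real (Suc j) *\<^sub>R h) - f (x + real j *\<^sub>R h))"
      using sum_lessThan_telescope[of "\<lambda>j. f (x + real j *\<^sub>R h)" N] by simp
    also have "\<dots> = (\<Sum>j<N. (1 / real N) *\<^sub>R a j x)"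
      using \<open>N > 0\<close> by (intro sum.cong refl) (simp add: a_def algebra_simps)
    also have "\<theta> \<dots> \<le> (\<Sum>j<N. (1 / real N) * \<theta> (a j x))"
      using \<open>N > 0\<close> by (intro convex_on_sum[OF _ _ assms(2)]) auto
    finally show ?thesis .
  qed
  have "(LBINT x. \<theta> (f (x + real N *\<^sub>R h) - f x)) \<le> (LBINT x. \<Sum>j<N. (1 / real N) * \<theta> (a j x))"
    by (intro integral_mono bsupp_integrable bsupp_sum bsupp_cmult bsa pw bsupp_compose[OF _ c assms(4)] bsupp_intros f bsupp_shift[OF f]) auto
  also have "\<dots> = (\<Sum>j<N. (1 / real N) * (LBINT x. \<theta> (a j x)))"
    using bsupp_integrable[OF bsa] by (subst Bochner_Integration.integral_sum) auto
  also have "\<dots> = (LBINT x. \<theta> (real N * (f (x + h) - f x)))"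
    using \<open>N > 0\<close> by (simp add: inta)
  finally show ?thesis .
qed

section \<open>Compactly supported functions of class C^1\<close>

lemma C1c_zero_outside:
  assumes "C1c \<Omega> \<phi> D" "x \<notin> closure {x. \<phi> x \<noteq> 0}"
  shows "\<phi> x = 0" "D x = 0"
proof -
  show "\<phi> x = 0" using assms(2) closure_subset[of "{x. \<phi> x \<noteq> 0}"] by auto
  have "(\<phi> has_derivative (\<lambda>h. 0 \<bullet> h)) (at x)"
  proof (rule has_derivative_transform_within_open[of "\<lambda>_. 0"])
    show "open (- closure {x. \<phi> x \<noteq> 0})" by auto
    show "x \<in> - closure {x. \<phi> x \<noteq> 0}" using assms(2) by auto
    show "\<And>y. y \<in> - closure {x. \<phi> x \<noteq> 0} \<Longrightarrow> 0 = \<phi> y" using closure_subset by force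
  qed simp
  then have "grad \<phi> x = 0" by (rule grad_eqI)
  moreover have "grad \<phi> x = D x" using assms(1) by (intro grad_eqI) (simp add: C1c_def)
  ultimately show "D x = 0" by simp
qed

lemma C1c_bounds:
  assumes "C1c \<Omega> \<phi> D"
  obtains R L where "\<And>x. norm x > R \<Longrightarrow> \<phi> x = 0" "\<And>x. norm x > R \<Longrightarrow> D x = 0" "R \<ge> 0"
    "\<And>x. norm (D x) \<le> L" "\<And>x y. \<bar>\<phi> x - \<phi> y\<bar> \<le> L * norm (x - y)" "L \<ge> 0"
proof -
  have "bounded (closure {x. \<phi> x \<noteq> 0})" using assms compact_imp_bounded by (auto simp: C1c_def)
  then obtain R0 where R0: "\<And>x. x \<in> closure {x. \<phi> x \<noteq> 0} \<Longrightarrow> norm x \<le> R0" by (auto simp: bounded_iff)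
  define R where "R = max R0 0"
  have R: "\<And>x. norm x > R \<Longrightarrow> x \<notin> closure {x. \<phi> x \<noteq> 0}" using R0 by (force simp: R_def)
  have cD: "continuous_on UNIV D" using assms by (simp add: C1c_def)
  have "bounded (D ` cball 0 R)"
    by (intro compact_imp_bounded compact_continuous_image continuous_on_subset[OF cD]) auto
  then obtain L0 where "\<forall>y\<in>D ` cball 0 R. norm y \<le> L0" unfolding bounded_iff by metis
  then have L0: "\<And>x. x \<in> cball 0 R \<Longrightarrow> norm (D x) \<le> L0" by blast
  define L where "L = max L0 0"
  have L: "norm (D x) \<le> L" for x
    using L0[of x] C1c_zero_outside(2)[OF assms R, of x] by (cases "norm x > R") (auto simp: L_def)
  have "\<bar>\<phi> x - \<phi> y\<bar> \<le> L * norm (x - y)" for x y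
  proof -
    have "norm (\<phi> x - \<phi> y) \<le> L * norm (x - y)"
    proof (rule differentiable_bound[of UNIV])
      show "(\<phi> has_derivative (\<lambda>h. D z \<bullet> h)) (at z within UNIV)" for z using assms by (simp add: C1c_def)
      show "onorm (\<lambda>h. D z \<bullet> h) \<le> L" for z
      proof (rule onorm_le)
        fix h
        have "norm (D z \<bullet> h) \<le> norm (D z) * norm h" by (simp add: Cauchy_Schwarz_ineq2)
        also have "\<dots> \<le> L * norm h" using L by (intro mult_right_mono) auto
        finally show "norm (D z \<bullet> h) \<le> L * norm h" .
      qed
    qed auto
    then show ?thesis by simp
  qed
  then show ?thesis using that[of R L] C1c_zero_outside[OF assms R] L by (auto simp: R_def L_def)
qed

lemma C1c_continuous: "C1c \<Omega> \<phi> D \<Longrightarrow> continuous_on S \<phi>"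
  unfolding C1c_def
  by (meson continuous_at_imp_continuous_on has_derivative_continuous)

lemma C1c_bsupp:
  assumes "C1c \<Omega> \<phi> D" shows "bsupp \<phi>" "bsupp (\<lambda>x. D x \<bullet> h)"
proof -
  obtain R L where *: "\<And>x. norm x > R \<Longrightarrow> \<phi> x = 0" "\<And>x. norm x > R \<Longrightarrow> D x = 0" "R \<ge> 0"
    "\<And>x. norm (D x) \<le> L" "\<And>x y. \<bar>\<phi> x - \<phi> y\<bar> \<le> L * norm (x - y)" "L \<ge> 0" using C1c_bounds[OF assms] by blast
  \<comment> \<open>A point outside the support, from which the Lipschitz bound gives a bound on the
    function itself.\<close>
  obtain z :: 'a where z: "norm z = R + 1" using vector_choose_size[of "R + 1"] * by auto
  show "bsupp \<phi>"
  proof (rule bsuppI[where R = R and B = "L * (R + norm z)"])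
    show "\<phi> \<in> borel_measurable borel" by (rule borel_measurable_continuous_onI[OF C1c_continuous[OF assms]])
    fix x
    show "norm x > R \<Longrightarrow> \<phi> x = 0" by (rule *)
    show "\<bar>\<phi> x\<bar> \<le> L * (R + norm z)"
    proof (cases "norm x > R")
      case False
      have "\<bar>\<phi> x - \<phi> z\<bar> \<le> L * norm (x - z)" by (rule *)
      also have "\<dots> \<le> L * (R + norm z)" using * False norm_triangle_ineq4[of x z] by (intro mult_left_mono) auto
      finally show ?thesis using *(1)[of z] z by simp
    qed (use * in auto)
  qed
  show "bsupp (\<lambda>x. D x \<bullet> h)"
  proof (rule bsuppI[where R = R and B = "L * norm h"])
    have "continuous_on UNIV D" using assms by (simp add: C1c_def)
    then show "(\<lambda>x. D x \<bullet> h) \<in> borel_measurable borel"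
      by (intro borel_measurable_continuous_onI continuous_intros)
    fix x
    show "norm x > R \<Longrightarrow> D x \<bullet> h = 0" using * by simp
    have "\<bar>D x \<bullet> h\<bar> \<le> norm (D x) * norm h" by (rule Cauchy_Schwarz_ineq2)
    also have "\<dots> \<le> L * norm h" using * by (intro mult_right_mono) auto
    finally show "\<bar>D x \<bullet> h\<bar> \<le> L * norm h" .
  qed
qed

lemma C1c_difference_quotient_integral:
  assumes \<phi>: "C1c \<Omega> \<phi> D" and c: "continuous_on UNIV \<theta>" and \<theta>0: "\<theta> 0 = (0::real)"
  shows "(\<lambda>N. (LBINT x. \<theta> (real (Suc N) * (\<phi> (x + (1 / real (Suc N)) *\<^sub>R h) - \<phi> x))))
    \<longlonglongrightarrow> (LBINT x. \<theta> (D x \<bullet> h))"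
proof -
  obtain R L where *: "\<And>x. norm x > R \<Longrightarrow> \<phi> x = 0" "\<And>x. norm x > R \<Longrightarrow> D x = 0" "R \<ge> 0"
    "\<And>x. norm (D x) \<le> L" "\<And>x y. \<bar>\<phi> x - \<phi> y\<bar> \<le> L * norm (x - y)" "L \<ge> 0" using C1c_bounds[OF \<phi>] by blast
  define s where "s N x = real (Suc N) * (\<phi> (x + (1 / real (Suc N)) *\<^sub>R h) - \<phi> x)" for N x
  have "compact (\<theta> ` {- (L * norm h)..L * norm h})"
    by (intro compact_continuous_image continuous_on_subset[OF c]) auto
  then obtain B where B: "\<And>r. \<bar>r\<bar> \<le> L * norm h \<Longrightarrow> \<bar>\<theta> r\<bar> \<le> B"
    by (force dest!: compact_imp_bounded simp: bounded_iff abs_le_iff)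
  have sb: "\<bar>s N x\<bar> \<le> L * norm h" for N x
  proof -
    have "\<bar>s N x\<bar> \<le> real (Suc N) * (L * norm (x + (1 / real (Suc N)) *\<^sub>R h - x))"
      unfolding s_def abs_mult using *(5)[of "x + (1 / real (Suc N)) *\<^sub>R h" x] by (intro mult_mono) auto
    also have "\<dots> = L * norm h" by simp
    finally show ?thesis .
  qed
  have s0: "s N x = 0" if "norm x > R + norm h" for N x
  proof -
    have "norm ((1 / real (Suc N)) *\<^sub>R h) \<le> norm h" by (simp add: field_simps)
    then have "norm (x + (1 / real (Suc N)) *\<^sub>R h) > R"
      using that norm_triangle_ineq2[of x "- ((1 / real (Suc N)) *\<^sub>R h)"] by simp
    moreover have "norm x > R" using that norm_ge_zero[of h] by linarith
    ultimately show ?thesis using * by (simp add: s_def)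
  qed
  have sl: "(\<lambda>N. s N x) \<longlonglongrightarrow> D x \<bullet> h" for x
  proof -
    have "(\<phi> has_derivative (\<lambda>h. D x \<bullet> h)) (at x)" using \<phi> by (simp add: C1c_def)
    moreover have "((\<lambda>r. x + r *\<^sub>R h) has_derivative (\<lambda>r. r *\<^sub>R h)) (at 0)"
      by (auto intro!: derivative_eq_intros)
    ultimately have "((\<lambda>r. \<phi> (x + r *\<^sub>R h)) has_derivative (\<lambda>r. D x \<bullet> (r *\<^sub>R h))) (at 0)"
      using has_derivative_compose[of "\<lambda>r. x + r *\<^sub>R h" "\<lambda>r. r *\<^sub>R h" 0 UNIV \<phi> "\<lambda>h. D x \<bullet> h"] by simp
    moreover have "(\<lambda>r. D x \<bullet> (r *\<^sub>R h)) = (*) (D x \<bullet> h)" by (auto simp: mult.commute)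
    ultimately have "DERIV (\<lambda>r. \<phi> (x + r *\<^sub>R h)) 0 :> D x \<bullet> h" by (simp add: has_field_derivative_def)
    then have "(\<lambda>r. (\<phi> (x + r *\<^sub>R h) - \<phi> x) / r) \<midarrow>0\<rightarrow> D x \<bullet> h" by (simp add: DERIV_def)
    moreover have "filterlim (\<lambda>N. 1 / real (Suc N)) (at 0) sequentially"
      unfolding filterlim_at using LIMSEQ_Suc[OF lim_1_over_n] by auto
    ultimately have "(\<lambda>N. (\<phi> (x + (1 / real (Suc N)) *\<^sub>R h) - \<phi> x) / (1 / real (Suc N))) \<longlonglongrightarrow> D x \<bullet> h"
      by (rule filterlim_compose)
    then show ?thesis unfolding s_def by (simp add: mult.commute)
  qed
  have bs: "bsupp (\<lambda>x. \<theta> (s N x))" for N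
    unfolding s_def by (intro bsupp_compose[OF _ c \<theta>0] bsupp_intros C1c_bsupp[OF \<phi>] bsupp_shift[OF C1c_bsupp(1)[OF \<phi>]])
  have "(\<lambda>N. (LBINT x. \<theta> (s N x))) \<longlonglongrightarrow> (LBINT x. \<theta> (D x \<bullet> h))"
  proof (rule integral_dominated_convergence[where w = "\<lambda>x. B * indicator (cball 0 (R + norm h)) x"])
    show "(\<lambda>x. \<theta> (D x \<bullet> h)) \<in> borel_measurable lborel"
      using bsupp_compose[OF C1c_bsupp(2)[OF \<phi>] c \<theta>0] by (simp add: bsupp_def)
    show "(\<lambda>x. \<theta> (s N x)) \<in> borel_measurable lborel" for N using bs by (simp add: bsupp_def)
    show "integrable lborel (\<lambda>x::'a. B * indicator (cball 0 (R + norm h)) x)"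
      by (intro integrable_mult_right integrable_real_indicator) (auto simp: emeasure_lborel_cball_finite[simplified])
    show "AE x in lborel. (\<lambda>N. \<theta> (s N x)) \<longlonglongrightarrow> \<theta> (D x \<bullet> h)"
      using sl by (intro AE_I2 continuous_on_tendsto_compose[OF c]) auto
    show "AE x in lborel. norm (\<theta> (s N x)) \<le> B * indicator (cball 0 (R + norm h)) x" for N
    proof (rule AE_I2)
      fix x
      show "norm (\<theta> (s N x)) \<le> B * indicator (cball 0 (R + norm h)) x"
        using B[OF sb[of N x]] s0[of x N] \<theta>0 by (cases "norm x > R + norm h") (auto simp: indicator_def)
    qed
  qed
  then show ?thesis by (simp add: s_def)
qed

text \<open>\<open>integral_convex_difference_steps\<close> with h cut into ever finer steps: the
  scaled increments tend to the directional derivative.\<close>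

lemma C1c_integral_convex_difference:
  assumes \<phi>: "C1c \<Omega> \<phi> D" and cvx: "convex_on UNIV \<theta>" and c: "continuous_on UNIV \<theta>" and \<theta>0: "\<theta> 0 = (0::real)"
  shows "(LBINT x. \<theta> (\<phi> (x + h) - \<phi> x)) \<le> (LBINT x. \<theta> (D x \<bullet> h))"
proof (rule LIMSEQ_le_const[OF C1c_difference_quotient_integral[OF \<phi> c \<theta>0]], intro exI[of _ 0] allI impI)
  fix N
  show "(LBINT x. \<theta> (\<phi> (x + h) - \<phi> x))
    \<le> (LBINT x. \<theta> (real (Suc N) * (\<phi> (x + (1 / real (Suc N)) *\<^sub>R h) - \<phi> x)))"
    using integral_convex_difference_steps[OF C1c_bsupp(1)[OF \<phi>] cvx c \<theta>0, of "Suc N" "(1 / real (Suc N)) *\<^sub>R h"]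
    by simp
qed

lemma C1c_integral_derivative:
  assumes \<phi>: "C1c \<Omega> \<phi> D"
  shows "(LBINT x. D x \<bullet> h) = 0"
proof -
  have "(LBINT x. real (Suc N) * (\<phi> (x + (1 / real (Suc N)) *\<^sub>R h) - \<phi> x)) = 0" for N
  proof -
    have i: "integrable lborel (\<lambda>x. \<phi> (x + a))" "integrable lborel \<phi>" for a
      by (intro bsupp_integrable bsupp_shift C1c_bsupp[OF \<phi>])+
    then show ?thesis
      using integral_lborel_shift[OF bsupp_measurable[OF C1c_bsupp(1)[OF \<phi>]]] by simp
  qed
  then show ?thesis
    using C1c_difference_quotient_integral[OF \<phi>, of "\<lambda>x. x" h] LIMSEQ_unique[OF _ tendsto_const] by auto
qed

lemma convex_on_pos_part_square: "convex_on UNIV (\<lambda>s. (max 0 (s - c))\<^sup>2 :: real)"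
proof (rule convex_onI)
  fix t x y :: real assume t: "0 < t" "t < 1"
  have "max 0 ((1 - t) * x + t * y - c) \<le> (1 - t) * max 0 (x - c) + t * max 0 (y - c)"
  proof -
    have "(1 - t) * x + t * y - c = (1 - t) * (x - c) + t * (y - c)" by (simp add: algebra_simps)
    also have "\<dots> \<le> (1 - t) * max 0 (x - c) + t * max 0 (y - c)"
      using t by (intro add_mono mult_left_mono) auto
    finally show ?thesis using t by simp
  qed
  then have "(max 0 ((1 - t) * x + t * y - c))\<^sup>2 \<le> ((1 - t) * max 0 (x - c) + t * max 0 (y - c))\<^sup>2"
    by (intro power_mono) auto
  also have "\<dots> \<le> (1 - t) * (max 0 (x - c))\<^sup>2 + t * (max 0 (y - c))\<^sup>2"
    using convex_onD[OF convex_power2, of t "max 0 (x - c)" "max 0 (y - c)"] t by simp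
  finally show "(max 0 ((1 - t) *\<^sub>R x + t *\<^sub>R y - c))\<^sup>2 \<le> (1 - t) * (max 0 (x - c))\<^sup>2 + t * (max 0 (y - c))\<^sup>2"
    by simp
qed auto

lemma lebesgue_on_integral_eq:
  fixes f :: "'a::euclidean_space \<Rightarrow> real"
  assumes "open \<Omega>" "f \<in> borel_measurable borel"
  shows "integral\<^sup>L (lebesgue_on \<Omega>) f = (LBINT x. indicator \<Omega> x * f x)"
proof -
  have [measurable]: "\<Omega> \<in> sets borel" "f \<in> borel_measurable borel" using assms by auto
  have "integral\<^sup>L (lebesgue_on \<Omega>) f = integral\<^sup>L lebesgue (\<lambda>x. indicator \<Omega> x *\<^sub>R f x)"
    by (rule integral_restrict_space) (use assms in auto)
  also have "\<dots> = (LBINT x. indicator \<Omega> x *\<^sub>R f x)"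
    by (rule integral_completion) simp
  finally show ?thesis by simp
qed

lemma lebesgue_on_integrable_eq:
  fixes f :: "'a::euclidean_space \<Rightarrow> real"
  assumes "open \<Omega>" "f \<in> borel_measurable borel"
  shows "integrable (lebesgue_on \<Omega>) f \<longleftrightarrow> integrable lborel (\<lambda>x. indicator \<Omega> x * f x)"
proof -
  have [measurable]: "\<Omega> \<in> sets borel" "f \<in> borel_measurable borel" using assms by auto
  have "integrable (lebesgue_on \<Omega>) f \<longleftrightarrow> integrable lebesgue (\<lambda>x. indicator \<Omega> x *\<^sub>R f x)"
    by (rule integrable_restrict_space) (use assms in auto)
  also have "\<dots> \<longleftrightarrow> integrable lborel (\<lambda>x. indicator \<Omega> x *\<^sub>R f x)"
    by (rule integrable_completion) simp
  finally show ?thesis by simp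
qed

section \<open>Difference quotients of Sobolev functions\<close>

lemma AE_lborel_open:
  fixes S :: "'a::euclidean_space set"
  assumes "AE x in lborel. P x" "open S" "S \<noteq> {}"
  obtains x where "x \<in> S" "P x"
proof -
  obtain N where N: "N \<in> null_sets lborel" "{x. \<not> P x} \<subseteq> N"
    using assms(1) by (auto simp: eventually_ae_filter)
  have "negligible N" using N(1) null_sets_completionI by (auto simp: negligible_iff_null_sets)
  then have "\<not> S \<subseteq> N" using open_not_negligible[OF assms(2,3)] negligible_subset by blast
  then show ?thesis using N(2) that by blast
qed

lemma square_integrable_add:
  fixes f g :: "'a \<Rightarrow> real"
  assumes [measurable]: "f \<in> borel_measurable M" "g \<in> borel_measurable M"
    and "integrable M (\<lambda>x. (f x)\<^sup>2)" "integrable M (\<lambda>x. (g x)\<^sup>2)"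
  shows "integrable M (\<lambda>x. (f x + g x)\<^sup>2)"
proof (rule Bochner_Integration.integrable_bound)
  show "integrable M (\<lambda>x. 2 * (f x)\<^sup>2 + 2 * (g x)\<^sup>2)" using assms by auto
  show "(\<lambda>x. (f x + g x)\<^sup>2) \<in> borel_measurable M" by measurable
  have "(a + b)\<^sup>2 \<le> 2 * a\<^sup>2 + 2 * b\<^sup>2" for a b :: real
    using sum_squares_bound[of a b] by (simp add: power2_eq_square algebra_simps)
  then show "AE x in M. norm ((f x + g x)\<^sup>2) \<le> norm (2 * (f x)\<^sup>2 + 2 * (g x)\<^sup>2)" by auto
qed

lemma square_integrable_diff:
  fixes f g :: "'a \<Rightarrow> real"
  assumes "f \<in> borel_measurable M" "g \<in> borel_measurable M"
    and "integrable M (\<lambda>x. (f x)\<^sup>2)" "integrable M (\<lambda>x. (g x)\<^sup>2)"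
  shows "integrable M (\<lambda>x. (f x - g x)\<^sup>2)"
  using square_integrable_add[of f M "\<lambda>x. - g x"] assms by simp

lemma contraction_continuous:
  fixes \<tau> :: "real \<Rightarrow> real"
  assumes "\<And>a b. \<bar>\<tau> a - \<tau> b\<bar> \<le> \<bar>a - b\<bar>" shows "continuous_on S \<tau>"
  unfolding continuous_on_iff dist_real_def using assms by (metis le_less_trans)

lemma square_integrable_contraction:
  fixes f :: "'a \<Rightarrow> real"
  assumes f: "f \<in> borel_measurable M" "integrable M (\<lambda>x. (f x)\<^sup>2)"
    and \<tau>: "\<And>a b. \<bar>\<tau> a - \<tau> b\<bar> \<le> \<bar>a - b\<bar>" "\<tau> 0 = (0::real)"
  shows "integrable M (\<lambda>x. (\<tau> (f x))\<^sup>2)"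
proof (rule Bochner_Integration.integrable_bound[OF f(2)])
  have "\<tau> \<in> borel_measurable borel"
    by (rule borel_measurable_continuous_onI[OF contraction_continuous[OF \<tau>(1)]])
  then show "(\<lambda>x. (\<tau> (f x))\<^sup>2) \<in> borel_measurable M" using f(1) by simp
  have "\<bar>\<tau> a\<bar> \<le> \<bar>a\<bar>" for a using \<tau>(1)[of a 0] \<tau>(2) by simp
  then show "AE x in M. norm ((\<tau> (f x))\<^sup>2) \<le> norm ((f x)\<^sup>2)" by (auto simp: abs_le_square_iff[symmetric])
qed

text \<open>Young's inequality (x + y)^2 \<le> (1 + \<eta>) x^2 + (1 + 1/\<eta>) y^2, where \<eta>
  later tends to 0. The contraction \<open>\<tau>\<close> will be the identity, which gives the
  Dirichlet energy, or the excess over |h|, which gives the Lipschitz bound.\<close>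

lemma integral_contraction_square_le:
  fixes a b :: "'a \<Rightarrow> real"
  assumes a: "a \<in> borel_measurable M" "integrable M (\<lambda>x. (a x)\<^sup>2)"
    and b: "b \<in> borel_measurable M" "integrable M (\<lambda>x. (b x)\<^sup>2)"
    and \<tau>: "\<And>a b. \<bar>\<tau> a - \<tau> b\<bar> \<le> \<bar>a - b\<bar>" "\<tau> 0 = (0::real)" and "\<eta> > 0"
  shows "integral\<^sup>L M (\<lambda>x. (\<tau> (a x))\<^sup>2)
    \<le> (1 + \<eta>) * integral\<^sup>L M (\<lambda>x. (\<tau> (b x))\<^sup>2) + (1 + 1/\<eta>) * integral\<^sup>L M (\<lambda>x. (a x - b x)\<^sup>2)"
proof -
  have pw: "(\<tau> p)\<^sup>2 \<le> (1 + \<eta>) * (\<tau> q)\<^sup>2 + (1 + 1/\<eta>) * (p - q)\<^sup>2" for p q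
  proof -
    define x y where "x = \<bar>\<tau> q\<bar>" and "y = \<bar>p - q\<bar>"
    have "\<bar>\<tau> p\<bar> \<le> x + y" using \<tau>(1)[of p q] by (simp add: x_def y_def)
    then have "(\<tau> p)\<^sup>2 \<le> (x + y)\<^sup>2" by (simp add: abs_le_square_iff[symmetric] x_def y_def)
    also have "\<dots> \<le> (1 + \<eta>) * x\<^sup>2 + (1 + 1/\<eta>) * y\<^sup>2"
    proof -
      have "0 \<le> (\<eta> * x - y)\<^sup>2 / \<eta>" using \<open>\<eta> > 0\<close> by simp
      also have "(\<eta> * x - y)\<^sup>2 / \<eta> = \<eta> * x\<^sup>2 + (1/\<eta>) * y\<^sup>2 - 2 * x * y"
        using \<open>\<eta> > 0\<close> by (simp add: power2_eq_square field_simps)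
      finally show ?thesis by (simp add: power2_eq_square algebra_simps)
    qed
    finally show ?thesis by (simp add: x_def y_def)
  qed
  note ib = square_integrable_contraction[OF b \<tau>] and id = square_integrable_diff[OF a(1) b(1) a(2) b(2)]
  have "integral\<^sup>L M (\<lambda>x. (\<tau> (a x))\<^sup>2) \<le> integral\<^sup>L M (\<lambda>x. (1 + \<eta>) * (\<tau> (b x))\<^sup>2 + (1 + 1/\<eta>) * (a x - b x)\<^sup>2)"
    using square_integrable_contraction[OF a \<tau>] ib id by (intro integral_mono pw) auto
  also have "\<dots> = (1 + \<eta>) * integral\<^sup>L M (\<lambda>x. (\<tau> (b x))\<^sup>2) + (1 + 1/\<eta>) * integral\<^sup>L M (\<lambda>x. (a x - b x)\<^sup>2)"
    using ib id by simp
  finally show ?thesis .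
qed

lemma borel_measurable_lebesgue_on:
  fixes f :: "'a::euclidean_space \<Rightarrow> 'b::euclidean_space"
  assumes "f \<in> borel_measurable borel" shows "f \<in> borel_measurable (lebesgue_on \<Omega>)"
  using assms by (intro measurable_restrict_space1 measurable_completion) simp

text \<open>Outside \<Omega> nothing is known about v, so its translates make sense only after
  extension by 0; this extension also encodes the zero boundary values.\<close>

definition zext :: "'a set \<Rightarrow> ('a \<Rightarrow> real) \<Rightarrow> 'a \<Rightarrow> real" where
  "zext \<Omega> v x = (if x \<in> \<Omega> then v x else 0)"

lemma zext_measurable:
  fixes v :: "'a::euclidean_space \<Rightarrow> real"
  assumes "open \<Omega>" "continuous_on \<Omega> v" shows "zext \<Omega> v \<in> borel_measurable borel"
proof -
  have "(\<lambda>x. indicator \<Omega> x *\<^sub>R v x) \<in> borel_measurable borel"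
    using assms by (intro borel_measurable_continuous_on_indicator) auto
  also have "(\<lambda>x. indicator \<Omega> x *\<^sub>R v x) = zext \<Omega> v" by (auto simp: zext_def)
  finally show ?thesis .
qed

lemma lebesgue_on_integral_zext:
  fixes f :: "'a::euclidean_space \<Rightarrow> real"
  assumes "open \<Omega>" "f \<in> borel_measurable borel" "\<And>x. x \<notin> \<Omega> \<Longrightarrow> f x = 0"
  shows "integral\<^sup>L (lebesgue_on \<Omega>) f = integral\<^sup>L lborel f"
    "integrable (lebesgue_on \<Omega>) f \<longleftrightarrow> integrable lborel f"
proof -
  have "(\<lambda>x. indicator \<Omega> x * f x) = f" using assms(3) by (auto simp: indicator_def fun_eq_iff)
  then show "integral\<^sup>L (lebesgue_on \<Omega>) f = integral\<^sup>L lborel f"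
    "integrable (lebesgue_on \<Omega>) f \<longleftrightarrow> integrable lborel f"
    using lebesgue_on_integral_eq[OF assms(1,2)] lebesgue_on_integrable_eq[OF assms(1,2)] by auto
qed

lemma C1c_zero_outside_domain:
  assumes "C1c \<Omega> \<phi> D" "x \<notin> \<Omega>" shows "\<phi> x = 0" "D x = 0"
  using C1c_zero_outside[OF assms(1), of x] assms by (auto simp: C1c_def)

lemma zext_square_integrable:
  fixes v :: "'a::euclidean_space \<Rightarrow> real"
  assumes "open \<Omega>" "continuous_on \<Omega> v" "L2_on \<Omega> v"
  shows "integrable lborel (\<lambda>x. (zext \<Omega> v x)\<^sup>2)"
proof -
  have "integrable (lebesgue_on \<Omega>) (\<lambda>x. (v x)\<^sup>2)" using assms(3) by (simp add: L2_on_def)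
  moreover have "integrable (lebesgue_on \<Omega>) (\<lambda>x. (zext \<Omega> v x)\<^sup>2) \<longleftrightarrow> integrable (lebesgue_on \<Omega>) (\<lambda>x. (v x)\<^sup>2)"
    by (rule Bochner_Integration.integrable_cong[OF refl]) (simp add: zext_def)
  ultimately have "integrable (lebesgue_on \<Omega>) (\<lambda>x. (zext \<Omega> v x)\<^sup>2)" by simp
  moreover have "(\<lambda>x. (zext \<Omega> v x)\<^sup>2) \<in> borel_measurable borel"
    using zext_measurable[OF assms(1,2)] by simp
  ultimately show ?thesis
    by (subst (asm) lebesgue_on_integral_zext(2)[OF assms(1)]) (simp_all add: zext_def)
qed

lemma square_integrable_shift_difference:
  fixes V :: "'a::euclidean_space \<Rightarrow> real"
  assumes "V \<in> borel_measurable borel" "integrable lborel (\<lambda>x. (V x)\<^sup>2)"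
  shows "(\<lambda>x. V (x + h) - V x) \<in> borel_measurable borel" "integrable lborel (\<lambda>x. (V (x + h) - V x)\<^sup>2)"
    "(LBINT x. (V (x + h) - V x)\<^sup>2) \<le> 4 * (LBINT x. (V x)\<^sup>2)"
proof -
  have [measurable]: "V \<in> borel_measurable borel" by fact
  show m: "(\<lambda>x. V (x + h) - V x) \<in> borel_measurable borel" by measurable
  have i: "integrable lborel (\<lambda>x. (V (x + h))\<^sup>2)"
    using integrable_lborel_shift[OF assms(2), of h] by simp
  show i2: "integrable lborel (\<lambda>x. (V (x + h) - V x)\<^sup>2)"
    using i assms(2) by (intro square_integrable_diff) auto
  have "(a - b)\<^sup>2 \<le> 2 * a\<^sup>2 + 2 * b\<^sup>2" for a b :: real
    using sum_squares_bound[of a "- b"] by (simp add: power2_eq_square algebra_simps)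
  then have "(LBINT x. (V (x + h) - V x)\<^sup>2) \<le> (LBINT x. 2 * (V (x + h))\<^sup>2 + 2 * (V x)\<^sup>2)"
    using i i2 assms(2) by (intro integral_mono) auto
  also have "\<dots> = 4 * (LBINT x. (V x)\<^sup>2)"
    using i assms(2) integral_lborel_shift[of "\<lambda>x. (V x)\<^sup>2" h] by simp
  finally show "(LBINT x. (V (x + h) - V x)\<^sup>2) \<le> 4 * (LBINT x. (V x)\<^sup>2)" .
qed

text \<open>Approximating \<open>v\<close> and its weak gradient by smooth functions costs one factor \<open>1 + \<eta>\<close> each.\<close>

lemma H10_difference_bound:
  fixes v :: "'a::euclidean_space \<Rightarrow> real"
  assumes op: "open \<Omega>" and H: "H10 \<Omega> v g" and cv: "continuous_on \<Omega> v"
    and \<tau>: "\<And>a b. \<bar>\<tau> a - \<tau> b\<bar> \<le> \<bar>a - b\<bar>" "\<tau> 0 = (0::real)" and cvx: "convex_on UNIV (\<lambda>s. (\<tau> s)\<^sup>2)"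
  shows "(LBINT x. (\<tau> (zext \<Omega> v (x + h) - zext \<Omega> v x))\<^sup>2)
    \<le> integral\<^sup>L (lebesgue_on \<Omega>) (\<lambda>x. (\<tau> (g x \<bullet> h))\<^sup>2)"
proof -
  let ?M = "lebesgue_on \<Omega>" and ?V = "zext \<Omega> v"
  have L2: "L2_on \<Omega> v" "L2_on \<Omega> g" using H by (auto simp: H10_def weak_grad_def)
  obtain \<phi> D where C: "\<And>k::nat. C1c \<Omega> (\<phi> k) (D k)"
    and l1: "(\<lambda>k. integral\<^sup>L ?M (\<lambda>x. (\<phi> k x - v x)\<^sup>2)) \<longlonglongrightarrow> 0"
    and l2: "(\<lambda>k. integral\<^sup>L ?M (\<lambda>x. (norm (D k x - g x))\<^sup>2)) \<longlonglongrightarrow> 0"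
    using H unfolding H10_def by blast
  note Vm = zext_measurable[OF op cv] and Vi = zext_square_integrable[OF op cv L2(1)]
  have [measurable]: "?V \<in> borel_measurable borel" by (rule Vm)
  have [measurable]: "\<phi> k \<in> borel_measurable borel" for k using bsupp_measurable[OF C1c_bsupp(1)[OF C]] .
  have [measurable]: "g \<in> borel_measurable ?M" using L2(2) by (simp add: L2_on_def)
  have [measurable]: "D k \<in> borel_measurable ?M" for k
    using C[of k] by (intro borel_measurable_lebesgue_on borel_measurable_continuous_onI) (simp add: C1c_def)
  have \<phi>i: "integrable lborel (\<lambda>x. (\<phi> k x)\<^sup>2)" for k
    by (intro bsupp_integrable bsupp_power2 C1c_bsupp(1)[OF C])
  have gi: "integrable ?M (\<lambda>x. (norm (g x))\<^sup>2)" using L2(2) by (simp add: L2_on_def)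
  have ghi: "integrable ?M (\<lambda>x. (g x \<bullet> h)\<^sup>2)"
  proof (rule Bochner_Integration.integrable_bound)
    show "integrable ?M (\<lambda>x. (norm h)\<^sup>2 * (norm (g x))\<^sup>2)" using gi by simp
    have "(g x \<bullet> h)\<^sup>2 \<le> (norm h)\<^sup>2 * (norm (g x))\<^sup>2" for x
      using Cauchy_Schwarz_ineq2[of "g x" h]
      by (metis abs_le_square_iff abs_mult abs_norm_cancel mult.commute power_mult_distrib)
    then show "AE x in ?M. norm ((g x \<bullet> h)\<^sup>2) \<le> norm ((norm h)\<^sup>2 * (norm (g x))\<^sup>2)" by auto
  qed measurable
  have Dhi: "integrable ?M (\<lambda>x. (D k x \<bullet> h)\<^sup>2)" for k h
    using lebesgue_on_integral_zext(2)[OF op, of "\<lambda>x. (D k x \<bullet> h)\<^sup>2"] C1c_bsupp(2)[OF C, of k h]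
      bsupp_integrable[OF bsupp_power2[OF C1c_bsupp(2)[OF C, of k h]]] C1c_zero_outside_domain[OF C]
    by (auto simp: bsupp_def)
  have Dgi: "integrable ?M (\<lambda>x. (norm (D k x - g x))\<^sup>2)" for k
  proof (rule Bochner_Integration.integrable_bound)
    show "integrable ?M (\<lambda>x. 2 * (\<Sum>b\<in>Basis. (D k x \<bullet> b)\<^sup>2) + 2 * (norm (g x))\<^sup>2)"
      using Dhi gi by (intro Bochner_Integration.integrable_add integrable_mult_right Bochner_Integration.integrable_sum) auto
    show "(\<lambda>x. (norm (D k x - g x))\<^sup>2) \<in> borel_measurable ?M" by measurable
    have "(norm (D k x - g x))\<^sup>2 \<le> 2 * (\<Sum>b\<in>Basis. (D k x \<bullet> b)\<^sup>2) + 2 * (norm (g x))\<^sup>2" for x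
    proof -
      have "(\<Sum>b\<in>Basis. (D k x \<bullet> b)\<^sup>2) = (norm (D k x))\<^sup>2"
        unfolding power2_norm_eq_inner[of "D k x"] by (simp add: power2_eq_square euclidean_inner[of "D k x" "D k x"])
      then show ?thesis using norm_parallelogram[of "D k x" "g x"] zero_le_power2[of "norm (D k x + g x)"] by linarith
    qed
    then show "AE x in ?M. norm ((norm (D k x - g x))\<^sup>2) \<le> norm (2 * (\<Sum>b\<in>Basis. (D k x \<bullet> b)\<^sup>2) + 2 * (norm (g x))\<^sup>2)"
      by (intro AE_I2) (smt (verit) real_norm_def zero_le_power2)
  qed
  define A where "A = (LBINT x. (\<tau> (?V (x + h) - ?V x))\<^sup>2)"
  define G where "G = integral\<^sup>L ?M (\<lambda>x. (\<tau> (g x \<bullet> h))\<^sup>2)"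
  have \<theta>c: "continuous_on UNIV (\<lambda>s. (\<tau> s)\<^sup>2)" by (intro continuous_intros contraction_continuous[OF \<tau>(1)])
  have key: "A \<le> (1 + \<eta>) * ((1 + \<eta>) * G)" if \<eta>: "\<eta> > 0" for \<eta>
  proof -
    let ?e1 = "\<lambda>k. integral\<^sup>L ?M (\<lambda>x. (\<phi> k x - v x)\<^sup>2)"
    let ?e2 = "\<lambda>k. integral\<^sup>L ?M (\<lambda>x. (norm (D k x - g x))\<^sup>2)"
    have k: "A \<le> (1 + \<eta>) * ((1 + \<eta>) * G + (1 + 1/\<eta>) * ((norm h)\<^sup>2 * ?e2 k)) + (1 + 1/\<eta>) * (4 * ?e1 k)" for k
    proof -
      have e1: "(LBINT x. (?V x - \<phi> k x)\<^sup>2) = ?e1 k"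
      proof -
        have "?e1 k = integral\<^sup>L ?M (\<lambda>x. (?V x - \<phi> k x)\<^sup>2)"
          by (intro Bochner_Integration.integral_cong) (auto simp: zext_def power2_commute)
        also have "\<dots> = (LBINT x. (?V x - \<phi> k x)\<^sup>2)"
        proof (rule lebesgue_on_integral_zext(1)[OF op])
          show "(\<lambda>x. (?V x - \<phi> k x)\<^sup>2) \<in> borel_measurable borel" by measurable
          show "\<And>x. x \<notin> \<Omega> \<Longrightarrow> (?V x - \<phi> k x)\<^sup>2 = 0"
            using C1c_zero_outside_domain(1)[OF C] by (simp add: zext_def)
        qed
        finally show ?thesis by simp
      qed
      have "A \<le> (1 + \<eta>) * (LBINT x. (\<tau> (\<phi> k (x + h) - \<phi> k x))\<^sup>2)
          + (1 + 1/\<eta>) * (LBINT x. ((?V (x + h) - ?V x) - (\<phi> k (x + h) - \<phi> k x))\<^sup>2)"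
        unfolding A_def
        using square_integrable_shift_difference(1,2)[OF Vm Vi, of h]
          square_integrable_shift_difference(1,2)[of "\<phi> k" h, OF _ \<phi>i]
        by (intro integral_contraction_square_le \<tau> \<eta>) auto
      also have "(LBINT x. ((?V (x + h) - ?V x) - (\<phi> k (x + h) - \<phi> k x))\<^sup>2)
          = (LBINT x. ((?V (x + h) - \<phi> k (x + h)) - (?V x - \<phi> k x))\<^sup>2)"
        by (simp add: algebra_simps)
      also have "\<dots> \<le> 4 * (LBINT x. (?V x - \<phi> k x)\<^sup>2)"
        using square_integrable_diff[of ?V lborel "\<phi> k"] Vi \<phi>i[of k]
        by (intro square_integrable_shift_difference(3)[where V = "\<lambda>x. ?V x - \<phi> k x"]) auto
      also have "(LBINT x. (\<tau> (\<phi> k (x + h) - \<phi> k x))\<^sup>2) \<le> (LBINT x. (\<tau> (D k x \<bullet> h))\<^sup>2)"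
        using C1c_integral_convex_difference[OF C cvx \<theta>c] \<tau>(2) by simp
      also have "(LBINT x. (\<tau> (D k x \<bullet> h))\<^sup>2) = integral\<^sup>L ?M (\<lambda>x. (\<tau> (D k x \<bullet> h))\<^sup>2)"
        using bsupp_compose[OF C1c_bsupp(2)[OF C, of k h] \<theta>c] \<tau>(2) C1c_zero_outside_domain(2)[OF C]
        by (intro lebesgue_on_integral_zext(1)[OF op, symmetric]) (auto simp: bsupp_def)
      also have "\<dots> \<le> (1 + \<eta>) * G + (1 + 1/\<eta>) * integral\<^sup>L ?M (\<lambda>x. (D k x \<bullet> h - g x \<bullet> h)\<^sup>2)"
        unfolding G_def by (intro integral_contraction_square_le \<tau> \<eta> Dhi ghi) measurable
      also have "integral\<^sup>L ?M (\<lambda>x. (D k x \<bullet> h - g x \<bullet> h)\<^sup>2) \<le> integral\<^sup>L ?M (\<lambda>x. (norm h)\<^sup>2 * (norm (D k x - g x))\<^sup>2)"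
      proof (rule integral_mono)
        show "integrable ?M (\<lambda>x. (D k x \<bullet> h - g x \<bullet> h)\<^sup>2)"
          by (intro square_integrable_diff Dhi ghi) measurable
        show "integrable ?M (\<lambda>x. (norm h)\<^sup>2 * (norm (D k x - g x))\<^sup>2)" using Dgi by simp
        fix x
        have "\<bar>(D k x - g x) \<bullet> h\<bar> \<le> \<bar>norm h * norm (D k x - g x)\<bar>"
          using Cauchy_Schwarz_ineq2[of "D k x - g x" h] by (simp add: mult.commute)
        then have "((D k x - g x) \<bullet> h)\<^sup>2 \<le> (norm h * norm (D k x - g x))\<^sup>2"
          unfolding abs_le_square_iff .
        then show "(D k x \<bullet> h - g x \<bullet> h)\<^sup>2 \<le> (norm h)\<^sup>2 * (norm (D k x - g x))\<^sup>2"
          by (simp add: inner_diff_left power_mult_distrib)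
      qed
      finally show ?thesis using \<eta> by (simp add: e1 mult_left_mono add_mono)
    qed
    have "(\<lambda>k. (1 + \<eta>) * ((1 + \<eta>) * G + (1 + 1/\<eta>) * ((norm h)\<^sup>2 * ?e2 k)) + (1 + 1/\<eta>) * (4 * ?e1 k))
        \<longlonglongrightarrow> (1 + \<eta>) * ((1 + \<eta>) * G + (1 + 1/\<eta>) * ((norm h)\<^sup>2 * 0)) + (1 + 1/\<eta>) * (4 * 0)"
      by (intro tendsto_intros l1 l2)
    then have "A \<le> (1 + \<eta>) * ((1 + \<eta>) * G + (1 + 1/\<eta>) * ((norm h)\<^sup>2 * 0)) + (1 + 1/\<eta>) * (4 * 0)"
      by (rule LIMSEQ_le_const) (use k in blast)
    then show ?thesis by simp
  qed
  then have "eventually (\<lambda>\<eta>. A \<le> (1 + \<eta>) * ((1 + \<eta>) * G)) (at_right 0)"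
    by (intro eventually_at_rightI[of 0 1]) auto
  moreover have "((\<lambda>\<eta>. (1 + \<eta>) * ((1 + \<eta>) * G)) \<longlongrightarrow> (1 + 0) * ((1 + 0) * G)) (at_right 0)"
    by (intro tendsto_intros)
  ultimately have "A \<le> (1 + 0) * ((1 + 0) * G)" by (intro tendsto_lowerbound) auto
  then show ?thesis by (simp add: A_def G_def)
qed

section \<open>Admissible functions lie below the distance\<close>

context bounded_domain
begin

text \<open>With the contraction that measures the excess over |h|, the gradient side of
  \<open>H10_difference_bound\<close> vanishes because g . h \<le> |h| almost everywhere.\<close>

lemma admissible_AE_Lipschitz:
  assumes a: "admissible \<Omega> v g" and cv: "continuous_on \<Omega> v"
  shows "AE x in lborel. zext \<Omega> v (x + h) - zext \<Omega> v x \<le> norm h"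
proof -
  define \<tau> where "\<tau> s = max 0 (s - norm h)" for s
  let ?V = "zext \<Omega> v"
  have H: "H10 \<Omega> v g" and g1: "AE x in lebesgue_on \<Omega>. norm (g x) \<le> 1" using a by (auto simp: admissible_def)
  have \<tau>: "\<And>a b. \<bar>\<tau> a - \<tau> b\<bar> \<le> \<bar>a - b\<bar>" "\<tau> 0 = 0" by (auto simp: \<tau>_def)
  have cvx: "convex_on UNIV (\<lambda>s. (\<tau> s)\<^sup>2)" unfolding \<tau>_def by (rule convex_on_pos_part_square)
  have "(LBINT x. (\<tau> (?V (x + h) - ?V x))\<^sup>2) \<le> integral\<^sup>L (lebesgue_on \<Omega>) (\<lambda>x. (\<tau> (g x \<bullet> h))\<^sup>2)"
    by (rule H10_difference_bound[OF open_dom H cv \<tau> cvx])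
  also have "\<dots> = 0"
  proof (rule integral_eq_zero_AE)
    show "AE x in lebesgue_on \<Omega>. (\<tau> (g x \<bullet> h))\<^sup>2 = 0"
      using g1
    proof (eventually_elim)
      case (elim x)
      have "g x \<bullet> h \<le> norm (g x) * norm h" by (rule norm_cauchy_schwarz)
      also have "\<dots> \<le> 1 * norm h" using elim by (intro mult_right_mono) auto
      finally show ?case by (simp add: \<tau>_def)
    qed
  qed
  finally have le0: "(LBINT x. (\<tau> (?V (x + h) - ?V x))\<^sup>2) \<le> 0" .
  have L2: "L2_on \<Omega> v" using H by (auto simp: H10_def weak_grad_def)
  note sd = square_integrable_shift_difference[OF zext_measurable[OF open_dom cv] zext_square_integrable[OF open_dom cv L2], of h]
  have i: "integrable lborel (\<lambda>x. (\<tau> (?V (x + h) - ?V x))\<^sup>2)"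
    using sd(1,2) by (intro square_integrable_contraction[OF _ _ \<tau>]) auto
  have "(LBINT x. (\<tau> (?V (x + h) - ?V x))\<^sup>2) \<ge> 0" by (intro Bochner_Integration.integral_nonneg) auto
  then have "(LBINT x. (\<tau> (?V (x + h) - ?V x))\<^sup>2) = 0" using le0 by linarith
  then have "AE x in lborel. (\<tau> (?V (x + h) - ?V x))\<^sup>2 = 0"
    using i by (subst (asm) integral_nonneg_eq_0_iff_AE) auto
  then show ?thesis by eventually_elim (auto simp: \<tau>_def max_def split: if_splits)
qed

text \<open>If |v x| > |x - y|, then the points z near x with |v z| > |h| and z - h outside the
  closure form a nonempty open set. There the extension jumps from 0 to v z over the displacement h,
  which is possible only on a null set.\<close>

lemma admissible_le_exterior_distance:
  assumes a: "admissible \<Omega> v g" and cv: "continuous_on \<Omega> v" and x: "x \<in> \<Omega>" and y: "y \<notin> closure \<Omega>"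
  shows "\<bar>v x\<bar> \<le> norm (x - y)"
proof -
  let ?V = "zext \<Omega> v"
  define h where "h = x - y"
  have cont: "continuous_on \<Omega> (\<lambda>z. \<bar>v z\<bar>)" by (intro continuous_intros cv)
  define S where "S = (\<Omega> \<inter> (\<lambda>z. \<bar>v z\<bar>) -` {norm h<..}) \<inter> (+) h ` (- closure \<Omega>)"
  have "open S" unfolding S_def using cont open_dom
    by (intro open_Int continuous_open_preimage open_translation) auto
  \<comment> \<open>The bound for h is moved to the base point z - h by translating the exceptional
    null set; the bound for -h covers the other sign of v.\<close>
  moreover have ae: "AE z in lborel. ?V ((z + (- h)) + h) - ?V (z + (- h)) \<le> norm h \<and> ?V (z + (- h)) - ?V z \<le> norm h"
  proof -
    obtain N where N: "N \<in> null_sets lborel" "{z. \<not> ?V (z + h) - ?V z \<le> norm h} \<subseteq> N"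
      using admissible_AE_Lipschitz[OF a cv, of h] by (auto simp: eventually_ae_filter)
    have "negligible N" using N(1) null_sets_completionI by (auto simp: negligible_iff_null_sets)
    then have "negligible ((+) h ` N)" by (rule negligible_translation)
    then have "AE z in lebesgue. z \<notin> (+) h ` N"
      by (simp add: negligible_iff_null_sets AE_not_in)
    then have "AE z in lborel. z \<notin> (+) h ` N" by (simp add: AE_completion_iff)
    then have "AE z in lborel. ?V ((z + (- h)) + h) - ?V (z + (- h)) \<le> norm h"
    proof eventually_elim
      case (elim z)
      have "z + (- h) \<notin> N"
      proof
        assume "z + (- h) \<in> N"
        then have "h + (z + (- h)) \<in> (+) h ` N" by blast
        then show False using elim by simp
      qed
      then have "\<not> \<not> ?V ((z + (- h)) + h) - ?V (z + (- h)) \<le> norm h" using N(2) by blast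
      then show ?case by simp
    qed
    then show ?thesis using admissible_AE_Lipschitz[OF a cv, of "- h"] by eventually_elim auto
  qed
  ultimately have wit: "\<exists>z\<in>S. ?V ((z + (- h)) + h) - ?V (z + (- h)) \<le> norm h \<and> ?V (z + (- h)) - ?V z \<le> norm h"
    if "S \<noteq> {}"
    using AE_lborel_open[OF ae _ that] by blast
  have contra: False if "z \<in> S" and *: "?V ((z + (- h)) + h) - ?V (z + (- h)) \<le> norm h" "?V (z + (- h)) - ?V z \<le> norm h" for z
  proof -
    have "z \<in> \<Omega>" "\<bar>v z\<bar> > norm h" "z - h \<notin> closure \<Omega>" using that(1) by (auto simp: S_def)
    moreover from this have "z - h \<notin> \<Omega>" using closure_subset by auto
    ultimately show False using * by (auto simp: zext_def)
  qed
  have "x \<notin> S" using wit contra by blast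
  moreover have "x \<in> (+) h ` (- closure \<Omega>)" using y by (intro image_eqI[of _ _ y]) (auto simp: h_def)
  ultimately show ?thesis using x by (auto simp: S_def h_def)
qed

text \<open>One half of the equivalence of the two constraints: the gradient constraint implies the
  obstacle constraint. The converse is needed only for the obstacle solution, where it is
  \<open>norm_grad_u_le\<close>.\<close>

lemma admissible_le_bdist:
  assumes C2: "C2_boundary \<Omega>" and a: "admissible \<Omega> v g" and cv: "continuous_on \<Omega> v" and x: "x \<in> \<Omega>"
  shows "\<bar>v x\<bar> \<le> bdist x"
proof (rule field_le_epsilon)
  fix e :: real assume "e > 0"
  obtain z where z: "z \<notin> \<Omega>" "dist x z = bdist x" using nearest_compl_point by blast
  obtain y where y: "dist z y < e" "y \<notin> closure \<Omega>"
    using exterior_near_frontier[OF C2 nearest_in_frontier[OF x z] \<open>e > 0\<close>] by blast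
  have "\<bar>v x\<bar> \<le> dist x y" using admissible_le_exterior_distance[OF a cv x y(2)] by (simp add: dist_norm)
  also have "\<dots> \<le> dist x z + dist z y" by (rule dist_triangle)
  finally show "\<bar>v x\<bar> \<le> bdist x + e" using y z by simp
qed

end

section \<open>Comparison of energies\<close>

text \<open>Enough steps of length t leave the support, so where f is nonzero its square is that of
  an N-step difference; \<open>integral_convex_difference_steps\<close> returns to one step. The
  constant is of order 1 / t^2, uniformly for t up to T.\<close>

lemma discrete_Poincare:
  fixes f :: "'a::euclidean_space \<Rightarrow> real"
  assumes f: "bsupp f" and supp: "\<And>x. f x \<noteq> 0 \<Longrightarrow> norm x \<le> R" and "R \<ge> 0" and t: "0 < t" "t \<le> T" and b: "norm b = 1"
  shows "(LBINT x. (f x)\<^sup>2) \<le> (2 * R + 1 + T)\<^sup>2 / t\<^sup>2 * (LBINT x. (f (x + t *\<^sub>R b) - f x)\<^sup>2)"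
proof -
  \<comment> \<open>Just enough steps to move by 2 R + 1: the excess 1 makes the exit from the ball
    strict, and rounding up costs at most t, hence at most T.\<close>
  define N where "N = nat \<lceil>(2 * R + 1) / t\<rceil>"
  have pos: "(2 * R + 1) / t > 0" using assms by simp
  then have N: "real N \<ge> (2 * R + 1) / t" "real N \<le> (2 * R + 1) / t + 1" "N > 0"
    by (auto simp: N_def)
  have Nt: "real N * t \<ge> 2 * R + 1" "real N * t \<le> 2 * R + 1 + T"
    using N t by (auto simp: field_simps)
  note bs = bsupp_shift[OF f]
  have cv: "continuous_on UNIV (\<lambda>s::real. s\<^sup>2)" by (intro continuous_intros)
  let ?I = "(LBINT x. (f (x + t *\<^sub>R b) - f x)\<^sup>2)"
  have "(LBINT x. (f x)\<^sup>2) \<le> (LBINT x. (f (x + real N *\<^sub>R t *\<^sub>R b) - f x)\<^sup>2)"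
  proof (intro integral_mono bsupp_integrable bsupp_power2 bsupp_diff f bs)
    fix x
    show "(f x)\<^sup>2 \<le> (f (x + real N *\<^sub>R t *\<^sub>R b) - f x)\<^sup>2"
    proof (cases "f x = 0")
      case False
      have "norm (x + real N *\<^sub>R t *\<^sub>R b) \<ge> real N * t - norm x"
        using norm_triangle_ineq2[of "real N *\<^sub>R t *\<^sub>R b" "- x"] b t by (simp add: add.commute)
      then have "f (x + real N *\<^sub>R t *\<^sub>R b) = 0"
        using supp[of "x + real N *\<^sub>R t *\<^sub>R b"] supp[OF False] Nt by fastforce
      then show ?thesis by simp
    qed simp
  qed
  also have "\<dots> \<le> (LBINT x. (real N * (f (x + t *\<^sub>R b) - f x))\<^sup>2)"
    using convex_power2 by (intro integral_convex_difference_steps[OF f _ cv] N(3)) auto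
  also have "\<dots> = (real N)\<^sup>2 * ?I" by (simp add: power_mult_distrib)
  also have "\<dots> \<le> ((2 * R + 1 + T) / t)\<^sup>2 * ?I"
    using Nt t by (intro mult_right_mono power_mono Bochner_Integration.integral_nonneg) (auto simp: field_simps)
  finally show ?thesis by (simp add: power_divide)
qed

context obst_limit
begin

lemma dom_radius: obtains R where "R \<ge> 0" "\<And>x. x \<in> \<Omega> \<Longrightarrow> norm x \<le> R"
proof -
  obtain R where "\<And>x. x \<in> \<Omega> \<Longrightarrow> norm x \<le> R" using bounded_dom by (auto simp: bounded_iff)
  then show ?thesis using that[of "max R 0"] by fastforce
qed

lemma bsupp_of_abs_le_bdist:
  assumes "f \<in> borel_measurable borel" "\<And>x. \<bar>f x\<bar> \<le> bdist x"
  shows "bsupp f"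
proof -
  obtain D where D: "\<And>x. bdist x \<le> D" using bdist_bounded by blast
  obtain R where R: "\<And>x. x \<in> \<Omega> \<Longrightarrow> norm x \<le> R" using dom_radius by blast
  show ?thesis
  proof (rule bsuppI[OF assms(1), where B = D and R = R])
    show "\<bar>f x\<bar> \<le> D" for x using assms(2)[of x] D[of x] by linarith
    show "f x = 0" if "norm x > R" for x
    proof -
      have "x \<notin> \<Omega>" using R[of x] that by auto
      then show ?thesis using assms(2)[of x] bdist_outside[of x] by simp
    qed
  qed
qed

lemma bsupp_w: "bsupp (w k)"
  using dobst_nonneg[OF \<rho>_pos] dobst_le_bdist[OF \<rho>_pos]
  by (intro bsupp_of_abs_le_bdist borel_measurable_continuous_onI continuous_w) (simp add: abs_of_nonneg)

lemma bsupp_u: "bsupp u"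
  using u_nonneg u_le_bdist
  by (intro bsupp_of_abs_le_bdist borel_measurable_continuous_onI continuous_u) (simp add: abs_of_nonneg)

lemma w_outside: "x \<notin> \<Omega> \<Longrightarrow> w k x = 0"
  using contact[of x] bdist_outside[of x] \<sigma>_pos by simp

text \<open>The discrete obstacle problem is exactly an Euler--Lagrange inequality: \<open>w - navg w\<close> is at most
  \<open>\<tau>\<^sup>2 / (2 \<rho>)\<close>, with equality off the contact set, where alone \<open>V - w\<close> can be positive.\<close>

lemma discrete_energy_comparison:
  assumes V: "bsupp V" and Vle: "\<And>x. V x \<le> bdist x"
  shows "(\<Sum>b\<in>Basis. (LBINT x. (w k (x + \<tau> k *\<^sub>R b) - w k x)\<^sup>2))
     + (\<Sum>b\<in>Basis. (LBINT x. ((V (x + \<tau> k *\<^sub>R b) - w k (x + \<tau> k *\<^sub>R b)) - (V x - w k x))\<^sup>2))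
     + (\<tau> k)\<^sup>2 * (2 * DIM('a) / \<rho>) * (LBINT x. V x - w k x)
     \<le> (\<Sum>b\<in>Basis. (LBINT x. (V (x + \<tau> k *\<^sub>R b) - V x)\<^sup>2))"
proof -
  let ?w = "w k" and ?t = "\<tau> k"
  define p where "p x = V x - ?w x" for x
  have p: "bsupp p" unfolding p_def by (intro bsupp_diff V bsupp_w)
  note bs = bsupp_shift[OF V] bsupp_shift[OF p] bsupp_shift[OF bsupp_w] V p bsupp_w
  define X where "X b = (LBINT x. (?w (x + ?t *\<^sub>R b) - ?w x) * (p (x + ?t *\<^sub>R b) - p x))" for b
  have split: "(LBINT x. (V (x + ?t *\<^sub>R b) - V x)\<^sup>2)
    = (LBINT x. (?w (x + ?t *\<^sub>R b) - ?w x)\<^sup>2) + (LBINT x. (p (x + ?t *\<^sub>R b) - p x)\<^sup>2) + 2 * X b" for b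
  proof -
    have i: "integrable lborel (\<lambda>x. (?w (x + ?t *\<^sub>R b) - ?w x)\<^sup>2)" "integrable lborel (\<lambda>x. (p (x + ?t *\<^sub>R b) - p x)\<^sup>2)"
      "integrable lborel (\<lambda>x. (?w (x + ?t *\<^sub>R b) - ?w x) * (p (x + ?t *\<^sub>R b) - p x))"
      by (intro bsupp_integrable bsupp_power2 bsupp_mult bsupp_diff bs)+
    have "(LBINT x. (V (x + ?t *\<^sub>R b) - V x)\<^sup>2)
      = (LBINT x. (?w (x + ?t *\<^sub>R b) - ?w x)\<^sup>2 + (p (x + ?t *\<^sub>R b) - p x)\<^sup>2
         + 2 * ((?w (x + ?t *\<^sub>R b) - ?w x) * (p (x + ?t *\<^sub>R b) - p x)))"
      by (intro Bochner_Integration.integral_cong refl) (simp add: p_def power2_eq_square algebra_simps)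
    also have "\<dots> = (LBINT x. (?w (x + ?t *\<^sub>R b) - ?w x)\<^sup>2) + (LBINT x. (p (x + ?t *\<^sub>R b) - p x)\<^sup>2) + 2 * X b"
      using i by (simp add: X_def)
    finally show ?thesis .
  qed
  have "2 * (\<Sum>b\<in>Basis. X b) \<ge> ?t\<^sup>2 * (2 * DIM('a) / \<rho>) * integral\<^sup>L lborel p"
  proof -
    have d: "bsupp (\<lambda>x. (?w (x + ?t *\<^sub>R b) + ?w (x - ?t *\<^sub>R b) - 2 * ?w x) * p x)" for b
      using bsupp_shift[OF bsupp_w, of k "- (?t *\<^sub>R b)"]
      by (intro bsupp_mult bsupp_diff bsupp_add bsupp_cmult bs) simp
    have sumd: "(\<Sum>b\<in>Basis. (?w (x + ?t *\<^sub>R b) + ?w (x - ?t *\<^sub>R b) - 2 * ?w x) * p x)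
        = - (2 * DIM('a) * (?w x - navg ?t ?w x) * p x)" for x
    proof -
      have "(\<Sum>b\<in>Basis. ?w (x + ?t *\<^sub>R b) + ?w (x - ?t *\<^sub>R b) - 2 * ?w x) = 2 * DIM('a) * navg ?t ?w x - DIM('a) * (2 * ?w x)"
        by (simp add: sum_subtractf navg_def)
      then have "(\<Sum>b\<in>Basis. ?w (x + ?t *\<^sub>R b) + ?w (x - ?t *\<^sub>R b) - 2 * ?w x) * p x
          = (2 * DIM('a) * navg ?t ?w x - DIM('a) * (2 * ?w x)) * p x" by (simp only:)
      also have "\<dots> = - (2 * DIM('a) * (?w x - navg ?t ?w x) * p x)" by (simp add: algebra_simps)
      finally show ?thesis unfolding sum_distrib_right[symmetric] .
    qed
    have "(\<Sum>b\<in>Basis. X b) = - (\<Sum>b\<in>Basis. (LBINT x. (?w (x + ?t *\<^sub>R b) + ?w (x - ?t *\<^sub>R b) - 2 * ?w x) * p x))"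
      unfolding X_def discrete_Green[OF bsupp_w p] by (simp add: sum_negf)
    also have "\<dots> = - (LBINT x. \<Sum>b\<in>Basis. (?w (x + ?t *\<^sub>R b) + ?w (x - ?t *\<^sub>R b) - 2 * ?w x) * p x)"
      using bsupp_integrable[OF d] by (subst Bochner_Integration.integral_sum) auto
    also have "\<dots> = (LBINT x. 2 * DIM('a) * (?w x - navg ?t ?w x) * p x)"
      unfolding sumd by simp
    also have "\<dots> \<ge> (LBINT x. ?t\<^sup>2 * (DIM('a) / \<rho>) * p x)"
    proof (rule integral_mono)
      show "integrable lborel (\<lambda>x. ?t\<^sup>2 * (DIM('a) / \<rho>) * p x)" by (intro bsupp_integrable bsupp_cmult p)
      have "bsupp (\<lambda>x. \<Sum>b\<in>Basis. (?w (x + ?t *\<^sub>R b) + ?w (x - ?t *\<^sub>R b) - 2 * ?w x) * p x)"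
        by (intro bsupp_sum d) auto
      from bsupp_integrable[OF this] show "integrable lborel (\<lambda>x. 2 * DIM('a) * (?w x - navg ?t ?w x) * p x)"
        unfolding sumd by simp
      fix x
      have "(?w x - navg ?t ?w x - ?t\<^sup>2 / (2 * \<rho>)) * p x \<ge> 0"
      proof (cases "?w x < bdist x")
        case True
        then show ?thesis using dobst_eq_navg[OF \<rho>_pos True] by simp
      next
        case False
        then have "p x \<le> 0" using Vle[of x] by (simp add: p_def)
        moreover have "?w x - navg ?t ?w x - ?t\<^sup>2 / (2 * \<rho>) \<le> 0" using dobst_le_navg[OF \<rho>_pos, of ?t x] by simp
        ultimately show ?thesis by (rule mult_nonpos_nonpos[rotated])
      qed
      then have "2 * DIM('a) * ((?w x - navg ?t ?w x - ?t\<^sup>2 / (2 * \<rho>)) * p x) \<ge> 0" by simp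
      then show "?t\<^sup>2 * (DIM('a) / \<rho>) * p x \<le> 2 * DIM('a) * (?w x - navg ?t ?w x) * p x"
        by (simp add: algebra_simps)
    qed
    finally have "(\<Sum>b\<in>Basis. X b) \<ge> ?t\<^sup>2 * (DIM('a) / \<rho>) * integral\<^sup>L lborel p" by simp
    then have "2 * (\<Sum>b\<in>Basis. X b) \<ge> 2 * (?t\<^sup>2 * (DIM('a) / \<rho>) * integral\<^sup>L lborel p)" by simp
    then show ?thesis by (simp add: algebra_simps)
  qed
  then show ?thesis unfolding split by (simp add: sum.distrib sum_distrib_left p_def[abs_def])
qed

lemma w_energy_limit:
  assumes b: "b \<in> Basis"
  shows "(\<lambda>k. (LBINT x. indicator \<Omega> x * ((w k (x + \<tau> k *\<^sub>R b) - w k x) / \<tau> k)\<^sup>2))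
    \<longlonglongrightarrow> (LBINT x. indicator \<Omega> x * (grad u x \<bullet> b)\<^sup>2)"
proof (rule integral_dominated_convergence[where w = "\<lambda>x. indicator \<Omega> x"])
  have [measurable]: "\<Omega> \<in> sets borel" using open_dom by simp
  have "(\<lambda>x. indicator \<Omega> x *\<^sub>R (grad u x \<bullet> b)\<^sup>2) \<in> borel_measurable borel"
    by (intro borel_measurable_continuous_on_indicator continuous_intros continuous_grad_u) simp
  then show "(\<lambda>x. indicator \<Omega> x * (grad u x \<bullet> b)\<^sup>2) \<in> borel_measurable lborel" by simp
  have [measurable]: "w k \<in> borel_measurable borel" for k using bsupp_w by (simp add: bsupp_def)
  show "(\<lambda>x. indicator \<Omega> x * ((w k (x + \<tau> k *\<^sub>R b) - w k x) / \<tau> k)\<^sup>2) \<in> borel_measurable lborel" for k by measurable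
  show "integrable lborel (\<lambda>x. indicator \<Omega> x :: real)"
    using bounded_dom emeasure_bounded_finite[of \<Omega>] by (intro integrable_real_indicator) auto
  show "AE x in lborel. (\<lambda>k. indicator \<Omega> x * ((w k (x + \<tau> k *\<^sub>R b) - w k x) / \<tau> k)\<^sup>2) \<longlonglongrightarrow> indicator \<Omega> x * (grad u x \<bullet> b)\<^sup>2"
  proof (rule AE_I2)
    fix x
    show "(\<lambda>k. indicator \<Omega> x * ((w k (x + \<tau> k *\<^sub>R b) - w k x) / \<tau> k)\<^sup>2) \<longlonglongrightarrow> indicator \<Omega> x * (grad u x \<bullet> b)\<^sup>2"
      by (cases "x \<in> \<Omega>") (auto intro!: tendsto_intros w_difference_quotient b)
  qed
  show "AE x in lborel. norm (indicator \<Omega> x * ((w k (x + \<tau> k *\<^sub>R b) - w k x) / \<tau> k)\<^sup>2) \<le> indicator \<Omega> x" for k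
  proof (rule AE_I2)
    fix x
    have "\<bar>w k (x + \<tau> k *\<^sub>R b) - w k x\<bar> \<le> \<tau> k"
      using w_Lipschitz_abs[of k "x + \<tau> k *\<^sub>R b" x] b \<tau>_pos[of k] by (simp add: dist_norm)
    then have "\<bar>(w k (x + \<tau> k *\<^sub>R b) - w k x) / \<tau> k\<bar> \<le> 1" using \<tau>_pos[of k] by (simp add: field_simps)
    then have "((w k (x + \<tau> k *\<^sub>R b) - w k x) / \<tau> k)\<^sup>2 \<le> 1" by (simp add: abs_square_le_1)
    then show "norm (indicator \<Omega> x * ((w k (x + \<tau> k *\<^sub>R b) - w k x) / \<tau> k)\<^sup>2) \<le> indicator \<Omega> x"
      by (simp add: indicator_def)
  qed
qed

lemma w_integral_limits:
  assumes V: "bsupp V"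
  shows "(\<lambda>k. integral\<^sup>L lborel (w k)) \<longlonglongrightarrow> integral\<^sup>L lborel u"
    "(\<lambda>k. (LBINT x. (V x - w k x)\<^sup>2)) \<longlonglongrightarrow> (LBINT x. (V x - u x)\<^sup>2)"
proof -
  have [measurable]: "w k \<in> borel_measurable borel" "u \<in> borel_measurable borel" "V \<in> borel_measurable borel" for k
    using bsupp_w bsupp_u V by (auto simp: bsupp_def)
  have bb: "bsupp bdist"
    using bdist_nonneg
    by (intro bsupp_of_abs_le_bdist borel_measurable_continuous_onI continuous_bdist) simp
  have wb: "\<bar>w k x\<bar> \<le> bdist x" for k x
    using dobst_nonneg[OF \<rho>_pos] dobst_le_bdist[OF \<rho>_pos] by (simp add: abs_of_nonneg)
  show "(\<lambda>k. integral\<^sup>L lborel (w k)) \<longlonglongrightarrow> integral\<^sup>L lborel u"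
    by (rule integral_dominated_convergence[where w = bdist])
      (auto intro!: bsupp_integrable bb wb u_lim)
  show "(\<lambda>k. (LBINT x. (V x - w k x)\<^sup>2)) \<longlonglongrightarrow> (LBINT x. (V x - u x)\<^sup>2)"
  proof (rule integral_dominated_convergence[where w = "\<lambda>x. 2 * (V x)\<^sup>2 + 2 * (bdist x)\<^sup>2"])
    show "integrable lborel (\<lambda>x. 2 * (V x)\<^sup>2 + 2 * (bdist x)\<^sup>2)"
      by (intro bsupp_integrable bsupp_add bsupp_cmult bsupp_power2 V bb)
    show "AE x in lborel. (\<lambda>k. (V x - w k x)\<^sup>2) \<longlonglongrightarrow> (V x - u x)\<^sup>2"
      by (intro AE_I2 tendsto_intros u_lim)
    show "AE x in lborel. norm ((V x - w k x)\<^sup>2) \<le> 2 * (V x)\<^sup>2 + 2 * (bdist x)\<^sup>2" for k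
    proof (rule AE_I2)
      fix x
      have "(V x - w k x)\<^sup>2 \<le> 2 * (V x)\<^sup>2 + 2 * (w k x)\<^sup>2"
        using sum_squares_bound[of "V x" "- w k x"] by (simp add: power2_eq_square algebra_simps)
      moreover have "(w k x)\<^sup>2 \<le> (bdist x)\<^sup>2"
        using wb[of k x] dobst_nonneg[OF \<rho>_pos] by (intro power_mono) auto
      ultimately show "norm ((V x - w k x)\<^sup>2) \<le> 2 * (V x)\<^sup>2 + 2 * (bdist x)\<^sup>2" by simp
    qed
  qed measurable
qed

lemma grad_u_component_square:
  assumes "b \<in> Basis"
  shows "integrable (lebesgue_on \<Omega>) (\<lambda>x. (grad u x \<bullet> b)\<^sup>2)"
    "integral\<^sup>L (lebesgue_on \<Omega>) (\<lambda>x. (grad u x \<bullet> b)\<^sup>2) = (LBINT x. indicator \<Omega> x * (grad u x \<bullet> b)\<^sup>2)"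
proof -
  let ?M = "lebesgue_on \<Omega>"
  obtain R where R: "R \<ge> 0" "\<And>x. x \<in> \<Omega> \<Longrightarrow> norm x \<le> R" using dom_radius by blast
  let ?G = "\<lambda>x. indicator \<Omega> x * (grad u x \<bullet> b)\<^sup>2"
  have "(\<lambda>x. indicator \<Omega> x *\<^sub>R (grad u x \<bullet> b)\<^sup>2) \<in> borel_measurable borel"
    using open_dom by (intro borel_measurable_continuous_on_indicator continuous_intros continuous_grad_u) simp
  then have G: "?G \<in> borel_measurable borel" by simp
  have "bsupp ?G"
  proof (rule bsuppI[OF G, where B = 1 and R = R])
    fix x
    show "norm x > R \<Longrightarrow> ?G x = 0" using R(2)[of x] by (auto simp: indicator_def)
    show "\<bar>?G x\<bar> \<le> 1"
    proof (cases "x \<in> \<Omega>")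
      case True
      have "\<bar>grad u x \<bullet> b\<bar> \<le> 1" using Basis_le_norm[OF assms, of "grad u x"] norm_grad_u_le[OF True] by linarith
      then show ?thesis using True by (simp add: abs_square_le_1)
    qed simp
  qed
  moreover have "integral\<^sup>L ?M (\<lambda>x. (grad u x \<bullet> b)\<^sup>2) = integral\<^sup>L ?M ?G"
    "integrable ?M (\<lambda>x. (grad u x \<bullet> b)\<^sup>2) \<longleftrightarrow> integrable ?M ?G"
    by (intro Bochner_Integration.integral_cong Bochner_Integration.integrable_cong refl; simp)+
  ultimately show "integrable ?M (\<lambda>x. (grad u x \<bullet> b)\<^sup>2)"
   "integral\<^sup>L ?M (\<lambda>x. (grad u x \<bullet> b)\<^sup>2) = integral\<^sup>L lborel ?G"
    using lebesgue_on_integral_zext[OF open_dom G] bsupp_integrable by auto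
qed

text \<open>Divide the discrete comparison by \<tau>^2 and let the scale tend to 0. The energy of V
  - w is not discarded: the discrete Poincare inequality, uniform in the scale, turns it into the
  L^2 gap that later gives v = u.\<close>

lemma energy_lower_bound:
  assumes adm: "admissible \<Omega> v g" and cv: "continuous_on \<Omega> v" and le: "\<And>x. x \<in> \<Omega> \<Longrightarrow> \<bar>v x\<bar> \<le> bdist x"
  shows "\<exists>c>0. energy \<Omega> (2 * DIM('a) / \<rho>) u (grad u) + c * (LBINT x. (zext \<Omega> v x - u x)\<^sup>2)
     \<le> energy \<Omega> (2 * DIM('a) / \<rho>) v g"
proof -
  let ?V = "zext \<Omega> v" and ?M = "lebesgue_on \<Omega>" and ?m = "2 * DIM('a) / \<rho>"
  have H: "H10 \<Omega> v g" using adm by (simp add: admissible_def)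
  have L2: "L2_on \<Omega> v" "L2_on \<Omega> g" using H by (auto simp: H10_def weak_grad_def)
  have Vle: "\<bar>?V x\<bar> \<le> bdist x" for x using le bdist_nonneg by (simp add: zext_def)
  have V: "bsupp ?V" by (intro bsupp_of_abs_le_bdist zext_measurable open_dom cv Vle)
  obtain R where R: "R \<ge> 0" "\<And>x. x \<in> \<Omega> \<Longrightarrow> norm x \<le> R" using dom_radius by blast
  \<comment> \<open>The inverse of the constant in \<open>discrete_Poincare\<close> with T =
    \<sigma>, which is the same for all k.\<close>
  define c where "c = 1 / (2 * R + 1 + \<sigma>)\<^sup>2"
  have c: "c > 0" using R \<sigma>_pos by (simp add: c_def)
  have [measurable]: "g \<in> borel_measurable ?M" using L2(2) by (simp add: L2_on_def)
  have gi: "integrable ?M (\<lambda>x. (norm (g x))\<^sup>2)" using L2(2) by (simp add: L2_on_def)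
  have gbi: "integrable ?M (\<lambda>x. (g x \<bullet> b)\<^sup>2)" if "b \<in> Basis" for b
  proof (rule Bochner_Integration.integrable_bound[OF gi])
    have "\<bar>g x \<bullet> b\<bar> \<le> \<bar>norm (g x)\<bar>" for x using Basis_le_norm[OF that, of "g x"] by simp
    then show "AE x in ?M. norm ((g x \<bullet> b)\<^sup>2) \<le> norm ((norm (g x))\<^sup>2)" by (simp only: abs_le_square_iff) auto
  qed measurable
  have sq: "(norm y)\<^sup>2 = (\<Sum>b\<in>Basis. (y \<bullet> b)\<^sup>2)" for y :: 'a
    unfolding power2_norm_eq_inner[of y] by (simp add: power2_eq_square euclidean_inner[of y y])
  have vM: "integral\<^sup>L ?M v = integral\<^sup>L lborel ?V" "integrable ?M v"
  proof -
    have 1: "integral\<^sup>L ?M v = integral\<^sup>L ?M ?V" "integrable ?M v \<longleftrightarrow> integrable ?M ?V"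
      by (intro Bochner_Integration.integral_cong Bochner_Integration.integrable_cong refl; simp add: zext_def)+
    then show "integral\<^sup>L ?M v = integral\<^sup>L lborel ?V" "integrable ?M v"
      using lebesgue_on_integral_zext[OF open_dom bsupp_measurable[OF V]] bsupp_integrable[OF V]
      by (auto simp: zext_def)
  qed
  have Ev: "energy \<Omega> ?m v g = (\<Sum>b\<in>Basis. integral\<^sup>L ?M (\<lambda>x. (g x \<bullet> b)\<^sup>2)) - ?m * integral\<^sup>L lborel ?V"
    unfolding energy_def using gi gbi vM by (simp add: sq)
  note gu = grad_u_component_square
  have uM: "integral\<^sup>L ?M u = integral\<^sup>L lborel u" "integrable ?M u"
    using lebesgue_on_integral_zext[OF open_dom bsupp_measurable[OF bsupp_u] u_outside] bsupp_integrable[OF bsupp_u] by auto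
  have Eu: "energy \<Omega> ?m u (grad u) = (\<Sum>b\<in>Basis. (LBINT x. indicator \<Omega> x * (grad u x \<bullet> b)\<^sup>2)) - ?m * integral\<^sup>L lborel u"
  proof -
    have "energy \<Omega> ?m u (grad u) = integral\<^sup>L ?M (\<lambda>x. (\<Sum>b\<in>Basis. (grad u x \<bullet> b)\<^sup>2) - ?m * u x)"
      unfolding energy_def sq ..
    also have "\<dots> = (\<Sum>b\<in>Basis. integral\<^sup>L ?M (\<lambda>x. (grad u x \<bullet> b)\<^sup>2)) - ?m * integral\<^sup>L ?M u"
      using gu(1) uM(2) by simp
    finally show ?thesis using gu(2) uM(1) by simp
  qed
  have step: "(\<Sum>b\<in>Basis. (LBINT x. indicator \<Omega> x * ((w k (x + \<tau> k *\<^sub>R b) - w k x) / \<tau> k)\<^sup>2))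
       - ?m * integral\<^sup>L lborel (w k) + c * (LBINT x. (?V x - w k x)\<^sup>2) \<le> energy \<Omega> ?m v g" for k
  proof -
    let ?t = "\<tau> k"
    let ?p = "\<lambda>x. ?V x - w k x"
    define A where "A b = (LBINT x. (w k (x + ?t *\<^sub>R b) - w k x)\<^sup>2)" for b
    define B where "B b = (LBINT x. (?p (x + ?t *\<^sub>R b) - ?p x)\<^sup>2)" for b
    define C where "C b = (LBINT x. (?V (x + ?t *\<^sub>R b) - ?V x)\<^sup>2)" for b
    have t: "?t > 0" "?t \<le> \<sigma>" using \<tau>_pos[of k] \<tau>_le[of k] by auto
    have p: "bsupp ?p" by (intro bsupp_diff V bsupp_w)
    have main: "(\<Sum>b\<in>Basis. A b) + (\<Sum>b\<in>Basis. B b) + ?t\<^sup>2 * ?m * integral\<^sup>L lborel ?p \<le> (\<Sum>b\<in>Basis. C b)"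
      using discrete_energy_comparison[OF V, of k] Vle unfolding A_def B_def C_def by (simp add: abs_le_iff)
    have Cle: "C b \<le> ?t\<^sup>2 * integral\<^sup>L ?M (\<lambda>x. (g x \<bullet> b)\<^sup>2)" for b
      using H10_difference_bound[OF open_dom H cv, of "\<lambda>s. s" "?t *\<^sub>R b"] convex_power2
      by (simp add: C_def power_mult_distrib)
    have Ale: "?t\<^sup>2 * (LBINT x. indicator \<Omega> x * ((w k (x + ?t *\<^sub>R b) - w k x) / ?t)\<^sup>2) \<le> A b" for b
    proof -
      have bs: "bsupp (\<lambda>x. (w k (x + ?t *\<^sub>R b) - w k x)\<^sup>2)"
        by (intro bsupp_power2 bsupp_diff bsupp_shift[OF bsupp_w] bsupp_w)
      have "integrable lborel (\<lambda>x. indicator \<Omega> x *\<^sub>R (w k (x + ?t *\<^sub>R b) - w k x)\<^sup>2)"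
        by (rule integrable_mult_indicator[OF _ bsupp_integrable[OF bs]]) (use open_dom in simp)
      then have "integrable lborel (\<lambda>x. indicator \<Omega> x * (w k (x + ?t *\<^sub>R b) - w k x)\<^sup>2)" by simp
      then have "(LBINT x. indicator \<Omega> x * (w k (x + ?t *\<^sub>R b) - w k x)\<^sup>2) \<le> A b"
        unfolding A_def by (rule integral_mono[OF _ bsupp_integrable[OF bs]]) (simp add: indicator_def)
      then show ?thesis using t by (simp add: power_divide)
    qed
    \<comment> \<open>Differences along a single axis suffice for the Poincare inequality; the other
      axes only add nonnegative terms.\<close>
    obtain b0 :: 'a where b0: "b0 \<in> Basis" using nonempty_Basis by blast
    have "(LBINT x. (?p x)\<^sup>2) \<le> (2 * R + 1 + \<sigma>)\<^sup>2 / ?t\<^sup>2 * B b0"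
      unfolding B_def
    proof (rule discrete_Poincare[OF p _ R(1) t])
      fix x assume "?p x \<noteq> 0"
      then have "x \<in> \<Omega>" using w_outside[of x k] by (cases "x \<in> \<Omega>") (simp_all add: zext_def)
      then show "norm x \<le> R" by (rule R)
    qed (use b0 in simp)
    then have "?t\<^sup>2 * (c * (LBINT x. (?p x)\<^sup>2)) \<le> ?t\<^sup>2 * (c * ((2 * R + 1 + \<sigma>)\<^sup>2 / ?t\<^sup>2 * B b0))"
      using c by (intro mult_left_mono) auto
    also have "\<dots> = B b0"
    proof -
      have "2 * R + 1 + \<sigma> > 0" using R \<sigma>_pos by simp
      then show ?thesis using t unfolding c_def by simp
    qed
    also have "B b0 \<le> (\<Sum>b\<in>Basis. B b)"
      using b0 unfolding B_def by (intro member_le_sum Bochner_Integration.integral_nonneg) auto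
    finally have Ble: "?t\<^sup>2 * (c * (LBINT x. (?p x)\<^sup>2)) \<le> (\<Sum>b\<in>Basis. B b)" .
    have ip: "integral\<^sup>L lborel ?p = integral\<^sup>L lborel ?V - integral\<^sup>L lborel (w k)"
      using bsupp_integrable V bsupp_w by (intro Bochner_Integration.integral_diff) auto
    let ?S1 = "\<Sum>b\<in>Basis. (LBINT x. indicator \<Omega> x * ((w k (x + ?t *\<^sub>R b) - w k x) / ?t)\<^sup>2)"
    let ?S2 = "\<Sum>b\<in>Basis. integral\<^sup>L ?M (\<lambda>x. (g x \<bullet> b)\<^sup>2)"
    have "?t\<^sup>2 * ?S1 \<le> (\<Sum>b\<in>Basis. A b)" unfolding sum_distrib_left by (intro sum_mono Ale)
    moreover have "(\<Sum>b\<in>Basis. C b) \<le> ?t\<^sup>2 * ?S2" unfolding sum_distrib_left by (intro sum_mono Cle)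
    ultimately have "?t\<^sup>2 * ?S1 + ?t\<^sup>2 * (c * (LBINT x. (?p x)\<^sup>2))
      + ?t\<^sup>2 * ?m * (integral\<^sup>L lborel ?V - integral\<^sup>L lborel (w k)) \<le> ?t\<^sup>2 * ?S2"
      using main Ble unfolding ip by linarith
    then have "?t\<^sup>2 * (?S1 + c * (LBINT x. (?p x)\<^sup>2) + ?m * (integral\<^sup>L lborel ?V - integral\<^sup>L lborel (w k))) \<le> ?t\<^sup>2 * ?S2"
      by (simp only: distrib_left mult.assoc)
    then have "?S1 + c * (LBINT x. (?p x)\<^sup>2) + ?m * (integral\<^sup>L lborel ?V - integral\<^sup>L lborel (w k)) \<le> ?S2"
      using t by simp
    then show ?thesis unfolding Ev by (simp add: right_diff_distrib)
  qed
  have "(\<lambda>k. (\<Sum>b\<in>Basis. (LBINT x. indicator \<Omega> x * ((w k (x + \<tau> k *\<^sub>R b) - w k x) / \<tau> k)\<^sup>2))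
       - ?m * integral\<^sup>L lborel (w k) + c * (LBINT x. (?V x - w k x)\<^sup>2))
     \<longlonglongrightarrow> (\<Sum>b\<in>Basis. (LBINT x. indicator \<Omega> x * (grad u x \<bullet> b)\<^sup>2))
       - ?m * integral\<^sup>L lborel u + c * (LBINT x. (?V x - u x)\<^sup>2)"
    by (intro tendsto_intros w_energy_limit w_integral_limits(1)[OF V] w_integral_limits(2)[OF V])
  then have "(\<Sum>b\<in>Basis. (LBINT x. indicator \<Omega> x * (grad u x \<bullet> b)\<^sup>2))
       - ?m * integral\<^sup>L lborel u + c * (LBINT x. (?V x - u x)\<^sup>2) \<le> energy \<Omega> ?m v g"
    by (rule LIMSEQ_le_const2) (use step in blast)
  then show ?thesis using c unfolding Eu by auto
qed

end

section \<open>The limit is the minimizer\<close>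

lemma C1c_intro:
  assumes op: "open \<Omega>" and S: "compact S" "S \<subseteq> \<Omega>"
    and d: "\<And>x. x \<in> \<Omega> \<Longrightarrow> (\<psi> has_derivative (\<lambda>h. D x \<bullet> h)) (at x)"
    and c: "continuous_on \<Omega> D" and z: "\<And>x. x \<notin> S \<Longrightarrow> \<psi> x = 0" "\<And>x. x \<notin> S \<Longrightarrow> D x = 0"
  shows "C1c \<Omega> \<psi> D"
  unfolding C1c_def
proof (intro conjI allI)
  have oS: "open (- S)" using S by (simp add: compact_imp_closed open_Compl)
  show "(\<psi> has_derivative (\<lambda>h. D x \<bullet> h)) (at x)" for x
  proof (cases "x \<in> \<Omega>")
    case False
    then have x: "x \<in> - S" using S by auto
    have "(\<psi> has_derivative (\<lambda>h. 0)) (at x)"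
      by (rule has_derivative_transform_within_open[OF has_derivative_const[of 0] oS x]) (use z in auto)
    then show ?thesis using z(2)[of x] x by simp
  qed (rule d)
  have "continuous_on (- S) D" using z(2) by (subst continuous_on_cong[OF refl, of _ _ "\<lambda>_. 0"]) auto
  then have "continuous_on (\<Omega> \<union> - S) D" using c op oS by (intro continuous_on_open_Un) auto
  moreover have "\<Omega> \<union> - S = UNIV" using S by auto
  ultimately show "continuous_on UNIV D" by simp
  have "closure {x. \<psi> x \<noteq> 0} \<subseteq> S" using z(1) S by (intro closure_minimal compact_imp_closed) auto
  then show "closure {x. \<psi> x \<noteq> 0} \<subseteq> \<Omega>" "compact (closure {x. \<psi> x \<noteq> 0})"
    using S compact_eq_bounded_closed bounded_subset closed_closure by (blast, metis order_trans)
qed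

text \<open>A \<open>C\<^sup>1\<close> truncation: \<open>soft_cut \<epsilon> s = (s - \<epsilon>)\<^sup>2 / s\<close> above \<open>\<epsilon>\<close> and \<open>0\<close> below.\<close>

definition soft_cut :: "real \<Rightarrow> real \<Rightarrow> real" where
  "soft_cut \<epsilon> s = max s \<epsilon> - 2 * \<epsilon> + \<epsilon>\<^sup>2 / max s \<epsilon>"

definition dsoft_cut :: "real \<Rightarrow> real \<Rightarrow> real" where
  "dsoft_cut \<epsilon> s = 1 - (\<epsilon> / max s \<epsilon>)\<^sup>2"

lemma soft_cut_zero: "\<epsilon> > 0 \<Longrightarrow> s \<le> \<epsilon> \<Longrightarrow> soft_cut \<epsilon> s = 0" "\<epsilon> > 0 \<Longrightarrow> s \<le> \<epsilon> \<Longrightarrow> dsoft_cut \<epsilon> s = 0"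
  by (auto simp: soft_cut_def dsoft_cut_def max_def power2_eq_square)

lemma soft_cut_has_derivative:
  assumes \<epsilon>: "\<epsilon> > 0" shows "(soft_cut \<epsilon> has_real_derivative dsoft_cut \<epsilon> s) (at s)"
proof (cases s \<epsilon> rule: linorder_cases)
  case less
  have "(soft_cut \<epsilon> has_real_derivative 0) (at s)"
    by (rule has_field_derivative_transform_within_open[OF DERIV_const[of 0], of "{..<\<epsilon>}"])
      (use less soft_cut_zero[OF \<epsilon>] in auto)
  then show ?thesis using less soft_cut_zero[OF \<epsilon>] by simp
next
  case greater
  then have s: "s \<noteq> 0" using \<epsilon> by simp
  have "((\<lambda>s. s - 2 * \<epsilon> + \<epsilon>\<^sup>2 / s) has_real_derivative 1 - \<epsilon>\<^sup>2 / s\<^sup>2) (at s)"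
    using s by (auto intro!: derivative_eq_intros simp: power2_eq_square)
  then have "(soft_cut \<epsilon> has_real_derivative 1 - \<epsilon>\<^sup>2 / s\<^sup>2) (at s)"
    by (rule has_field_derivative_transform_within_open[of _ _ _ "{\<epsilon><..}"])
      (use greater in \<open>auto simp: soft_cut_def max_def\<close>)
  then show ?thesis using greater by (simp add: dsoft_cut_def max_def power_divide)
next
  case equal
  have "(soft_cut \<epsilon> has_derivative (\<lambda>h. 0 \<bullet> h)) (at s)"
  proof (rule quadratic_bound_has_derivative[of 1])
    fix h :: real
    show "\<bar>soft_cut \<epsilon> (s + h) - soft_cut \<epsilon> s - 0 \<bullet> h\<bar> \<le> 1 / \<epsilon> * (norm h)\<^sup>2"
    proof (cases "h \<le> 0")
      case True
      then show ?thesis using soft_cut_zero[OF \<epsilon>] equal \<epsilon> by simp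
    next
      case False
      have "soft_cut \<epsilon> (s + h) = h\<^sup>2 / (\<epsilon> + h)"
        using False \<epsilon> equal by (simp add: soft_cut_def max_def power2_eq_square field_simps)
      moreover have "h\<^sup>2 / (\<epsilon> + h) \<le> h\<^sup>2 / \<epsilon>" using False \<epsilon> by (intro divide_left_mono) auto
      moreover have "h\<^sup>2 / (\<epsilon> + h) \<ge> 0" using False \<epsilon> by simp
      moreover have "soft_cut \<epsilon> s = 0" using soft_cut_zero(1)[OF \<epsilon>] equal by simp
      moreover have "1 / \<epsilon> * (norm h)\<^sup>2 = h\<^sup>2 / \<epsilon>" by simp
      ultimately show ?thesis by (simp only: inner_zero_left diff_zero abs_of_nonneg)
    qed
  qed simp
  moreover have "(\<lambda>h::real. 0 \<bullet> h) = (*) 0" by auto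
  ultimately have "(soft_cut \<epsilon> has_real_derivative 0) (at s)" by (simp add: has_field_derivative_def)
  then show ?thesis using equal soft_cut_zero[OF \<epsilon>] by simp
qed

lemma soft_cut_diff_bound:
  assumes "\<epsilon> > 0" "s \<ge> 0" shows "\<bar>soft_cut \<epsilon> s - s\<bar> \<le> 2 * \<epsilon>"
proof (cases "s \<le> \<epsilon>")
  case True
  then show ?thesis using soft_cut_zero[OF assms(1)] assms by simp
next
  case False
  have "\<epsilon>\<^sup>2 / s \<le> \<epsilon>" using False assms by (simp add: field_simps power2_eq_square)
  moreover have "\<epsilon>\<^sup>2 / s \<ge> 0" using assms by simp
  ultimately show ?thesis using False assms by (simp add: soft_cut_def max_def)
qed

lemma dsoft_cut_range:
  assumes "\<epsilon> > 0" shows "0 \<le> dsoft_cut \<epsilon> s" "dsoft_cut \<epsilon> s \<le> 1"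
proof -
  have "0 \<le> \<epsilon> / max s \<epsilon>" "\<epsilon> / max s \<epsilon> \<le> 1" using assms by (auto simp: field_simps max_def)
  then have "(\<epsilon> / max s \<epsilon>)\<^sup>2 \<le> 1" by (simp add: power_le_one)
  then show "0 \<le> dsoft_cut \<epsilon> s" "dsoft_cut \<epsilon> s \<le> 1" by (auto simp: dsoft_cut_def)
qed

lemma continuous_dsoft_cut:
  assumes "\<epsilon> > 0" shows "continuous_on S (dsoft_cut \<epsilon>)"
  unfolding dsoft_cut_def[abs_def] using assms by (intro continuous_intros) (auto simp: max_def)

section \<open>Admissibility of the limit and uniqueness\<close>

context obst_limit
begin

lemma finite_measure_dom: "finite_measure (lebesgue_on \<Omega>)"
  using open_dom bounded_dom by (intro finite_measure_lebesgue_on) (simp add: bounded_set_imp_lmeasurable)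

lemma grad_u_measurable: "grad u \<in> borel_measurable (lebesgue_on \<Omega>)"
  using open_dom by (intro continuous_imp_measurable_on_sets_lebesgue continuous_grad_u) simp

lemma u_L2: "L2_on \<Omega> u"
  unfolding L2_on_def
proof
  show "u \<in> borel_measurable (lebesgue_on \<Omega>)"
    using bsupp_u by (intro borel_measurable_lebesgue_on) (simp add: bsupp_def)
  show "integrable (lebesgue_on \<Omega>) (\<lambda>x. (norm (u x))\<^sup>2)"
    using lebesgue_on_integral_zext(2)[OF open_dom, of "\<lambda>x. (u x)\<^sup>2"] bsupp_power2[OF bsupp_u]
      bsupp_integrable[OF bsupp_power2[OF bsupp_u]] u_outside
    by (simp add: bsupp_def)
qed

lemma grad_u_L2: "L2_on \<Omega> (grad u)"
  unfolding L2_on_def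
proof
  show "integrable (lebesgue_on \<Omega>) (\<lambda>x. (norm (grad u x))\<^sup>2)"
  proof (rule finite_measure.integrable_const_bound[OF finite_measure_dom, where B = 1])
    show "AE x in lebesgue_on \<Omega>. norm ((norm (grad u x))\<^sup>2) \<le> 1"
      using norm_grad_u_le by (intro AE_I2) (simp add: abs_square_le_1)
    show "(\<lambda>x. (norm (grad u x))\<^sup>2) \<in> borel_measurable (lebesgue_on \<Omega>)"
      using grad_u_measurable by measurable
  qed
qed (rule grad_u_measurable)

text \<open>The product of u with a test function is again of class C^1 with compact support in
  \<Omega>, so integration by parts reduces to the vanishing of the integral of its
  derivative.\<close>

lemma u_weak_grad: "weak_grad \<Omega> u (grad u)"
  unfolding weak_grad_def
proof (intro conjI u_L2 grad_u_L2 allI impI ballI)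
  fix \<phi> D and i :: 'a
  assume C: "C1c \<Omega> \<phi> D" and i: "i \<in> Basis"
  let ?M = "lebesgue_on \<Omega>"
  define \<psi> where "\<psi> x = u x * \<phi> x" for x
  define E where "E x = u x *\<^sub>R D x + \<phi> x *\<^sub>R grad u x" for x
  have C\<psi>: "C1c \<Omega> \<psi> E"
  proof (rule C1c_intro[OF open_dom, of "closure {x. \<phi> x \<noteq> 0}"])
    show "compact (closure {x. \<phi> x \<noteq> 0})" "closure {x. \<phi> x \<noteq> 0} \<subseteq> \<Omega>" using C by (auto simp: C1c_def)
    show "(\<psi> has_derivative (\<lambda>h. E x \<bullet> h)) (at x)" if "x \<in> \<Omega>" for x
    proof -
      have "(\<phi> has_derivative (\<lambda>h. D x \<bullet> h)) (at x)" using C by (simp add: C1c_def)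
      from has_derivative_mult[OF u_has_derivative[OF that] this] show ?thesis
        unfolding \<psi>_def[abs_def] E_def by (simp add: inner_add_left algebra_simps)
    qed
    have "continuous_on \<Omega> D" using C continuous_on_subset by (auto simp: C1c_def)
    then show "continuous_on \<Omega> E" unfolding E_def[abs_def]
      using continuous_u[of \<Omega>] continuous_grad_u C1c_continuous[OF C, of \<Omega>]
      by (simp add: continuous_on_add continuous_on_scaleR)
    show "\<And>x. x \<notin> closure {x. \<phi> x \<noteq> 0} \<Longrightarrow> \<psi> x = 0" "\<And>x. x \<notin> closure {x. \<phi> x \<noteq> 0} \<Longrightarrow> E x = 0"
      unfolding \<psi>_def E_def using C1c_zero_outside[OF C] by (metis mult_zero_right, metis add_0 scaleR_zero_left scaleR_zero_right)
  qed
  have b1: "bsupp (\<lambda>x. E x \<bullet> i)" by (rule C1c_bsupp(2)[OF C\<psi>])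
  have b2: "bsupp (\<lambda>x. u x * (D x \<bullet> i))" by (intro bsupp_mult bsupp_u C1c_bsupp(2)[OF C])
  have M1: "integral\<^sup>L ?M (\<lambda>x. E x \<bullet> i) = 0" "integrable ?M (\<lambda>x. E x \<bullet> i)"
    using lebesgue_on_integral_zext[OF open_dom bsupp_measurable[OF b1]] C1c_zero_outside_domain(2)[OF C\<psi>]
      C1c_integral_derivative[OF C\<psi>] bsupp_integrable[OF b1] by auto
  have M2: "integrable ?M (\<lambda>x. u x * (D x \<bullet> i))"
    using lebesgue_on_integral_zext(2)[OF open_dom bsupp_measurable[OF b2]] C1c_zero_outside_domain(2)[OF C]
      bsupp_integrable[OF b2] by auto
  have "integral\<^sup>L ?M (\<lambda>x. (grad u x \<bullet> i) * \<phi> x) = integral\<^sup>L ?M (\<lambda>x. E x \<bullet> i - u x * (D x \<bullet> i))"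
    by (simp add: E_def inner_add_left mult.commute)
  also have "\<dots> = - integral\<^sup>L ?M (\<lambda>x. u x * (D x \<bullet> i))" using M1 M2 by simp
  finally show "integral\<^sup>L ?M (\<lambda>x. u x * (D x \<bullet> i)) = - integral\<^sup>L ?M (\<lambda>x. (grad u x \<bullet> i) * \<phi> x)" by simp
qed

lemma soft_cut_u_C1c:
  assumes "\<epsilon> > 0"
  shows "C1c \<Omega> (\<lambda>x. soft_cut \<epsilon> (u x)) (\<lambda>x. dsoft_cut \<epsilon> (u x) *\<^sub>R grad u x)"
proof (rule C1c_intro[OF open_dom, of "{x. \<epsilon> \<le> u x}"])
  show sub: "{x. \<epsilon> \<le> u x} \<subseteq> \<Omega>" using u_outside assms by force
  have "closed {x. \<epsilon> \<le> u x}" by (intro closed_Collect_le continuous_intros continuous_u)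
  then show "compact {x. \<epsilon> \<le> u x}" using bounded_subset[OF bounded_dom sub] by (simp add: compact_eq_bounded_closed)
  show "((\<lambda>x. soft_cut \<epsilon> (u x)) has_derivative (\<lambda>h. dsoft_cut \<epsilon> (u x) *\<^sub>R grad u x \<bullet> h)) (at x)" if "x \<in> \<Omega>" for x
  proof -
    have "(soft_cut \<epsilon> has_derivative (*) (dsoft_cut \<epsilon> (u x))) (at (u x))"
      using soft_cut_has_derivative[OF assms] by (simp add: has_field_derivative_def)
    from has_derivative_compose[OF u_has_derivative[OF that] this] show ?thesis by simp
  qed
  show "continuous_on \<Omega> (\<lambda>x. dsoft_cut \<epsilon> (u x) *\<^sub>R grad u x)"
    by (intro continuous_intros continuous_grad_u continuous_on_compose2[OF continuous_dsoft_cut[OF assms, of UNIV] continuous_u]) auto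
  show "\<And>x. x \<notin> {x. \<epsilon> \<le> u x} \<Longrightarrow> soft_cut \<epsilon> (u x) = 0"
    "\<And>x. x \<notin> {x. \<epsilon> \<le> u x} \<Longrightarrow> dsoft_cut \<epsilon> (u x) *\<^sub>R grad u x = 0"
    using soft_cut_zero[OF assms] by auto
qed

text \<open>The truncations of u have compact support because superlevel sets {u \<ge> \<epsilon>}
  with \<epsilon> > 0 are compact in \<Omega>. Their gradients converge at every point of \<Omega>
  because u is positive there; this is where \<open>\<rho> \<le> \<sigma>\<close> enters.\<close>

lemma u_H10:
  assumes "\<rho> \<le> \<sigma>" shows "H10 \<Omega> u (grad u)"
  unfolding H10_def
proof (intro conjI u_weak_grad exI allI)
  let ?M = "lebesgue_on \<Omega>"
  define e where "e k = 1 / real (Suc k)" for k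
  have e: "e k > 0" "e k \<le> 1" for k by (auto simp: e_def)
  have e0: "e \<longlonglongrightarrow> 0" unfolding e_def[abs_def] using LIMSEQ_Suc[OF lim_1_over_n] by simp
  let ?\<phi> = "\<lambda>k x. soft_cut (e k) (u x)" and ?D = "\<lambda>k x. dsoft_cut (e k) (u x) *\<^sub>R grad u x"
  show C: "C1c \<Omega> (?\<phi> k) (?D k)" for k by (rule soft_cut_u_C1c[OF e(1)])
  have ic: "integrable ?M (\<lambda>x. c :: real)" for c
    using finite_measure.integrable_const[OF finite_measure_dom] .
  have [measurable]: "u \<in> borel_measurable ?M" using u_L2 by (simp add: L2_on_def)
  have [measurable]: "?\<phi> k \<in> borel_measurable ?M" for k
    using C1c_bsupp(1)[OF C] by (intro borel_measurable_lebesgue_on) (simp add: bsupp_def)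
  have [measurable]: "?D k \<in> borel_measurable ?M" for k
    using C[of k] by (intro borel_measurable_lebesgue_on borel_measurable_continuous_onI) (simp add: C1c_def)
  note [measurable] = grad_u_measurable
  have "(\<lambda>k. integral\<^sup>L ?M (\<lambda>x. (?\<phi> k x - u x)\<^sup>2)) \<longlonglongrightarrow> integral\<^sup>L ?M (\<lambda>x. 0)"
  proof (rule integral_dominated_convergence[where w = "\<lambda>x. 4"])
    show "AE x in ?M. (\<lambda>k. (?\<phi> k x - u x)\<^sup>2) \<longlonglongrightarrow> 0"
    proof (rule AE_I2)
      fix x
      have "(\<lambda>k. ?\<phi> k x - u x) \<longlonglongrightarrow> 0"
      proof (rule Lim_null_comparison[OF always_eventually])
        show "\<forall>k. norm (?\<phi> k x - u x) \<le> 2 * e k" using soft_cut_diff_bound[OF e(1) u_nonneg] by simp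
        show "(\<lambda>k. 2 * e k) \<longlonglongrightarrow> 0" using tendsto_mult_right_zero[OF e0] by simp
      qed
      then show "(\<lambda>k. (?\<phi> k x - u x)\<^sup>2) \<longlonglongrightarrow> 0" using tendsto_power[of _ 0 _ 2] by fastforce
    qed
    show "AE x in ?M. norm ((?\<phi> k x - u x)\<^sup>2) \<le> 4" for k
    proof (rule AE_I2)
      fix x
      have "\<bar>?\<phi> k x - u x\<bar> \<le> 2" using soft_cut_diff_bound[OF e(1)[of k] u_nonneg[of x]] e(2)[of k] by linarith
      then have "\<bar>?\<phi> k x - u x\<bar> ^ 2 \<le> 2 ^ 2" by (intro power_mono) auto
      then show "norm ((?\<phi> k x - u x)\<^sup>2) \<le> 4" by simp
    qed
  qed (use ic in measurable)
  then show "(\<lambda>k. integral\<^sup>L ?M (\<lambda>x. (?\<phi> k x - u x)\<^sup>2)) \<longlonglongrightarrow> 0" by simp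
  have "(\<lambda>k. integral\<^sup>L ?M (\<lambda>x. (norm (?D k x - grad u x))\<^sup>2)) \<longlonglongrightarrow> integral\<^sup>L ?M (\<lambda>x. 0)"
  proof (rule integral_dominated_convergence[where w = "\<lambda>x. 1"])
    have eq: "norm (?D k x - grad u x) = (1 - dsoft_cut (e k) (u x)) * norm (grad u x)" for k x
    proof -
      have "?D k x - grad u x = (dsoft_cut (e k) (u x) - 1) *\<^sub>R grad u x" by (simp add: scaleR_diff_left)
      then show ?thesis using dsoft_cut_range[OF e(1)] by simp
    qed
    show "AE x in ?M. (\<lambda>k. (norm (?D k x - grad u x))\<^sup>2) \<longlonglongrightarrow> 0"
    proof (rule AE_I2)
      fix x assume "x \<in> space ?M"
      then have pos: "u x > 0" using u_pos[OF assms] by simp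
      have "(\<lambda>k. (((e k / max (u x) (e k))\<^sup>2) * norm (grad u x))\<^sup>2) \<longlonglongrightarrow> (((0 / max (u x) 0)\<^sup>2) * norm (grad u x))\<^sup>2"
        using pos by (intro tendsto_intros e0) auto
      then show "(\<lambda>k. (norm (?D k x - grad u x))\<^sup>2) \<longlonglongrightarrow> 0" unfolding eq unfolding dsoft_cut_def by simp
    qed
    show "AE x in ?M. norm ((norm (?D k x - grad u x))\<^sup>2) \<le> 1" for k
    proof (rule AE_I2)
      fix x assume "x \<in> space ?M"
      then have "(1 - dsoft_cut (e k) (u x)) * norm (grad u x) \<le> 1 * 1"
        using dsoft_cut_range[OF e(1)] norm_grad_u_le by (intro mult_mono) auto
      moreover have "(1 - dsoft_cut (e k) (u x)) * norm (grad u x) \<ge> 0" using dsoft_cut_range[OF e(1)] by simp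
      ultimately show "norm ((norm (?D k x - grad u x))\<^sup>2) \<le> 1" unfolding eq by (simp add: power_le_one)
    qed
  qed (use ic in measurable)
  then show "(\<lambda>k. integral\<^sup>L ?M (\<lambda>x. (norm (?D k x - grad u x))\<^sup>2)) \<longlonglongrightarrow> 0" by simp
qed

text \<open>Since u is a competitor, the gap in \<open>energy_lower_bound\<close> must vanish, so v
  = u almost everywhere. Continuity upgrades this to every point, as pointwise gradients
  require.\<close>

lemma minimizer_eq_u:
  assumes C2: "C2_boundary \<Omega>" and "\<rho> \<le> \<sigma>" and cv: "continuous_on \<Omega> v"
    and min: "is_minimizer \<Omega> (2 * DIM('a) / \<rho>) v" and x: "x \<in> \<Omega>"
  shows "v x = u x"
proof -
  let ?V = "zext \<Omega> v"
  obtain g where adm: "admissible \<Omega> v g"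
    and opt: "\<And>w h. admissible \<Omega> w h \<Longrightarrow> energy \<Omega> (2 * DIM('a) / \<rho>) v g \<le> energy \<Omega> (2 * DIM('a) / \<rho>) w h"
    using min unfolding is_minimizer_def by blast
  have le: "\<bar>v y\<bar> \<le> bdist y" if "y \<in> \<Omega>" for y by (rule admissible_le_bdist[OF C2 adm cv that])
  obtain c where c: "c > 0" "energy \<Omega> (2 * DIM('a) / \<rho>) u (grad u) + c * (LBINT x. (?V x - u x)\<^sup>2)
     \<le> energy \<Omega> (2 * DIM('a) / \<rho>) v g"
    using energy_lower_bound[OF adm cv le] by blast
  have "admissible \<Omega> u (grad u)"
    unfolding admissible_def using u_H10[OF assms(2)] norm_grad_u_le by (auto intro: AE_I2)
  from opt[OF this] have "c * (LBINT x. (?V x - u x)\<^sup>2) \<le> 0" using c(2) by linarith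
  then have "(LBINT x. (?V x - u x)\<^sup>2) \<le> 0" using c(1) by (simp add: mult_le_0_iff)
  moreover have "(LBINT x. (?V x - u x)\<^sup>2) \<ge> 0" by (intro Bochner_Integration.integral_nonneg) simp
  moreover have V: "bsupp ?V"
    using le bdist_nonneg by (intro bsupp_of_abs_le_bdist zext_measurable open_dom cv) (simp add: zext_def)
  moreover have "integrable lborel (\<lambda>x. (?V x - u x)\<^sup>2)"
    by (intro bsupp_integrable bsupp_power2 bsupp_diff V bsupp_u)
  ultimately have "integrable lborel (\<lambda>x. (?V x - u x)\<^sup>2)" "(LBINT x. (?V x - u x)\<^sup>2) = 0"
    by linarith+
  then have "AE x in lborel. (?V x - u x)\<^sup>2 = 0"
    by (subst (asm) integral_nonneg_eq_0_iff_AE) auto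
  then have ae: "AE x in lborel. ?V x = u x" by eventually_elim simp
  define S where "S = {y\<in>\<Omega>. v y \<noteq> u y}"
  have "open S"
  proof -
    have "continuous_on \<Omega> (\<lambda>y. v y - u y)" by (intro continuous_intros cv continuous_u)
    then have "open (\<Omega> \<inter> (\<lambda>y. v y - u y) -` (- {0}))" using open_dom by (intro continuous_open_preimage) auto
    moreover have "\<Omega> \<inter> (\<lambda>y. v y - u y) -` (- {0}) = S" by (auto simp: S_def)
    ultimately show ?thesis by simp
  qed
  have "S = {}"
  proof (rule ccontr)
    assume "S \<noteq> {}"
    then obtain y where "y \<in> S" "?V y = u y" using AE_lborel_open[OF ae \<open>open S\<close>] by blast
    then show False by (simp add: S_def zext_def)
  qed
  then show ?thesis using x by (auto simp: S_def)
qed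

end

section \<open>Convergence to the medial axis\<close>

text \<open>Along its own gradient g, the function has derivative |g|^2, which the assumed growth
  bounds by c |g|.\<close>

lemma gradient_norm_le_of_ray:
  fixes v :: "'a::real_inner \<Rightarrow> real"
  assumes d: "(v has_derivative (\<lambda>h. g \<bullet> h)) (at x)" and "e > 0"
    and up: "\<And>s. 0 < s \<Longrightarrow> s < e \<Longrightarrow> v (x + s *\<^sub>R g) \<le> v x + s * (c * norm g)" and "c \<ge> 0"
  shows "norm g \<le> c"
proof -
  have "((\<lambda>r. x + r *\<^sub>R g) has_derivative (\<lambda>r. r *\<^sub>R g)) (at 0)"
    by (auto intro!: derivative_eq_intros)
  then have "((\<lambda>r. v (x + r *\<^sub>R g)) has_derivative (\<lambda>r. g \<bullet> (r *\<^sub>R g))) (at 0)"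
    using has_derivative_compose[of "\<lambda>r. x + r *\<^sub>R g" "\<lambda>r. r *\<^sub>R g" 0 UNIV v "\<lambda>h. g \<bullet> h"] d by simp
  moreover have "(\<lambda>r. g \<bullet> (r *\<^sub>R g)) = (*) (g \<bullet> g)" by (auto simp: mult.commute)
  ultimately have "DERIV (\<lambda>r. v (x + r *\<^sub>R g)) 0 :> g \<bullet> g" by (simp add: has_field_derivative_def)
  then have "((\<lambda>r. (v (x + r *\<^sub>R g) - v x) / r) \<longlongrightarrow> g \<bullet> g) (at 0)" by (simp add: DERIV_def)
  then have "((\<lambda>r. (v (x + r *\<^sub>R g) - v x) / r) \<longlongrightarrow> g \<bullet> g) (at_right 0)"
    by (rule tendsto_mono[OF at_le[OF subset_UNIV]])
  moreover have "eventually (\<lambda>r. (v (x + r *\<^sub>R g) - v x) / r \<le> c * norm g) (at_right 0)"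
  proof (rule eventually_at_rightI[OF _ \<open>e > 0\<close>])
    fix s assume "s \<in> {0<..<e}"
    then show "(v (x + s *\<^sub>R g) - v x) / s \<le> c * norm g" using up[of s] by (simp add: field_simps)
  qed
  ultimately have "g \<bullet> g \<le> c * norm g" by (intro tendsto_upperbound) auto
  then have "norm g * norm g \<le> c * norm g" by (simp add: dot_square_norm power2_eq_square)
  then show ?thesis using \<open>c \<ge> 0\<close> by (cases "g = 0") auto
qed

context bounded_domain
begin

text \<open>All that the passage m to infinity uses about v_m. The quadratic constant depends on
  \<sigma> and \<beta> but not on m.\<close>

definition approximates :: "real \<Rightarrow> real \<Rightarrow> ('a \<Rightarrow> real) \<Rightarrow> bool" where
  "approximates \<sigma> m v \<longleftrightarrow> (\<forall>x\<in>\<Omega>. 0 < v x \<and> v x \<le> bdist x \<and> bdist x - DIM('a) / m \<le> v x \<and>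
     (v has_derivative (\<lambda>h. grad v x \<bullet> h)) (at x) \<and> norm (grad v x) \<le> 1 \<and>
     (\<forall>\<beta> h. \<beta> > 0 \<longrightarrow> 2 * \<beta> \<le> bdist x \<longrightarrow> norm h < \<beta> \<longrightarrow>
        v (x + h) \<le> v x + grad v x \<bullet> h + (max (2/\<sigma>) (1/\<beta>) + 1) / 2 * (norm h)\<^sup>2))"

lemma minimizer_approximates:
  assumes C2: "C2_boundary \<Omega>"
  obtains \<sigma> where "\<sigma> > 0" "\<And>m v. m > 0 \<Longrightarrow> 2 * DIM('a) / m \<le> \<sigma> \<Longrightarrow> is_minimizer \<Omega> m v
     \<Longrightarrow> continuous_on \<Omega> v \<Longrightarrow> approximates \<sigma> m v"
proof -
  obtain R where R: "R > 0"
    "\<And>x z. x \<in> \<Omega> \<Longrightarrow> z \<notin> \<Omega> \<Longrightarrow> dist x z = bdist x \<Longrightarrow> ball (z + (R / dist x z) *\<^sub>R (x - z)) R \<subseteq> \<Omega>"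
    using interior_ball[OF C2] by blast
  \<comment> \<open>\<open>dobst_contact\<close> gives contact up to distance R / 2 once \<rho>
    \<le> R / 2.\<close>
  define \<sigma> where "\<sigma> = R / 2"
  have \<sigma>: "\<sigma> > 0" using R by (simp add: \<sigma>_def)
  have "approximates \<sigma> m v"
    if m: "m > 0" "2 * DIM('a) / m \<le> \<sigma>" and min: "is_minimizer \<Omega> m v" and cv: "continuous_on \<Omega> v" for m v
  proof -
    define \<rho> where "\<rho> = 2 * DIM('a) / m"
    have \<rho>: "\<rho> > 0" "\<rho> \<le> \<sigma>" "2 * DIM('a) / \<rho> = m" "\<rho> / 2 = DIM('a) / m" using m by (auto simp: \<rho>_def)
    have "dobst \<rho> t x = bdist x" if "bdist x \<le> \<sigma>" for t x
      by (rule dobst_contact[OF \<rho>(1) _ R(2)]) (use \<rho>(2) that in \<open>simp_all add: \<sigma>_def\<close>)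
    then obtain \<tau> u where ol: "obst_limit \<Omega> \<rho> \<sigma> \<tau> u"
      using obst_limit_exists[OF \<rho>(1) \<sigma>] by blast
    interpret obst_limit \<Omega> \<rho> \<sigma> \<tau> u by (rule ol)
    have eq: "v x = u x" if "x \<in> \<Omega>" for x
      using minimizer_eq_u[OF C2 \<rho>(2) cv _ that] min \<rho>(3) by simp
    show ?thesis
      unfolding approximates_def
    proof (intro ballI conjI allI impI)
      fix x assume x: "x \<in> \<Omega>"
      show "0 < v x" "v x \<le> bdist x" "bdist x - DIM('a) / m \<le> v x"
        using eq[OF x] u_pos[OF \<rho>(2) x] u_le_bdist[of x] u_ge[of x] \<rho>(4) by auto
      have "(v has_derivative (\<lambda>h. grad u x \<bullet> h)) (at x)"
        by (rule has_derivative_transform_within_open[OF u_has_derivative[OF x] open_dom x]) (use eq in auto)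
      then have g: "grad v x = grad u x" "(v has_derivative (\<lambda>h. grad u x \<bullet> h)) (at x)"
        by (auto intro: grad_eqI)
      then show "(v has_derivative (\<lambda>h. grad v x \<bullet> h)) (at x)" by simp
      show "norm (grad v x) \<le> 1" using norm_grad_u_le[OF x] g by simp
      fix \<beta> :: real and h :: 'a
      assume b: "0 < \<beta>" "2 * \<beta> \<le> bdist x" "norm h < \<beta>"
      have "bdist (x + h) > 0" using bdist_Lipschitz[of x "x + h"] b by (simp add: dist_norm)
      then have "x + h \<in> \<Omega>" using bdist_pos_iff by blast
      then show "v (x + h) \<le> v x + grad v x \<bullet> h + (max (2/\<sigma>) (1/\<beta>) + 1) / 2 * (norm h)\<^sup>2"
        using u_supergradient[OF b] eq x g(1) by (simp add: semi_def)
    qed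
  qed
  then show ?thesis using that \<sigma> by blast
qed

text \<open>By compactness, a violating sequence x k with gradients p k converges to some (y, q).
  Points of \<open>Eset\<close> satisfy v \<ge> lam, hence stay at distance at least lam from the
  boundary, where the supergradient constant is uniform. So q is a supergradient of d at y, and
  \<open>rad_ge_of_supergradient\<close> places y on the medial axis.\<close>

lemma Eset_near_medial_axis:
  assumes app: "eventually (\<lambda>m. approximates \<sigma> m (v m)) at_top" and "lam > 0" "\<delta> > 0"
  shows "eventually (\<lambda>m. \<forall>x\<in>Eset \<Omega> (v m) lam. \<exists>y\<in>medial_axis \<Omega> lam. dist x y < \<delta>) at_top"
proof (rule ccontr)
  assume neg: "\<not> ?thesis"
  obtain M where M: "\<And>m. m \<ge> M \<Longrightarrow> approximates \<sigma> m (v m)" using app by (auto simp: eventually_at_top_linorder)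
  have "\<exists>m x. m \<ge> max M (real (Suc k)) \<and> x \<in> Eset \<Omega> (v m) lam \<and> (\<forall>y\<in>medial_axis \<Omega> lam. \<not> dist x y < \<delta>)" for k
    using neg unfolding eventually_at_top_linorder by blast
  then obtain m x where mx: "\<And>k::nat. m k \<ge> max M (real (Suc k))" "\<And>k. x k \<in> Eset \<Omega> (v (m k)) lam"
    "\<And>k y. y \<in> medial_axis \<Omega> lam \<Longrightarrow> \<not> dist (x k) y < \<delta>" by metis
  define V where "V k = v (m k) (x k)" for k
  define p where "p k = grad (v (m k)) (x k)" for k
  have x\<Omega>: "x k \<in> \<Omega>" for k using mx(2)[of k] by (simp add: Eset_def)
  have A: "0 < v (m k) y \<and> v (m k) y \<le> bdist y \<and> bdist y - DIM('a) / m k \<le> v (m k) y" if "y \<in> \<Omega>" for k y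
    using M[of "m k"] mx(1)[of k] that unfolding approximates_def by auto
  have Vp: "V k > 0" "V k \<le> bdist (x k)" for k using A[OF x\<Omega>] by (auto simp: V_def)
  have pn: "norm (p k) \<le> 1" for k
    using M[of "m k"] mx(1)[of k] x\<Omega>[of k] unfolding approximates_def p_def by auto
  have pE: "(norm (p k))\<^sup>2 \<le> 1 - lam\<^sup>2 / (V k)\<^sup>2" for k
    using mx(2)[of k] by (simp add: Eset_def p_def V_def)
  have VL: "V k \<ge> lam" for k
  proof -
    have "lam\<^sup>2 / (V k)\<^sup>2 \<le> 1" using pE[of k] zero_le_power2[of "norm (p k)"] by linarith
    then have "lam\<^sup>2 \<le> (V k)\<^sup>2" using Vp(1)[of k] by simp
    then show ?thesis by (rule power2_le_imp_le) (use Vp(1)[of k] in simp)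
  qed
  \<comment> \<open>Since d \<ge> V \<ge> lam along the sequence, the condition 2 \<beta> \<le> d
    holds at every x k.\<close>
  define \<beta> where "\<beta> = lam / 2"
  define C where "C = (max (2/\<sigma>) (1/\<beta>) + 1) / 2"
  have \<beta>: "\<beta> > 0" using \<open>lam > 0\<close> by (simp add: \<beta>_def)
  have "C \<ge> 0" using \<beta> by (simp add: C_def le_max_iff_disj)
  \<comment> \<open>The supergradient inequality of v, with v replaced by d on both sides: this
    costs n / m on the left and nothing on the right, where v \<le> d.\<close>
  have up: "bdist (x k + h) - DIM('a) / m k \<le> bdist (x k) + p k \<bullet> h + C * (norm h)\<^sup>2" if h: "norm h < \<beta>" for k h
  proof -
    have d: "2 * \<beta> \<le> bdist (x k)" using VL[of k] Vp(2)[of k] by (simp add: \<beta>_def)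
    have "bdist (x k + h) > 0" using bdist_Lipschitz[of "x k" "x k + h"] h d \<beta> by (simp add: dist_norm)
    then have "x k + h \<in> \<Omega>" using bdist_pos_iff by blast
    then have "bdist (x k + h) - DIM('a) / m k \<le> v (m k) (x k + h)" using A by blast
    also have "\<dots> \<le> V k + p k \<bullet> h + C * (norm h)\<^sup>2"
      using M[of "m k"] mx(1)[of k] x\<Omega>[of k] \<beta> d h unfolding approximates_def V_def p_def C_def by auto
    finally show ?thesis using Vp(2)[of k] by linarith
  qed
  have "bounded (range (\<lambda>k. (x k, p k)))"
  proof -
    have "bounded (\<Omega> \<times> cball (0::'a) 1)" using bounded_dom by (intro bounded_Times) auto
    then show ?thesis by (rule bounded_subset) (use x\<Omega> pn in auto)
  qed
  then obtain l r where lr: "strict_mono r" "((\<lambda>k. (x k, p k)) \<circ> r) \<longlonglongrightarrow> l"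
    using bounded_imp_convergent_subsequence by metis
  obtain y q where l: "l = (y, q)" by (cases l)
  have xy: "(\<lambda>k. x (r k)) \<longlonglongrightarrow> y" and pq: "(\<lambda>k. p (r k)) \<longlonglongrightarrow> q"
    using tendsto_fst[OF lr(2)] tendsto_snd[OF lr(2)] by (auto simp: l o_def)
  have cb: "isCont bdist z" for z using continuous_bdist[of UNIV] by (simp add: continuous_on_eq_continuous_at)
  have bdy: "(\<lambda>k. bdist (x (r k))) \<longlonglongrightarrow> bdist y" by (rule isCont_tendsto_compose[OF cb xy])
  have "lam \<le> bdist y" by (rule LIMSEQ_le_const[OF bdy]) (use VL Vp(2) order_trans in blast)
  then have by0: "bdist y > 0" using \<open>lam > 0\<close> by linarith
  then have y: "y \<in> \<Omega>" using bdist_pos_iff by blast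
  have m0: "(\<lambda>k. DIM('a) / m (r k)) \<longlonglongrightarrow> 0"
  proof (rule Lim_null_comparison[OF always_eventually])
    show "\<forall>k. norm (DIM('a) / m (r k)) \<le> DIM('a) / real (Suc k)"
    proof
      fix k
      have "real (Suc k) \<le> real (Suc (r k))" using seq_suble[OF lr(1), of k] by simp
      also have "\<dots> \<le> m (r k)" using mx(1)[of "r k"] by simp
      finally have "real (Suc k) \<le> m (r k)" .
      moreover from this have "m (r k) > 0" by (rule less_le_trans[rotated]) simp
      ultimately show "norm (DIM('a) / m (r k)) \<le> DIM('a) / real (Suc k)" by (simp add: frac_le)
    qed
    show "(\<lambda>k. DIM('a) / real (Suc k)) \<longlonglongrightarrow> 0" by (rule LIMSEQ_Suc[OF lim_const_over_n])
  qed
  have "lam \<le> rad \<Omega> y"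
  proof (rule rad_ge_of_supergradient[OF y \<beta> \<open>C \<ge> 0\<close>])
    fix h :: 'a assume h: "norm h < \<beta>"
    have l1: "(\<lambda>k. bdist (x (r k) + h) - DIM('a) / m (r k)) \<longlonglongrightarrow> bdist (y + h) - 0"
      by (intro tendsto_diff m0 isCont_tendsto_compose[OF cb] tendsto_add xy tendsto_const)
    have l2: "(\<lambda>k. bdist (x (r k)) + p (r k) \<bullet> h + C * (norm h)\<^sup>2) \<longlonglongrightarrow> bdist y + q \<bullet> h + C * (norm h)\<^sup>2"
      by (intro tendsto_intros bdy pq)
    have "bdist (y + h) - 0 \<le> bdist y + q \<bullet> h + C * (norm h)\<^sup>2"
      by (rule LIMSEQ_le[OF l1 l2]) (use up[OF h] in blast)
    then show "bdist (y + h) \<le> bdist y + q \<bullet> h + C * (norm h)\<^sup>2" by simp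
  next
    have l1: "(\<lambda>k. (norm (p (r k)))\<^sup>2) \<longlonglongrightarrow> (norm q)\<^sup>2" by (intro tendsto_intros pq)
    have l2: "(\<lambda>k. 1 - lam\<^sup>2 / (bdist (x (r k)))\<^sup>2) \<longlonglongrightarrow> 1 - lam\<^sup>2 / (bdist y)\<^sup>2"
      using by0 by (intro tendsto_intros bdy) auto
    have "(norm (p k))\<^sup>2 \<le> 1 - lam\<^sup>2 / (bdist (x k))\<^sup>2" for k
    proof -
      have "lam\<^sup>2 / (bdist (x k))\<^sup>2 \<le> lam\<^sup>2 / (V k)\<^sup>2"
        using Vp[of k] by (intro divide_left_mono power_mono mult_pos_pos) auto
      then show ?thesis using pE[of k] by linarith
    qed
    then show "(norm q)\<^sup>2 \<le> 1 - lam\<^sup>2 / (bdist y)\<^sup>2" by (intro LIMSEQ_le[OF l1 l2]) auto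
  qed (use \<open>lam > 0\<close> in simp)
  then have "y \<in> medial_axis \<Omega> lam" using y by (simp add: medial_axis_def)
  moreover have "eventually (\<lambda>k. dist (x (r k)) y < \<delta>) sequentially" using tendstoD[OF xy \<open>\<delta> > 0\<close>] .
  ultimately show False using mx(3) by (auto simp: eventually_sequentially)
qed

text \<open>A maximum point \<open>y\<close> of \<open>v - s |\<cdot> - x|\<close> satisfies \<open>|\<nabla>v(y)| \<le> s\<close>; it is close to \<open>x\<close> because the
  distance function grows from \<open>x\<close> at most at the rate \<open>|x - c| / bdist x < s\<close>.\<close>

lemma medial_axis_near_Eset:
  assumes app: "eventually (\<lambda>m. approximates \<sigma> m (v m)) at_top"
    and cv: "eventually (\<lambda>m. continuous_on \<Omega> (v m)) at_top"
    and "lam > 0" "\<epsilon> > 0" "\<delta> > 0"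
  shows "eventually (\<lambda>m. \<forall>x\<in>medial_axis \<Omega> (lam + \<epsilon>). \<exists>y\<in>Eset \<Omega> (v m) lam. dist x y < \<delta>) at_top"
proof -
  obtain D where D: "D > 0" "\<And>x. bdist x \<le> D" using bdist_bounded by metis
  define L where "L = lam + \<epsilon>"
  \<comment> \<open>Half of \<epsilon> separates L from L1 and yields the slope gap; the other half
    separates L1 from lam and absorbs the difference between v and d.\<close>
  define L1 where "L1 = lam + \<epsilon> / 2"
  have L: "0 < L1" "L1 < L" "0 < L" using assms by (auto simp: L_def L1_def)
  have LL: "L\<^sup>2 - L1\<^sup>2 > 0" using L by (simp add: power_strict_mono)
  \<comment> \<open>With a the growth rate of d at x, the difference s^2 - a^2 is at least (L^2 -
    L1^2) / D^2 = 2 \<eta>. Since s + a \<le> 2, this gives s - a \<ge> \<eta>.\<close>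
  define \<eta> where "\<eta> = (L\<^sup>2 - L1\<^sup>2) / (2 * D\<^sup>2)"
  have \<eta>: "\<eta> > 0" using LL D by (simp add: \<eta>_def)
  \<comment> \<open>Below \<delta> as required; at most L / 2 so that the ball stays in \<Omega>,
    because d \<ge> L; at most \<eta> L so that the quadratic growth \<delta>'^2 / (2 d) uses only
    half of the gain \<eta> \<delta>'.\<close>
  define \<delta>' where "\<delta>' = min (\<delta> / 2) (min (L / 2) (\<eta> * L))"
  have \<delta>': "\<delta>' > 0" "\<delta>' < \<delta>" "\<delta>' \<le> L / 2" "\<delta>' \<le> \<eta> * L" using \<open>\<delta> > 0\<close> \<eta> L by (auto simp: \<delta>'_def)
  \<comment> \<open>A threshold for n / m. The first bound excludes a maximum on the sphere of
    radius \<delta>'; the second ensures lam / v(y) \<le> L1 / d.\<close>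
  define \<mu> where "\<mu> = min (\<eta> * \<delta>' / 2) (\<epsilon> * L / (2 * L1))"
  have \<mu>: "\<mu> > 0" using \<eta> \<delta>' L assms by (simp add: \<mu>_def)
  have small: "eventually (\<lambda>m. DIM('a) / m < \<mu>) at_top"
  proof -
    have "((\<lambda>m::real. DIM('a) / m) \<longlongrightarrow> 0) at_top"
      by (rule tendsto_divide_0[OF tendsto_const filterlim_at_top_imp_at_infinity[OF filterlim_ident]])
    then show ?thesis using \<mu> by (rule order_tendstoD(2))
  qed
  show ?thesis
    using app cv small
  proof (eventually_elim, intro ballI)
    case (elim m)
    fix x assume x: "x \<in> medial_axis \<Omega> (lam + \<epsilon>)"
    let ?v = "v m"
    define q where "q = DIM('a) / m"
    have q: "q < \<mu>" using elim by (simp add: q_def)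
    have x\<Omega>: "x \<in> \<Omega>" and rx: "rad \<Omega> x \<ge> L" using x by (auto simp: medial_axis_def L_def)
    have A: "0 < ?v y" "?v y \<le> bdist y" "bdist y - q \<le> ?v y" "(?v has_derivative (\<lambda>h. grad ?v y \<bullet> h)) (at y)"
      if "y \<in> \<Omega>" for y using elim(1) that unfolding approximates_def q_def by auto
    define d where "d = bdist x"
    obtain c where c: "(norm (x - c))\<^sup>2 + (max 0 (rad \<Omega> x))\<^sup>2 \<le> d\<^sup>2"
      "\<And>h. (bdist (x + h))\<^sup>2 \<le> d\<^sup>2 + 2 * (h \<bullet> (x - c)) + (norm h)\<^sup>2"
      using rad_center[OF x\<Omega>] unfolding d_def by metis
    have d0: "d > 0" using x\<Omega> bdist_pos_iff by (simp add: d_def)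
    have "L\<^sup>2 \<le> (max 0 (rad \<Omega> x))\<^sup>2" using rx L by (intro power_mono) auto
    then have cL: "(norm (x - c))\<^sup>2 + L\<^sup>2 \<le> d\<^sup>2" using c(1) by linarith
    have dL: "d \<ge> L"
    proof -
      have "L\<^sup>2 \<le> d\<^sup>2" using cL zero_le_power2[of "norm (x - c)"] by linarith
      then show ?thesis by (rule power2_le_imp_le) (use d0 in simp)
    qed
    have dD: "d \<le> D" using D by (simp add: d_def)
    define a where "a = norm (x - c) / d"
    have a: "a \<ge> 0" "a * d = norm (x - c)" using d0 by (auto simp: a_def)
    have a2: "a\<^sup>2 \<le> 1 - L\<^sup>2 / d\<^sup>2"
    proof -
      have "a\<^sup>2 + L\<^sup>2 / d\<^sup>2 = ((norm (x - c))\<^sup>2 + L\<^sup>2) / d\<^sup>2" by (simp add: a_def power_divide add_divide_distrib)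
      also have "\<dots> \<le> 1" using cL d0 by simp
      finally show ?thesis by simp
    qed
    define s where "s = sqrt (1 - L1\<^sup>2 / d\<^sup>2)"
    have L1d: "L1\<^sup>2 / d\<^sup>2 \<le> 1" using L dL d0 by (simp add: power_mono)
    then have s: "s \<ge> 0" "s\<^sup>2 = 1 - L1\<^sup>2 / d\<^sup>2" "s \<le> 1"
      by (auto simp: s_def)
    have s2a2: "s\<^sup>2 - a\<^sup>2 \<ge> 2 * \<eta>"
    proof -
      have "2 * (A / (2 * B)) = A / B" for A B :: real by simp
      then have "2 * \<eta> = (L\<^sup>2 - L1\<^sup>2) / D\<^sup>2" unfolding \<eta>_def .
      also have "\<dots> \<le> (L\<^sup>2 - L1\<^sup>2) / d\<^sup>2" using LL d0 dD by (intro divide_left_mono power_mono) auto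
      also have "\<dots> \<le> s\<^sup>2 - a\<^sup>2" using a2 s(2) by (simp add: diff_divide_distrib)
      finally show ?thesis .
    qed
    have sa: "s - a \<ge> \<eta>"
    proof -
      have "a\<^sup>2 \<le> s\<^sup>2" using s2a2 \<eta> by linarith
      then have as: "a \<le> s" using s(1) by (rule power2_le_imp_le)
      have "2 * \<eta> \<le> (s - a) * (s + a)" using s2a2 by (simp add: power2_eq_square algebra_simps)
      also have "\<dots> \<le> (s - a) * 2" using as s(3) by (intro mult_left_mono) auto
      finally show ?thesis by simp
    qed
    \<comment> \<open>The bound on d(x + h)^2 from \<open>rad_center\<close> becomes a perfect
      square after adding a nonnegative term.\<close>
    have grow: "bdist (x + h) \<le> d + a * norm h + (norm h)\<^sup>2 / (2 * d)" for h
    proof (rule power2_le_imp_le)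
      have "h \<bullet> (x - c) \<le> norm h * (a * d)" using norm_cauchy_schwarz[of h "x - c"] a(2) by simp
      then have "(bdist (x + h))\<^sup>2 \<le> d\<^sup>2 + 2 * (norm h * (a * d)) + (norm h)\<^sup>2" using c(2)[of h] by linarith
      also have "\<dots> \<le> d\<^sup>2 + 2 * d * (a * norm h + (norm h)\<^sup>2 / (2 * d)) + (a * norm h + (norm h)\<^sup>2 / (2 * d))\<^sup>2"
        using d0 by (simp add: algebra_simps)
      also have "\<dots> = (d + a * norm h + (norm h)\<^sup>2 / (2 * d))\<^sup>2"
        by (simp add: power2_eq_square algebra_simps)
      finally show "(bdist (x + h))\<^sup>2 \<le> (d + a * norm h + (norm h)\<^sup>2 / (2 * d))\<^sup>2" .
      show "0 \<le> d + a * norm h + (norm h)\<^sup>2 / (2 * d)" using d0 a by simp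
    qed
    have sub: "cball x \<delta>' \<subseteq> \<Omega>"
    proof -
      have "cball x \<delta>' \<subseteq> ball x (bdist x)" using \<delta>' dL L unfolding d_def by auto
      then show ?thesis using ball_bdist_subset by blast
    qed
    define F where "F y = ?v y - s * norm (y - x)" for y
    have "continuous_on (cball x \<delta>') F"
      unfolding F_def by (intro continuous_intros continuous_on_subset[OF elim(2) sub])
    then obtain y where y: "y \<in> cball x \<delta>'" "\<And>z. z \<in> cball x \<delta>' \<Longrightarrow> F z \<le> F y"
      using continuous_attains_sup[of "cball x \<delta>'" F] \<delta>' by auto
    have y\<Omega>: "y \<in> \<Omega>" using y sub by blast
    have Fx: "F x \<ge> d - q" using A(3)[OF x\<Omega>] by (simp add: F_def d_def)
    have Fyx: "F x \<le> F y" using y(2)[of x] \<delta>' by simp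
    \<comment> \<open>On the sphere of radius \<delta>' the slope gap gives F \<le> d - \<eta>
      \<delta>' / 2, which is less than d - q and hence less than F x.\<close>
    have int: "norm (y - x) < \<delta>'"
    proof (rule ccontr)
      assume "\<not> norm (y - x) < \<delta>'"
      then have e: "norm (y - x) = \<delta>'" using y(1) by (simp add: dist_norm norm_minus_commute)
      have "?v y \<le> d + a * \<delta>' + \<delta>'\<^sup>2 / (2 * d)"
        using A(2)[OF y\<Omega>] grow[of "y - x"] e by simp
      moreover have "\<delta>'\<^sup>2 / (2 * d) \<le> \<eta> * \<delta>' / 2"
      proof -
        have "\<delta>' * \<delta>' \<le> \<delta>' * (\<eta> * d)"
          using \<delta>' dL \<eta> by (intro mult_left_mono) (auto intro: order_trans)
        then show ?thesis using d0 by (simp add: power2_eq_square field_simps)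
      qed
      moreover have "\<delta>' * \<eta> \<le> \<delta>' * (s - a)" using sa \<delta>' by simp
      ultimately have "F y \<le> d - \<eta> * \<delta>' / 2" by (simp add: F_def e algebra_simps)
      moreover have "q < \<eta> * \<delta>' / 2" using q by (simp add: \<mu>_def)
      ultimately show False using Fx Fyx by linarith
    qed
    have "norm (grad ?v y) \<le> s"
    proof (rule gradient_norm_le_of_ray[OF A(4)[OF y\<Omega>] _ _ s(1)])
      let ?g = "grad ?v y"
      define e where "e = (\<delta>' - norm (y - x)) / (norm ?g + 1)"
      have g1: "norm ?g + 1 > 0" by (simp add: add_nonneg_pos)
      show "e > 0" unfolding e_def using int g1 by simp
      fix r assume r: "0 < r" "r < e"
      have "r * norm ?g \<le> r * (norm ?g + 1)" using r by simp
      also have "\<dots> < \<delta>' - norm (y - x)" using r g1 unfolding e_def by (simp add: pos_less_divide_eq)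
      finally have rg: "r * norm ?g < \<delta>' - norm (y - x)" .
      have n: "norm (y + r *\<^sub>R ?g - x) \<le> norm (y - x) + r * norm ?g"
        using norm_triangle_ineq[of "y - x" "r *\<^sub>R ?g"] r by (simp add: algebra_simps)
      then have "y + r *\<^sub>R ?g \<in> cball x \<delta>'" using rg by (simp add: dist_norm norm_minus_commute)
      then have "F (y + r *\<^sub>R ?g) \<le> F y" by (rule y(2))
      then have "?v (y + r *\<^sub>R ?g) \<le> ?v y + s * (norm (y + r *\<^sub>R ?g - x) - norm (y - x))"
        by (simp add: F_def algebra_simps)
      also have "\<dots> \<le> ?v y + s * (r * norm ?g)" using n s(1) by (intro add_left_mono mult_left_mono) auto
      finally show "?v (y + r *\<^sub>R ?g) \<le> ?v y + r * (s * norm ?g)" by (simp add: mult.left_commute)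
    qed
    then have "(norm (grad ?v y))\<^sup>2 \<le> s\<^sup>2" by (intro power_mono) auto
    also have "\<dots> \<le> 1 - lam\<^sup>2 / (?v y)\<^sup>2"
    proof -
      have vy: "?v y \<ge> d - q" using Fyx Fx s(1) mult_nonneg_nonneg[OF s(1) norm_ge_zero[of "y - x"]]
        unfolding F_def[of y] by linarith
      have "q < \<epsilon> * L / (2 * L1)" using q by (simp add: \<mu>_def)
      then have "L1 * q \<le> \<epsilon> / 2 * L" using L by (simp add: field_simps)
      also have "\<dots> \<le> \<epsilon> / 2 * d" using dL \<open>\<epsilon> > 0\<close> by (intro mult_left_mono) auto
      finally have "lam * d \<le> L1 * (d - q)" by (simp add: L1_def algebra_simps)
      also have "\<dots> \<le> L1 * ?v y" using vy L by (intro mult_left_mono) auto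
      finally have "lam * d \<le> L1 * ?v y" .
      then have "lam / ?v y \<le> L1 / d" using A(1)[OF y\<Omega>] d0 by (simp add: field_simps)
      then have "(lam / ?v y)\<^sup>2 \<le> (L1 / d)\<^sup>2"
        using A(1)[OF y\<Omega>] \<open>lam > 0\<close> by (intro power_mono) auto
      then show ?thesis using s(2) by (simp add: power_divide)
    qed
    finally have "y \<in> Eset \<Omega> ?v lam" using y\<Omega> by (simp add: Eset_def)
    moreover have "dist x y < \<delta>" using int \<delta>'(2) by (simp add: dist_norm norm_minus_commute)
    ultimately show "\<exists>y\<in>Eset \<Omega> ?v lam. dist x y < \<delta>" by blast
  qed
qed

end

theorem theorem1p6:
  fixes \<Omega> :: "'a::euclidean_space set" and v :: "real \<Rightarrow> 'a \<Rightarrow> real"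
  assumes "open \<Omega>" and "bounded \<Omega>" and "C2_boundary \<Omega>"
    and "\<And>m. m > 0 \<Longrightarrow> is_minimizer \<Omega> m (v m)"
    and "\<And>m. m > 0 \<Longrightarrow> continuous_on \<Omega> (v m)"
    and "lam > 0" and "\<epsilon> > 0"
  shows "(\<forall>\<delta>>0. eventually (\<lambda>m. \<forall>x\<in>Eset \<Omega> (v m) lam.
             \<exists>y\<in>medial_axis \<Omega> lam. dist x y < \<delta>) at_top) \<and>
         (\<forall>\<delta>>0. eventually (\<lambda>m. \<forall>x\<in>medial_axis \<Omega> (lam + \<epsilon>).
             \<exists>y\<in>Eset \<Omega> (v m) lam. dist x y < \<delta>) at_top)"
proof (cases "\<Omega> = {}")
  case True
  then show ?thesis by (simp add: Eset_def medial_axis_def)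
next
  case False
  interpret bounded_domain \<Omega> by unfold_locales fact+
  obtain \<sigma> where \<sigma>: "\<sigma> > 0" "\<And>m v. m > 0 \<Longrightarrow> 2 * DIM('a) / m \<le> \<sigma> \<Longrightarrow> is_minimizer \<Omega> m v
     \<Longrightarrow> continuous_on \<Omega> v \<Longrightarrow> approximates \<sigma> m v"
    using minimizer_approximates[OF assms(3)] by blast
  have large: "eventually (\<lambda>m. m > 0 \<and> 2 * DIM('a) / m \<le> \<sigma>) at_top"
  proof (rule eventually_at_top_linorderI[of "max 1 (2 * DIM('a) / \<sigma>)"])
    fix m assume m: "max 1 (2 * DIM('a) / \<sigma>) \<le> m"
    then have "m > 0" "2 * DIM('a) / \<sigma> \<le> m" by auto
    then show "m > 0 \<and> 2 * DIM('a) / m \<le> \<sigma>" using \<sigma>(1) by (simp add: field_simps)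
  qed
  then have app: "eventually (\<lambda>m. approximates \<sigma> m (v m)) at_top"
    by eventually_elim (use \<sigma>(2) assms(4,5) in blast)
  have cv: "eventually (\<lambda>m. continuous_on \<Omega> (v m)) at_top"
    using large by eventually_elim (use assms(5) in blast)
  show ?thesis
    using Eset_near_medial_axis[OF app assms(6)] medial_axis_near_Eset[OF app cv assms(6,7)] by blast
qed

end
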